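(* Let $a<b$ be coprime positive integers and let $X=\mathsf{NC}(a,b)$ be the set of $a,b$-noncrossing partitions of $[b-1]$. Let $C=\mathbb{Z}_{b-1}$ act on $X$ by rotation (a generator acting by $\mathtt{rot}$). Then the triple $(X,C,X(q))$ exhibits the cyclic sieving phenomenon, where $$X(q)=\mathsf{Cat}_q(a,b)=\frac{1}{[a+b]_q}\begin{bmatrix} a+b\\ a,\ b\end{bmatrix}_q=\frac{[a+b-1]_q!}{[a]_q!\,[b]_q!}.$$
   Context: Let $a<b$ be coprime positive integers and $[b-1]=\{1,\dots,b-1\}$. An $a,b$-Dyck path is a lattice path from $(0,0)$ to $(b,a)$ using unit north and east steps that stays weakly above the line $y=\frac{a}{b}x$. A valley of such a path $D$ is a lattice point of $D$ immediately preceded by an east step and immediately followed by a north step. From each valley $P$ fire the laser $\ell(P)$: the segment of slope $\frac ab$ from $P$ going northeast until it first meets $D$ again. Label the east endpoints of the first $b-1$ east steps of $D$ from left to right by $1,\dots,b-1$, each label regarded as sitting slightly below its lattice point. The set partition $\pi(D)$ of $[b-1]$ declares $i\sim j$ iff labels $i,j$ are not separated by any valley laser. $\mathsf{NC}(a,b)=\{\pi(D): D\text{ an }a,b\text{-Dyck path}\}$. $\mathtt{rot}$ is the permutation $i\mapsto i+1$ ($i<b-1$), $b-1\mapsto 1$, acting blockwise on set partitions. Notation: $[n]_q=1+q+\cdots+q^{n-1}$, $[n]_q!=[1]_q[2]_q\cdots[n]_q$. Cyclic sieving: for a finite set $X$ with an action of a cyclic group $C=\langle c\rangle$ of order $n$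 and a polynomial $X(q)$ with nonnegative integer coefficients, $(X,C,X(q))$ exhibits the cyclic sieving phenomenon if for every $d\ge 0$, $X(\zeta^d)=|\{x\in X: c^d.x=x\}|$, where $\zeta$ is a primitive $n$-th root of unity. *)

theory Defs
  imports
    "HOL-Analysis.Analysis"
    "HOL-Algebra.Group_Action"
    "HOL-Algebra.Elementary_Groups"
    "HOL-Computational_Algebra.Polynomial_Factorial"
begin

section \<open>Rational Dyck paths\<close>

datatype step = North | East

text \<open>\<open>vertex w k\<close> is the lattice point reached from the origin after the first \<open>k\<close> steps.\<close>

definition vertex :: "step list \<Rightarrow> nat \<Rightarrow> real \<times> real" where
  "vertex w k = (real (count_list (take k w) East), real (count_list (take k w) North))"

definition curve :: "step list \<Rightarrow> (real \<times> real) set" where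
  "curve w = (\<Union>k<length w. closed_segment (vertex w k) (vertex w (Suc k)))"

definition dyck_path :: "nat \<Rightarrow> nat \<Rightarrow> step list \<Rightarrow> bool" where
  "dyck_path a b w \<longleftrightarrow>
     vertex w (length w) = (real b, real a) \<and>
     (\<forall>p\<in>curve w. snd p \<ge> real a / real b * fst p)"

definition valleys :: "step list \<Rightarrow> (real \<times> real) set" where
  "valleys w = {vertex w k |k. 0 < k \<and> k < length w \<and> w ! (k - 1) = East \<and> w ! k = North}"

text \<open>All points reached from \<open>P\<close> in direction \<open>(b, a)\<close> up to and including the first
  point at which the path is met again.\<close>

definition laser :: "nat \<Rightarrow> nat \<Rightarrow> step list \<Rightarrow> real \<times> real \<Rightarrow> (real \<times> real) set" where
  "laser a b w P = {P + t *\<^sub>R (real b, real a) |t.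
     0 \<le> t \<and> (\<forall>s. 0 < s \<and> s < t \<longrightarrow> P + s *\<^sub>R (real b, real a) \<notin> curve w)}"


section \<open>The partition of a Dyck path\<close>

definition east_steps :: "step list \<Rightarrow> nat list" where
  "east_steps w = filter (\<lambda>k. w ! k = East) [0..<length w]"

text \<open>East endpoint of the \<open>i\<close>-th east step, counted from 1.\<close>

definition east_end :: "step list \<Rightarrow> nat \<Rightarrow> real \<times> real" where
  "east_end w i = vertex w (Suc (east_steps w ! (i - 1)))"

text \<open>A laser and the path together enclose a region. Two labels are separated by the laser if,
  when each is placed at a small distance \<open>\<epsilon>\<close> below its lattice point, they lie in different
  connected components of the complement of the path and the laser. The path alone does not
  disconnect the plane, so it is the laser that separates them.\<close>

definition separated :: "nat \<Rightarrow> nat \<Rightarrow> step list \<Rightarrow> real \<times> real \<Rightarrow> nat \<Rightarrow> nat \<Rightarrow> bool" where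
  "separated a b w P i j \<longleftrightarrow>
     (\<forall>\<^sub>F \<epsilon> in at_right 0.
        \<not> connected_component (- (curve w \<union> laser a b w P))
            (east_end w i - (0, \<epsilon>)) (east_end w j - (0, \<epsilon>)))"

definition dyck_partition :: "nat \<Rightarrow> nat \<Rightarrow> step list \<Rightarrow> nat set set" where
  "dyck_partition a b w =
     {1..b - 1} // {(i, j). i \<in> {1..b - 1} \<and> j \<in> {1..b - 1} \<and>
                            \<not> (\<exists>P\<in>valleys w. separated a b w P i j)}"

definition NC :: "nat \<Rightarrow> nat \<Rightarrow> nat set set set" where
  "NC a b = {dyck_partition a b w |w. dyck_path a b w}"


section \<open>Rotation\<close>

definition rot :: "nat \<Rightarrow> nat \<Rightarrow> nat" where
  "rot n i = (if 1 \<le> i \<and> i < n then i + 1 else if i = n then 1 else i)"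

definition rot_blocks :: "nat \<Rightarrow> nat set set \<Rightarrow> nat set set" where
  "rot_blocks n \<pi> = (\<lambda>B. rot n ` B) ` \<pi>"

text \<open>The action of \<open>g\<close> in the integers modulo \<open>b - 1\<close> (represented by \<open>0, \<dots>, b - 2\<close>) is the
  \<open>g\<close>-th power of rotation; the restriction is needed because group actions in the library take
  values in extensional bijections.\<close>

definition rot_action :: "nat \<Rightarrow> nat \<Rightarrow> int \<Rightarrow> nat set set \<Rightarrow> nat set set" where
  "rot_action a b g = restrict (rot_blocks (b - 1) ^^ nat g) (NC a b)"


section \<open>Rational q-Catalan numbers\<close>

definition q_int :: "nat \<Rightarrow> int poly" where
  "q_int n = (\<Sum>i<n. monom 1 i)"

definition q_fact :: "nat \<Rightarrow> int poly" where
  "q_fact n = (\<Prod>k=1..n. q_int k)"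

text \<open>The q-multinomial coefficient of \<open>a + b\<close> over \<open>a, b\<close> and the q-Catalan number are a priori
  only rational functions in \<open>q\<close>.\<close>

definition q_multinomial :: "nat \<Rightarrow> nat \<Rightarrow> int poly fract" where
  "q_multinomial a b = to_fract (q_fact (a + b)) / (to_fract (q_fact a) * to_fract (q_fact b))"

definition q_Catalan :: "nat \<Rightarrow> nat \<Rightarrow> int poly fract" where
  "q_Catalan a b = 1 / to_fract (q_int (a + b)) * q_multinomial a b"


section \<open>Cyclic sieving\<close>

definition primitive_root_of_unity :: "nat \<Rightarrow> complex \<Rightarrow> bool" where
  "primitive_root_of_unity n \<zeta> \<longleftrightarrow> \<zeta> ^ n = 1 \<and> (\<forall>k. 0 < k \<and> k < n \<longrightarrow> \<zeta> ^ k \<noteq> 1)"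

text \<open>The group \<open>C\<close>, generated by \<open>c\<close>, acts on \<open>X\<close> through \<open>\<phi>\<close>.\<close>

definition cyclic_sieving ::
  "'x set \<Rightarrow> ('g, 'm) monoid_scheme \<Rightarrow> 'g \<Rightarrow> ('g \<Rightarrow> 'x \<Rightarrow> 'x) \<Rightarrow> int poly \<Rightarrow> bool" where
  "cyclic_sieving X C c \<phi> p \<longleftrightarrow>
     finite X \<and>
     finite (carrier C) \<and> c \<in> carrier C \<and> generate C {c} = carrier C \<and>
     group_action C X \<phi> \<and>
     (\<forall>i. 0 \<le> coeff p i) \<and>
     (\<forall>\<zeta>. primitive_root_of_unity (Coset.order C) \<zeta> \<longrightarrow>
        (\<forall>d::nat. poly (map_poly complex_of_int p) (\<zeta> ^ d) =
                  of_nat (card {x \<in> X. \<phi> (c [^]\<^bsub>C\<^esub> d) x = x})))"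

end

theory Submission
  imports Defs "HOL-Library.Multiset"
begin

text \<open>Let \<open>h\<^sub>i\<close> be the height of the \<open>i\<close>-th east step of a Dyck path and \<open>g\<^sub>i = b h\<^sub>i - a i\<close>. A laser fired
  from abscissa \<open>i\<close> cuts off exactly the labels between \<open>i\<close> and the next index with a smaller value
  of \<open>g\<close>. Hence two labels are in the same block iff they have the same previous index with a smaller
  value of \<open>g\<close>. The drop of \<open>g\<close> from an index to the next smaller one lies between \<open>1\<close> and \<open>a\<close> and is
  known modulo \<open>b\<close> from the distance of the two indices, so the partition determines the path.
  Rotation by one step amounts to transferring a single rise of the path within the block of \<open>1\<close>.

  Let \<open>b - 1 = e N\<close> with \<open>e \<ge> 2\<close>. The partitions invariant under rotation by \<open>N\<close> correspond to the
  \<open>N\<close>-periodic sequences of north steps with at most \<open>a / e\<close> north steps per period: extend the walk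
  \<open>g\<close> to all integers and group the labels by their previous smaller index as before, where the
  labels that have none form the central block. There are \<open>(N + \<lfloor>a / e\<rfloor>) choose \<lfloor>a / e\<rfloor>\<close> such
  sequences, which is the value of the q-Catalan number at a primitive \<open>e\<close>-th root of unity. The number
  of all partitions follows from the cycle lemma.

  The q-Catalan number \<open>X\<close> satisfies \<open>(1 - q\<^bsup>a+b\<^esup>) X = (1 - q) G\<close> for the Gaussian polynomial \<open>G\<close> of
  degree \<open>a b\<close>. Unimodality of \<open>G\<close> makes the first half of the coefficients of \<open>X\<close> nonnegative, and
  \<open>X\<close> is palindromic.\<close>

section \<open>Dyck walks and previous smaller heights\<close>

text \<open>A Dyck walk has a distinguished starting point, which rotation by \<open>N\<close>
  destroys; the symmetry shows only after extending the walk along the period \<open>b - 1\<close>.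
  The congruence forces the drift of such an extension to be \<open>a\<close> modulo
  \<open>b\<close>. Bounded by \<open>a\<close>, it is either \<open>a\<close> itself, and every
  label has a previous smaller index, or negative, and some labels have none. The two kinds are cut
  back into Dyck walks differently: at a minimum of the values that follow, with \<open>0\<close>
  appended at \<open>b\<close>, or so as to end in a record low, with \<open>0\<close> put at the
  front. Since the relation determines the Dyck walk, invariance is transferred by comparing windows
  cut \<open>N\<close> steps apart: equal relations give equal windows, hence a drift along
  \<open>N\<close>. The delicate point is to read admissible cuts off the relation alone. The value
  at \<open>q = 1\<close> needs the separate count by the cycle lemma: for \<open>e = 1\<close> the
  labels \<open>k\<close> and \<open>k + N\<close> are always related, the central block is no
  longer recognisable, and the same binomial coefficient is \<open>b\<close> times too
  large.\<close>

definition prev_smaller :: "(int \<Rightarrow> int) \<Rightarrow> int \<Rightarrow> int \<Rightarrow> bool" where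
  "prev_smaller g k i \<longleftrightarrow> i < k \<and> g i < g k \<and> (\<forall>j. i < j \<and> j < k \<longrightarrow> g k < g j)"

lemma prev_smaller_unique: "prev_smaller g k i \<Longrightarrow> prev_smaller g k j \<Longrightarrow> i = j"
  unfolding prev_smaller_def by (metis linorder_neqE not_less_iff_gr_or_eq)

locale coprime_slope =
  fixes a b :: int
  assumes a_pos: "0 < a" and a_less_b: "a < b" and coprime_ab: "coprime a b"
begin

text \<open>With \<open>g i = b * h - a * i\<close> for the height \<open>h\<close> of the
  \<open>i\<close>-th east step, the step bound says that heights do not decrease and the congruence
  that they are integers. Values outside \<open>0..b\<close> stay unconstrained.\<close>

definition dyck_walk :: "(int \<Rightarrow> int) \<Rightarrow> bool" where
  "dyck_walk g \<longleftrightarrow> g 0 = 0 \<and> g b = 0 \<and> (\<forall>i. 0 < i \<and> i < b \<longrightarrow> 0 < g i) \<and>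
     (\<forall>i. 0 \<le> i \<and> i < b \<longrightarrow> g i - a \<le> g (i + 1)) \<and>
     (\<forall>i. 0 \<le> i \<and> i \<le> b \<longrightarrow> b dvd g i + a * i)"

lemma dyck_walkD:
  assumes "dyck_walk g"
  shows "g 0 = 0" "g b = 0" "0 < i \<Longrightarrow> i < b \<Longrightarrow> 0 < g i"
    "0 \<le> i \<Longrightarrow> i < b \<Longrightarrow> g i - a \<le> g (i + 1)" "0 \<le> i \<Longrightarrow> i \<le> b \<Longrightarrow> b dvd g i + a * i"
  using assms by (auto simp: dyck_walk_def)

lemma b_gt_1: "1 < b" using a_pos a_less_b by linarith

text \<open>Heights congruent to \<open>-a i\<close> modulo \<open>b\<close> are distinct within a window shorter than \<open>b\<close>,
  so that comparisons of heights below are always strict.\<close>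

lemma heights_distinct:
  assumes "b dvd g i + a * i" "b dvd g j + a * j" "i < j" "j < i + b"
  shows "g i \<noteq> g j"
proof
  assume "g i = g j"
  then have "b dvd a * (j - i)"
    using dvd_diff[OF assms(2,1)] by (simp add: algebra_simps)
  then have "b dvd j - i" using coprime_ab by (simp add: coprime_dvd_mult_right_iff coprime_commute)
  then show False using assms(3,4) zdvd_imp_le[of b "j - i"] by linarith
qed

lemma dyck_walk_neq:
  assumes "dyck_walk g" "0 \<le> i" "i < j" "j \<le> b" "i \<noteq> 0 \<or> j \<noteq> b"
  shows "g i \<noteq> g j"
  using heights_distinct[of g i j] dyck_walkD(5)[OF assms(1)] assms by auto

text \<open>The congruence gives \<open>a\<close> modulo \<open>b\<close>, and the last step down to
  \<open>0\<close> bounds the value by \<open>a < b\<close>. This number becomes the drift of the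
  extension without a central block.\<close>

lemma dyck_walk_last: assumes "dyck_walk g" shows "g (b - 1) = a"
proof -
  have "b dvd g (b-1) + a * (b-1)" using dyck_walkD(5)[OF assms, of "b-1"] b_gt_1 by simp
  moreover have "g (b-1) + a*(b-1) = (g (b-1) - a) + b * a" by (simp add: algebra_simps)
  ultimately have "b dvd g (b-1) - a" by (metis dvd_add_left_iff dvd_triv_left)
  moreover have "g (b-1) - a \<le> 0" using dyck_walkD(2)[OF assms] dyck_walkD(4)[OF assms, of "b-1"] b_gt_1 by simp
  moreover have "0 < g (b-1)" using dyck_walkD(3)[OF assms, of "b-1"] b_gt_1 by simp
  ultimately show ?thesis using a_less_b zdvd_imp_le[of b "a - g (b-1)"]
    by (smt (verit) dvd_minus_iff minus_diff_eq)
qed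

text \<open>Index \<open>0\<close> lies below all interior values and stops every search to the
  left, whatever the values at negative indices are.\<close>

lemma prev_smaller_nonneg:
  assumes "dyck_walk g" "0 < k" "k < b" "prev_smaller g k i"
  shows "0 \<le> i" "prev_smaller g (i + 1) i"
proof -
  show "0 \<le> i"
    using assms(4) dyck_walkD(1)[OF assms(1)] dyck_walkD(3)[OF assms(1), of k] assms(2,3)
    unfolding prev_smaller_def by (metis less_asym not_le)
  show "prev_smaller g (i + 1) i"
    using assms(4) unfolding prev_smaller_def
    by (smt (verit, best))
qed

lemma prev_smaller_exists:
  assumes "dyck_walk g" "0 < k" "k < b"
  obtains i where "prev_smaller g k i" "0 \<le> i"
proof -
  let ?S = "{i. 0 \<le> i \<and> i < k \<and> g i < g k}"
  have fin: "finite ?S" by (rule finite_subset[of _ "{0..k}"]) auto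
  have "0 \<in> ?S" using dyck_walkD(1)[OF assms(1)] dyck_walkD(3)[OF assms(1), of k] assms by auto
  then have m: "Max ?S \<in> ?S" using fin Max_in by blast
  have "g k < g j" if "Max ?S < j" "j < k" for j
  proof -
    have "j \<notin> ?S" using that(1) Max_ge[OF fin, of j] by auto
    then have "g k \<le> g j" using m that by auto
    moreover have "g j \<noteq> g k" using dyck_walk_neq[OF assms(1), of j k] that m assms by auto
    ultimately show ?thesis by linarith
  qed
  then have "prev_smaller g k (Max ?S)" using m unfolding prev_smaller_def by auto
  then show thesis using that m by blast
qed

definition block_rel :: "(int \<Rightarrow> int) \<Rightarrow> int \<Rightarrow> int \<Rightarrow> bool" where
  "block_rel g k l \<longleftrightarrow> (\<exists>i. prev_smaller g k i \<and> prev_smaller g l i)"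

text \<open>The label \<open>i + 1\<close> has \<open>i\<close> as its own previous smaller index,
  so the block begins right after the index shared by its members. This recovers
  \<open>prev_smaller\<close> from the relation alone.\<close>

lemma prev_smaller_iff_block_min:
  assumes g: "dyck_walk g" and k: "0 < k" "k < b"
  shows "prev_smaller g k i \<longleftrightarrow> 0 \<le> i \<and> i < k \<and> block_rel g k (i + 1) \<and>
           (\<forall>j. 0 < j \<and> j < b \<and> block_rel g k j \<longrightarrow> i + 1 \<le> j)"
    (is "_ \<longleftrightarrow> ?R i")
proof -
  obtain p where p: "prev_smaller g k p" "0 \<le> p" using prev_smaller_exists[OF g k] .
  have pk: "p < k" using p by (simp add: prev_smaller_def)
  have Rp: "?R p"
    using p pk prev_smaller_nonneg[OF g k p(1)] prev_smaller_unique[of g k]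
    unfolding block_rel_def by (auto) (metis prev_smaller_def zless_imp_add1_zle)
  have "i = p" if "?R i" for i
    using that Rp k by (smt (verit, best))
  with Rp p show ?thesis by (metis prev_smaller_unique)
qed

text \<open>Downward induction from \<open>b\<close>. The next smaller index \<open>j\<close> of
  \<open>i\<close> is recognised by previous smaller indices: those of the labels between
  \<open>i\<close> and \<open>j\<close> are at least \<open>i\<close>, that of \<open>j\<close> is
  less than \<open>i\<close>. Hence both walks have the same \<open>j\<close>, where they already
  agree.\<close>

lemma dyck_walk_eqI:
  assumes g: "dyck_walk g" and g': "dyck_walk g'"
    and rel: "\<And>k l. 0 < k \<Longrightarrow> k < b \<Longrightarrow> 0 < l \<Longrightarrow> l < b \<Longrightarrow> block_rel g k l \<longleftrightarrow> block_rel g' k l"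
    and i: "0 \<le> i" "i \<le> b"
  shows "g i = g' i"
proof (cases "i = 0")
  case True then show ?thesis using dyck_walkD(1)[OF g] dyck_walkD(1)[OF g'] by simp
next
  case False
  have ps: "prev_smaller g k j \<longleftrightarrow> prev_smaller g' k j" if "0 < k" "k < b" for k j
    unfolding prev_smaller_iff_block_min[OF g that] prev_smaller_iff_block_min[OF g' that]
    using rel[OF that] that by (smt (verit, ccfv_threshold))
  have "0 < i \<and> i \<le> b \<longrightarrow> g i = g' i" for i
  proof (induction "nat (b - i)" arbitrary: i rule: less_induct)
    case less
    show ?case
    proof (intro impI, elim conjE)
      assume i: "0 < i" "i \<le> b"
      show "g i = g' i"
      proof (cases "i = b")
        case True then show ?thesis using dyck_walkD(2)[OF g] dyck_walkD(2)[OF g'] by simp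
      next
        case False
        let ?S = "{j. i < j \<and> j \<le> b \<and> g j < g i}"
        have fin: "finite ?S" by (rule finite_subset[of _ "{i..b}"]) auto
        have "b \<in> ?S" using dyck_walkD(2,3)[OF g] i False by auto
        then have m: "Min ?S \<in> ?S" using fin Min_in by blast
        define j where "j = Min ?S"
        have j: "i < j" "j \<le> b" "g j < g i" using m unfolding j_def by auto
        have above: "g i < g t" if "i < t" "t < j" for t
        proof -
          have "t \<notin> ?S" using that Min_le[OF fin, of t] unfolding j_def by auto
          then have "g i \<le> g t" using that j by auto
          moreover have "g i \<noteq> g t" using dyck_walk_neq[OF g, of i t] that i j by auto
          ultimately show ?thesis by linarith
        qed
        \<comment> \<open>Passing repeatedly to the previous smaller index leads from
          \<open>t\<close> down to \<open>i\<close> without leaving the interval, and each passage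
          lowers \<open>g'\<close>.\<close>
        have above': "i < t \<Longrightarrow> t < j \<Longrightarrow> g' i < g' t" for t
        proof (induction "nat t" arbitrary: t rule: less_induct)
          case less
          have tb: "0 < t" "t < b" using less i j by auto
          obtain p where p: "prev_smaller g t p" "0 \<le> p" using prev_smaller_exists[OF g tb] .
          have "i \<le> p" using p(1) above[OF less.prems] less.prems unfolding prev_smaller_def by force
          moreover have "p < t" "g' p < g' t" using p(1) ps[OF tb] unfolding prev_smaller_def by auto
          ultimately show ?case using less.hyps[of p] less.prems i by (cases "p = i") auto
        qed
        have below': "g' j < g' i"
        proof (cases "j = b")
          case True then show ?thesis using dyck_walkD(2,3)[OF g'] i False by auto
        next
          case jb: False
          have tb: "0 < j" "j < b" using j i jb by auto
          obtain p where p: "prev_smaller g j p" "0 \<le> p" using prev_smaller_exists[OF g tb] .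
          have "p < i" using p(1) above j unfolding prev_smaller_def by (smt (verit))
          moreover have "prev_smaller g' j p" using p(1) ps[OF tb] by simp
          ultimately show ?thesis using j unfolding prev_smaller_def by auto
        qed
        \<comment> \<open>The step into \<open>j\<close> starts at height at least
          \<open>g i\<close>, so the drop from \<open>i\<close> to \<open>j\<close> is at most
          \<open>a\<close>.\<close>
        have "g i \<le> g (j - 1)" using above[of "j-1"] j by (cases "j - 1 = i") auto
        then have 1: "g i - g j \<le> a" using dyck_walkD(4)[OF g, of "j-1"] j i by auto
        have "g' i \<le> g' (j - 1)" using above'[of "j-1"] j by (cases "j - 1 = i") auto
        then have 2: "g' i - g' j \<le> a" using dyck_walkD(4)[OF g', of "j-1"] j i by auto
        have eq: "g j = g' j" using less[of j] j i by auto
        have "b dvd (g i + a * i) - (g' i + a * i)" using dyck_walkD(5)[OF g, of i] dyck_walkD(5)[OF g', of i] i by (intro dvd_diff) auto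
        then have d: "b dvd g i - g' i" by simp
        show ?thesis
        proof (rule ccontr)
          assume "g i \<noteq> g' i"
          then have "b \<le> \<bar>g i - g' i\<bar>" using d dvd_imp_le_int[of "g i - g' i" b] b_gt_1 by auto
          then show False using 1 2 eq j below' a_less_b by linarith
        qed
      qed
    qed
  qed
  then show ?thesis using False i by auto
qed

end

section \<open>Rotation\<close>

context coprime_slope
begin

text \<open>Moving the starting point of the walk from \<open>0\<close> to \<open>1\<close>: the rise at \<open>1\<close>, which belongs to the
  block of \<open>1\<close>, is transferred to the next element \<open>m\<close> of that block (or stays in place
  cyclically, if there is none).\<close>

lemma block_rel_rotate:
  assumes g: "dyck_walk g"
  obtains g' where "dyck_walk g'"
    and "\<And>k l. 0 < k \<Longrightarrow> k < b \<Longrightarrow> 0 < l \<Longrightarrow> l < b \<Longrightarrow>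
      block_rel g' k l \<longleftrightarrow> block_rel g (if k = b - 1 then 1 else k + 1) (if l = b - 1 then 1 else l + 1)"
proof -
  let ?S = "{j. 1 < j \<and> j \<le> b \<and> g j < g 1}"
  have fin: "finite ?S" by (rule finite_subset[of _ "{1..b}"]) auto
  have g1: "0 < g 1" using dyck_walkD(3)[OF g, of 1] b_gt_1 by simp
  have "b \<in> ?S" using dyck_walkD(2)[OF g] g1 b_gt_1 by auto
  then have "Min ?S \<in> ?S" using fin Min_in by blast
  then obtain m where mS: "m = Min ?S" and m: "1 < m" "m \<le> b" "g m < g 1" by auto
  have above: "g 1 < g t" if "1 < t" "t < m" for t
  proof -
    have "t \<notin> ?S" using that Min_le[OF fin, of t] mS by auto
    then have "g 1 \<le> g t" using that m by auto
    moreover have "g 1 \<noteq> g t" using dyck_walk_neq[OF g, of 1 t] that m by auto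
    ultimately show ?thesis by linarith
  qed
  have above1: "g 1 \<le> g t" if "1 \<le> t" "t < m" for t
    using above[of t] that by (cases "t = 1") auto
  have gm0: "0 \<le> g t" if "0 \<le> t" "t \<le> b" for t
    using dyck_walkD(1,2)[OF g] dyck_walkD(3)[OF g, of t] that by (cases "t = 0 \<or> t = b") auto
  have gm1: "g (m - 1) \<le> g m + a" using dyck_walkD(4)[OF g, of "m - 1"] m by auto
  \<comment> \<open>The two offsets differ by \<open>g 1 + a\<close>, which is \<open>b\<close>
    times the height of the first east step: this rise is removed at the front and reinserted at the
    new index \<open>m - 1\<close>.\<close>
  define g' where "g' i = (if i = b then 0 else if i + 1 < m then g (i + 1) - g 1 else g (i + 1) + a)" for i
  have b1: "b dvd g 1 + a" using dyck_walkD(5)[OF g, of 1] b_gt_1 by simp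
  have gb: "g b = 0" "g 0 = 0" using dyck_walkD(1,2)[OF g] by auto
  have g'b1: "g' (b - 1) = a" using m gb by (auto simp: g'_def)
  have dy: "dyck_walk g'"
    unfolding dyck_walk_def
  proof (intro conjI allI impI)
    show "g' 0 = 0" using m b_gt_1 by (auto simp: g'_def)
    show "g' b = 0" by (simp add: g'_def)
    show "0 < g' i" if "0 < i \<and> i < b" for i
      using that above[of "i + 1"] gm0[of "i + 1"] a_pos by (auto simp: g'_def)
    show "g' i - a \<le> g' (i + 1)" if i: "0 \<le> i \<and> i < b" for i
    proof (cases "i = b - 1")
      case True then show ?thesis using g'b1 by (simp add: g'_def)
    next
      case False
      then show ?thesis
        using i dyck_walkD(4)[OF g, of "i + 1"] m gm1 g1 a_pos
        by (auto simp: g'_def algebra_simps) 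
    qed
    show "b dvd g' i + a * i" if i: "0 \<le> i \<and> i \<le> b" for i
    proof (cases "i = b")
      case True then show ?thesis by (simp add: g'_def)
    next
      case False
      then have d: "b dvd g (i + 1) + a * (i + 1)" using i dyck_walkD(5)[OF g, of "i + 1"] by auto
      have "g (i + 1) - g 1 + a * i = g (i + 1) + a * (i + 1) - (g 1 + a)" by (simp add: algebra_simps)
      then have "b dvd g (i + 1) - g 1 + a * i" using dvd_diff[OF d b1] by metis
      moreover have "b dvd g (i + 1) + a + a * i" using d by (simp add: algebra_simps)
      ultimately show ?thesis using False by (auto simp: g'_def)
    qed
  qed
  define \<sigma> where "\<sigma> k = (if k = b - 1 then 1 else k + 1)" for k :: int
  \<comment> \<open>Effect of rotation on previous smaller indices: \<open>0\<close> is replaced by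
    the index just before the reinserted rise. \<open>\<tau>\<close> identifies \<open>0\<close> and
    \<open>m - 1\<close>, but \<open>m - 1\<close> is never a previous smaller index because
    \<open>g m < g (m - 1)\<close>.\<close>
  define \<tau> where "\<tau> i = (if i = 0 then m - 2 else i - 1)" for i :: int
  have ps1: "prev_smaller g 1 0" using gb g1 by (auto simp: prev_smaller_def)
  have key: "\<exists>i. prev_smaller g (\<sigma> k) i \<and> prev_smaller g' k (\<tau> i) \<and> 0 \<le> i \<and> i \<noteq> m - 1"
    if k: "0 < k" "k < b" for k
  proof (cases "k = b - 1")
    case True
    have "prev_smaller g' (b - 1) (m - 2)"
      unfolding prev_smaller_def g'b1
    proof (intro conjI allI impI)
      show "m - 2 < b - 1" using m by simp
      show "g' (m - 2) < a" using m gm1 by (simp add: g'_def)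
      show "a < g' j" if "m - 2 < j \<and> j < b - 1" for j
        using that m dyck_walkD(3)[OF g, of "j + 1"] by (auto simp: g'_def)
    qed
    then show ?thesis using True ps1 m by (intro exI[of _ 0]) (auto simp: \<sigma>_def \<tau>_def)
  next
    case False
    then have \<sigma>: "\<sigma> k = k + 1" and kb: "0 < k + 1" "k + 1 < b" using k by (auto simp: \<sigma>_def)
    obtain i where i: "prev_smaller g (k + 1) i" "0 \<le> i" using prev_smaller_exists[OF g kb] .
    then have ik: "i \<le> k" "g i < g (k + 1)" and ab: "\<And>j. i < j \<Longrightarrow> j < k + 1 \<Longrightarrow> g (k + 1) < g j"
      by (auto simp: prev_smaller_def)
    consider "k + 1 < m" | "m \<le> k + 1" "i = 0" | "m \<le> k + 1" "0 < i" using i by linarith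
    then show ?thesis
    proof cases
      case 1
      have "i \<noteq> 0" using ab[of 1] above[of "k + 1"] 1 k by auto
      then have "prev_smaller g' k (i - 1)"
        using 1 i ik ab k m by (auto simp: prev_smaller_def g'_def)
      then show ?thesis using 1 i ik \<open>i \<noteq> 0\<close> by (intro exI[of _ i]) (auto simp: \<sigma> \<tau>_def)
    next
      case 2
      have "prev_smaller g' k (m - 2)"
        unfolding prev_smaller_def
      proof (intro conjI allI impI)
        show "m - 2 < k" using 2 by simp
        show "g' (m - 2) < g' k" using 2 m gm1 kb ik gb by (simp add: g'_def)
        show "g' k < g' j" if "m - 2 < j \<and> j < k" for j
          using that 2 ab[of "j + 1"] kb m by (auto simp: g'_def)
      qed
      then show ?thesis using 2 i m by (intro exI[of _ i]) (auto simp: \<sigma> \<tau>_def)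
    next
      case 3
      have "m \<le> i"
      proof (rule ccontr)
        assume "\<not> m \<le> i"
        then have "i < m" by simp
        then have "g 1 \<le> g i" using above1[of i] 3 by simp
        moreover have "g (k + 1) \<le> g m"
          using ab[of m] \<open>i < m\<close> 3 by (cases "m = k + 1") auto
        ultimately show False using m ik by linarith
      qed
      then have "prev_smaller g' k (i - 1)"
        using 3 i ik ab kb m by (auto simp: prev_smaller_def g'_def)
      then show ?thesis using 3 i ik \<open>m \<le> i\<close> by (intro exI[of _ i]) (auto simp: \<sigma> \<tau>_def)
    qed
  qed
  have "block_rel g' k l \<longleftrightarrow> block_rel g (\<sigma> k) (\<sigma> l)" if "0 < k" "k < b" "0 < l" "l < b" for k l
  proof -
    note kl = that
    obtain i j where ij: "prev_smaller g (\<sigma> k) i" "prev_smaller g' k (\<tau> i)" "0 \<le> i" "i \<noteq> m - 1"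
        "prev_smaller g (\<sigma> l) j" "prev_smaller g' l (\<tau> j)" "0 \<le> j" "j \<noteq> m - 1"
      using key[OF kl(1,2)] key[OF kl(3,4)] by blast
    have "block_rel g' k l \<longleftrightarrow> \<tau> i = \<tau> j"
      using ij prev_smaller_unique unfolding block_rel_def by metis
    also have "\<dots> \<longleftrightarrow> i = j" using ij by (auto simp: \<tau>_def)
    also have "\<dots> \<longleftrightarrow> block_rel g (\<sigma> k) (\<sigma> l)"
      using ij prev_smaller_unique unfolding block_rel_def by metis
    finally show ?thesis .
  qed
  then show thesis using that dy unfolding \<sigma>_def by blast
qed

section \<open>Partitions as periodic relations on the integers\<close>

definition label :: "int \<Rightarrow> int" where "label x = (x - 1) mod (b - 1) + 1"

lemma label_range: "0 < label x" "label x < b"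
  using b_gt_1 pos_mod_bound[of "b - 1" "x - 1"] pos_mod_sign[of "b - 1" "x - 1"] unfolding label_def by linarith+

lemma label_id: "0 < x \<Longrightarrow> x < b \<Longrightarrow> label x = x"
  by (simp add: label_def mod_pos_pos_trivial)

lemma label_decomp: obtains t where "x = label x + (b - 1) * t"
  using mult_div_mod_eq[of "b - 1" "x - 1"] unfolding label_def
  by (metis add.commute diff_add_cancel add.assoc)

lemma label_period [simp]: "label (x + (b - 1) * t) = label x"
proof -
  have "(x + (b - 1) * t - 1) mod (b - 1) = (x - 1 + (b - 1) * t) mod (b - 1)" by (simp add: algebra_simps)
  then show ?thesis unfolding label_def by simp
qed

lemma label_add_1: "label (x + 1) = (if label x = b - 1 then 1 else label x + 1)"
proof -
  obtain t where t: "x = label x + (b - 1) * t" using label_decomp .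
  have "label (x + 1) = label (label x + 1 + (b - 1) * t)" by (subst t) (simp add: algebra_simps)
  also have "\<dots> = label (label x + 1)" by simp
  also have "\<dots> = (if label x = b - 1 then 1 else label x + 1)"
  proof (cases "label x = b - 1")
    case True
    have "label (1 + (b - 1) * 1) = label 1" by (rule label_period)
    then show ?thesis using True label_id[of 1] b_gt_1 by simp
  next
    case False then show ?thesis using label_id[of "label x + 1"] label_range[of x] by auto
  qed
  finally show ?thesis .
qed

text \<open>A partition of \<open>{1..b - 1}\<close> is represented by the induced \<open>(b - 1)\<close>-periodic equivalence
  relation on the integers, on which rotation acts by translation.\<close>

definition cyclic_rel :: "(int \<Rightarrow> int) \<Rightarrow> int \<Rightarrow> int \<Rightarrow> bool" where
  "cyclic_rel g x y \<longleftrightarrow> block_rel g (label x) (label y)"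

definition shift_rel :: "int \<Rightarrow> (int \<Rightarrow> int \<Rightarrow> bool) \<Rightarrow> int \<Rightarrow> int \<Rightarrow> bool" where
  "shift_rel d R x y \<longleftrightarrow> R (x + d) (y + d)"

definition nc_rels :: "(int \<Rightarrow> int \<Rightarrow> bool) set" where
  "nc_rels = {cyclic_rel g |g. dyck_walk g}"

lemma shift_rel_0 [simp]: "shift_rel 0 R = R"
  by (simp add: shift_rel_def fun_eq_iff)

lemma shift_rel_add: "shift_rel d (shift_rel d' R) = shift_rel (d + d') R"
  by (simp add: shift_rel_def fun_eq_iff algebra_simps)

lemma cyclic_rel_period: "shift_rel ((b - 1) * t) (cyclic_rel g) = cyclic_rel g"
  by (simp add: shift_rel_def fun_eq_iff cyclic_rel_def)

lemma nc_rels_period: "R \<in> nc_rels \<Longrightarrow> shift_rel ((b - 1) * t) R = R"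
  using cyclic_rel_period by (auto simp: nc_rels_def)

lemma nc_rels_shift_1:
  assumes "R \<in> nc_rels" shows "shift_rel 1 R \<in> nc_rels"
proof -
  obtain g where g: "dyck_walk g" "R = cyclic_rel g" using assms by (auto simp: nc_rels_def)
  obtain g' where g': "dyck_walk g'" "\<And>k l. 0 < k \<Longrightarrow> k < b \<Longrightarrow> 0 < l \<Longrightarrow> l < b \<Longrightarrow>
      block_rel g' k l \<longleftrightarrow> block_rel g (if k = b - 1 then 1 else k + 1) (if l = b - 1 then 1 else l + 1)"
    using block_rel_rotate[OF g(1)] by blast
  have "shift_rel 1 R = cyclic_rel g'"
    unfolding fun_eq_iff shift_rel_def g(2) cyclic_rel_def label_add_1
    using g'(2) label_range by metis
  then show ?thesis using g'(1) by (auto simp: nc_rels_def)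
qed

lemma nc_rels_shift:
  assumes "R \<in> nc_rels" shows "shift_rel d R \<in> nc_rels"
proof -
  have pos: "shift_rel (int k) R \<in> nc_rels" for k
  proof (induction k)
    case 0 then show ?case using assms by simp
  next
    case (Suc k)
    have "shift_rel (int (Suc k)) R = shift_rel 1 (shift_rel (int k) R)" by (simp add: shift_rel_add)
    then show ?case using nc_rels_shift_1[OF Suc] by simp
  qed
  \<comment> \<open>Adding a multiple of the period makes a negative shift nonnegative, so that
    iterating the shift by one suffices.\<close>
  have "shift_rel d R = shift_rel d (shift_rel ((b - 1) * \<bar>d\<bar>) R)"
    using nc_rels_period[OF assms] by simp
  also have "\<dots> = shift_rel (int (nat (d + (b - 1) * \<bar>d\<bar>))) R"
  proof -
    have "1 * \<bar>d\<bar> \<le> (b - 1) * \<bar>d\<bar>" using b_gt_1 by (intro mult_right_mono) auto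
    then have "0 \<le> d + (b - 1) * \<bar>d\<bar>" by linarith
    then show ?thesis by (simp add: shift_rel_add)
  qed
  finally show ?thesis using pos by metis
qed

lemma cyclic_rel_inj:
  assumes "dyck_walk g" "dyck_walk g'" "cyclic_rel g = cyclic_rel g'" "0 \<le> i" "i \<le> b"
  shows "g i = g' i"
proof (rule dyck_walk_eqI[OF assms(1,2) _ assms(4,5)])
  fix k l assume "0 < k" "k < b" "0 < l" "l < b"
  then show "block_rel g k l = block_rel g' k l"
    using assms(3) unfolding fun_eq_iff cyclic_rel_def by (metis label_id)
qed

end

section \<open>Periodic walks\<close>

context coprime_slope
begin

text \<open>What remains of a Dyck walk when no base point is singled out: the step bound and the
  congruence, on all integers.\<close>

definition walk :: "(int \<Rightarrow> int) \<Rightarrow> bool" where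
  "walk G \<longleftrightarrow> (\<forall>i. G i - a \<le> G (i + 1)) \<and> (\<forall>i. b dvd G i + a * i)"

definition drift :: "(int \<Rightarrow> int) \<Rightarrow> int \<Rightarrow> int \<Rightarrow> bool" where
  "drift G p c \<longleftrightarrow> (\<forall>i. G (i + p) = G i + c)"

definition shift_walk :: "int \<Rightarrow> (int \<Rightarrow> int) \<Rightarrow> int \<Rightarrow> int" where
  "shift_walk d G i = G (i + d) - G d"

lemma walkD: "walk G \<Longrightarrow> G i - a \<le> G (i + 1)" "walk G \<Longrightarrow> b dvd G i + a * i"
  by (auto simp: walk_def)

lemma driftD: "drift G p c \<Longrightarrow> G (i + p) = G i + c"
  by (auto simp: drift_def)

lemma drift_mult: assumes "drift G p c" shows "drift G (p * t) (c * t)"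
proof -
  have pos: "G (i + p * int k) = G i + c * int k" for i k
  proof (induction k)
    case (Suc k)
    have "G (i + p * int (Suc k)) = G ((i + p * int k) + p)" by (simp add: algebra_simps)
    then show ?case using Suc driftD[OF assms, of "i + p * int k"] by (simp add: algebra_simps)
  qed simp
  have "G (i + p * t) = G i + c * t" for i
  proof (cases "0 \<le> t")
    case True then show ?thesis using pos[of i "nat t"] by simp
  next
    case False
    then show ?thesis using pos[of "i + p * t" "nat (- t)"] by (simp add: algebra_simps)
  qed
  then show ?thesis by (simp add: drift_def)
qed

lemma walk_shift: assumes "walk G" shows "walk (shift_walk d G)"
proof -
  have "b dvd G (i + d) - G d + a * i" for i
    using dvd_diff[OF walkD(2)[OF assms, of "i + d"] walkD(2)[OF assms, of d]]
    by (simp add: algebra_simps)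
  moreover have "G (i + d) - a \<le> G (i + 1 + d)" for i
    using walkD(1)[OF assms, of "i + d"] by (simp add: algebra_simps)
  ultimately show ?thesis unfolding walk_def shift_walk_def by (simp add: algebra_simps)
qed

lemma drift_shift: assumes "drift G p c" shows "drift (shift_walk d G) p c"
proof -
  have "G (i + p + d) = G (i + d) + c" for i
    using driftD[OF assms, of "i + d"] by (simp add: ac_simps)
  then show ?thesis unfolding drift_def shift_walk_def by simp
qed

lemma prev_smaller_shift: "prev_smaller (shift_walk d G) k i \<longleftrightarrow> prev_smaller G (k + d) (i + d)"
proof -
  have "(\<forall>j. i < j \<and> j < k \<longrightarrow> G (k + d) < G (j + d)) \<longleftrightarrow> (\<forall>j. i + d < j \<and> j < k + d \<longrightarrow> G (k + d) < G j)"
    by (metis add_less_cancel_right diff_add_cancel)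
  then show ?thesis unfolding prev_smaller_def shift_walk_def by simp
qed

lemma prev_smaller_drift:
  assumes "drift G p c" shows "prev_smaller G (k + p) (i + p) \<longleftrightarrow> prev_smaller G k i"
proof -
  have "shift_walk p G = (\<lambda>i. G i + (c - G p))" using driftD[OF assms] by (auto simp: shift_walk_def)
  then have "prev_smaller (shift_walk p G) k i \<longleftrightarrow> prev_smaller G k i" by (simp add: prev_smaller_def)
  then show ?thesis by (simp add: prev_smaller_shift)
qed

lemma walk_neq: "walk G \<Longrightarrow> i < j \<Longrightarrow> j < i + b \<Longrightarrow> G i \<noteq> G j"
  using heights_distinct walkD(2) by blast

text \<open>Modulo \<open>b\<close> the drift is \<open>- a * (b - 1)\<close>, that is
  \<open>a\<close>; so a drift below \<open>a\<close> is at most \<open>a - b < 0\<close>. This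
  dichotomy separates the relations without and with a central block.\<close>

lemma walk_drift_cases:
  assumes "walk G" "drift G (b - 1) c" "c \<le> a"
  shows "c = a \<or> c < 0"
proof -
  have "G (b - 1) = G 0 + c" using driftD[OF assms(2), of 0] by simp
  moreover have "b dvd (G (b - 1) + a * (b - 1)) - (G 0 + a * 0)"
    using walkD(2)[OF assms(1)] by (intro dvd_diff)
  moreover have "G (b - 1) + a * (b - 1) - (G 0 + a * 0) = (G (b-1) - G 0 - a) + b * a"
    by (simp add: algebra_simps)
  ultimately have "b dvd (c - a) + b * a" by (simp add: algebra_simps)
  then have "b dvd a - c" by (metis dvd_add_left_iff dvd_triv_left dvd_diff_commute)
  then show ?thesis using assms(3) a_less_b zdvd_imp_le[of b "a - c"] by (cases "c = a") auto
qed

text \<open>The labels without a previous smaller height, which occur only for negative drift, form a single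
  block. It is the central block when the walk has a period smaller than \<open>b - 1\<close>.\<close>

definition walk_rel :: "(int \<Rightarrow> int) \<Rightarrow> int \<Rightarrow> int \<Rightarrow> bool" where
  "walk_rel G x y \<longleftrightarrow> (\<exists>i t. prev_smaller G x i \<and> prev_smaller G y (i + (b - 1) * t)) \<or>
     (\<nexists>i. prev_smaller G x i) \<and> (\<nexists>i. prev_smaller G y i)"

lemma walk_rel_shift: "walk_rel (shift_walk d G) = shift_rel d (walk_rel G)"
proof -
  have "(\<exists>i. prev_smaller (shift_walk d G) x i) \<longleftrightarrow> (\<exists>i. prev_smaller G (x + d) i)" for x
    unfolding prev_smaller_shift by (metis diff_add_cancel)
  moreover have "(\<exists>i t. prev_smaller (shift_walk d G) x i \<and> prev_smaller (shift_walk d G) y (i + (b - 1) * t)) \<longleftrightarrow>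
      (\<exists>i t. prev_smaller G (x + d) i \<and> prev_smaller G (y + d) (i + (b - 1) * t))" for x y
  proof -
    have "(\<exists>i. P (i + d)) \<longleftrightarrow> (\<exists>i. P i)" for P :: "int \<Rightarrow> bool" by (metis diff_add_cancel)
    from this[of "\<lambda>i. \<exists>t. prev_smaller G (x + d) i \<and> prev_smaller G (y + d) (i + (b - 1) * t)"]
    show ?thesis unfolding prev_smaller_shift by (simp add: ac_simps)
  qed
  ultimately show ?thesis unfolding fun_eq_iff walk_rel_def shift_rel_def by simp
qed

lemma walk_rel_drift:
  assumes "drift G p c" shows "shift_rel p (walk_rel G) = walk_rel G"
proof -
  have "shift_walk p G = (\<lambda>i. G i + (c - G p))" using driftD[OF assms] by (auto simp: shift_walk_def)
  then have "prev_smaller (shift_walk p G) = prev_smaller G" by (simp add: prev_smaller_def fun_eq_iff)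
  then show ?thesis unfolding walk_rel_shift[symmetric] by (simp add: walk_rel_def fun_eq_iff)
qed

lemma walk_rel_label:
  assumes "drift G (b - 1) c" shows "walk_rel G x y \<longleftrightarrow> walk_rel G (label x) (label y)"
proof -
  obtain s where s: "x = label x + (b - 1) * s" using label_decomp .
  obtain t where t: "y = label y + (b - 1) * t" using label_decomp .
  have ps: "prev_smaller G (k + (b - 1) * u) i \<longleftrightarrow> prev_smaller G k (i - (b - 1) * u)" for k u i
    using prev_smaller_drift[OF drift_mult[OF assms, of u], of k "i - (b - 1) * u"] by simp
  have 1: "(\<exists>i. prev_smaller G (k + (b - 1) * u) i) \<longleftrightarrow> (\<exists>i. prev_smaller G k i)" for k u
    unfolding ps by (metis add_diff_cancel_right')
  have 2: "(\<exists>i v. prev_smaller G (k + (b - 1) * s) i \<and> prev_smaller G (l + (b - 1) * t) (i + (b - 1) * v)) \<longleftrightarrow>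
    (\<exists>i v. prev_smaller G k i \<and> prev_smaller G l (i + (b - 1) * v))" for k l
  proof safe
    fix i v assume "prev_smaller G (k + (b - 1) * s) i" "prev_smaller G (l + (b - 1) * t) (i + (b - 1) * v)"
    then have "prev_smaller G k (i - (b - 1) * s)" "prev_smaller G l ((i - (b - 1) * s) + (b - 1) * (s + v - t))"
      unfolding ps by (auto simp: algebra_simps)
    then show "\<exists>i v. prev_smaller G k i \<and> prev_smaller G l (i + (b - 1) * v)" by blast
  next
    fix i v assume *: "prev_smaller G k i" "prev_smaller G l (i + (b - 1) * v)"
    have "prev_smaller G (k + (b - 1) * s) (i + (b - 1) * s)"
      "prev_smaller G (l + (b - 1) * t) ((i + (b - 1) * s) + (b - 1) * (v + t - s))"
      unfolding ps using * by (auto simp: algebra_simps)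
    then show "\<exists>i v. prev_smaller G (k + (b - 1) * s) i \<and> prev_smaller G (l + (b - 1) * t) (i + (b - 1) * v)"
      by blast
  qed
  have "walk_rel G (label x + (b - 1) * s) (label y + (b - 1) * t) \<longleftrightarrow> walk_rel G (label x) (label y)"
    unfolding walk_rel_def 1 2 ..
  then show ?thesis using s t by simp
qed

lemma walk_rel_eq_cyclic_rel:
  assumes "drift G (b - 1) c"
    and "\<And>k l. 0 < k \<Longrightarrow> k < b \<Longrightarrow> 0 < l \<Longrightarrow> l < b \<Longrightarrow> walk_rel G k l \<longleftrightarrow> block_rel g k l"
  shows "walk_rel G = cyclic_rel g"
  unfolding fun_eq_iff cyclic_rel_def using walk_rel_label[OF assms(1)] assms(2) label_range by metis

section \<open>Cutting periodic walks into Dyck walks\<close>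

lemma window_eq:
  assumes "0 \<le> (i::int)" "i < b - 1" "0 \<le> i + (b - 1) * t" "i + (b - 1) * t < b - 1"
  shows "t = 0"
proof (rule ccontr)
  assume "t \<noteq> 0"
  define m where "m = (b - 1) * t"
  have "1 * (b - 1) \<le> \<bar>t\<bar> * (b - 1)" using \<open>t \<noteq> 0\<close> b_gt_1 by (intro mult_right_mono) auto
  then have "b - 1 \<le> \<bar>m\<bar>" using b_gt_1 by (simp add: m_def abs_mult mult.commute)
  then show False using assms unfolding m_def[symmetric] by linarith
qed

text \<open>Drift \<open>a\<close> gives the value \<open>a\<close> at \<open>b - 1\<close>, from
  which the step down to the new value \<open>0\<close> at \<open>b\<close> is just allowed.
  Searches from labels \<open>1..b - 1\<close> end inside the window because \<open>G 0\<close> lies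
  below them.\<close>

lemma dyck_walk_of_right_min:
  assumes G: "walk G" "drift G (b - 1) a" "G 0 = 0" "\<And>i. 0 < i \<Longrightarrow> i < b \<Longrightarrow> 0 < G i"
  shows "dyck_walk (G(b := 0))" "walk_rel G = cyclic_rel (G(b := 0))"
proof -
  let ?g = "G(b := 0)"
  have Gb: "G (b - 1) = a" using driftD[OF G(2), of 0] G(3) by simp
  show dy: "dyck_walk ?g"
    unfolding dyck_walk_def using G(3,4) walkD[OF G(1)] Gb b_gt_1
    by auto
  have ps: "prev_smaller G k i \<longleftrightarrow> prev_smaller ?g k i" if "k < b" for k i
    using that unfolding prev_smaller_def by auto
  show "walk_rel G = cyclic_rel ?g"
  proof (rule walk_rel_eq_cyclic_rel[OF G(2)])
    fix k l assume kl: "0 < k" "k < b" "0 < l" "l < b"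
    obtain i where i: "prev_smaller ?g k i" "0 \<le> i" using prev_smaller_exists[OF dy kl(1,2)] .
    obtain j where j: "prev_smaller ?g l j" "0 \<le> j" using prev_smaller_exists[OF dy kl(3,4)] .
    have lt: "i < b - 1" "j < b - 1" using i j kl by (auto simp: prev_smaller_def)
    have "walk_rel G k l \<longleftrightarrow> (\<exists>t. j = i + (b - 1) * t)"
      unfolding walk_rel_def ps[OF kl(2)] ps[OF kl(4)] using i(1) j(1) prev_smaller_unique by blast
    also have "\<dots> \<longleftrightarrow> i = j"
    proof
      assume "\<exists>t. j = i + (b - 1) * t"
      then obtain t where t: "j = i + (b - 1) * t" by blast
      then have "t = 0" using window_eq[of i t] i j lt by simp
      then show "i = j" using t by simp
    qed (auto intro: exI[of _ 0])
    also have "\<dots> \<longleftrightarrow> block_rel ?g k l"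
      unfolding block_rel_def using i j prev_smaller_unique by metis
    finally show "walk_rel G k l \<longleftrightarrow> block_rel ?g k l" .
  qed
qed

text \<open>The new value \<open>0\<close> at index \<open>0\<close> is a sentinel: it catches
  exactly the searches that find nothing in \<open>G\<close>, so the labels without a previous
  smaller index become the block of \<open>1\<close>.\<close>

lemma dyck_walk_of_record:
  assumes G: "walk G" "drift G (b - 1) c" "G b = 0" "\<And>i. 0 < i \<Longrightarrow> i < b \<Longrightarrow> 0 < G i"
  shows "dyck_walk (G(0 := 0))" "walk_rel G = cyclic_rel (G(0 := 0))"
    "\<And>k. 0 < k \<Longrightarrow> k < b \<Longrightarrow> (\<nexists>i. prev_smaller G k i) \<longleftrightarrow> prev_smaller (G(0 := 0)) k 0"
proof -
  let ?g = "G(0 := 0)"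
  have c: "G 1 + c = 0" using driftD[OF G(2), of 1] G(3) by simp
  have "0 < G 1" using G(4) b_gt_1 by simp
  then have cneg: "c < 0" using c by simp
  show dy: "dyck_walk ?g"
    unfolding dyck_walk_def using G(3,4) walkD[OF G(1)] b_gt_1 \<open>0 < G 1\<close> a_pos
    by (auto simp del: One_nat_def simp: less_imp_le order.trans[of "- a" 0])
  \<comment> \<open>Each period to the left adds \<open>- c = G 1\<close> to a value that is
    positive inside the window, so no search can end at an index at most \<open>0\<close>.\<close>
  have left: "G 1 < G j" if "j \<le> 0" for j
  proof -
    obtain t where t: "j = label j + (b - 1) * t" using label_decomp .
    have Gj: "G j = G (label j) + c * t" using driftD[OF drift_mult[OF G(2), of t], of "label j"] t by simp
    have "t < 0"
    proof (rule ccontr)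
      assume "\<not> t < 0"
      then have "0 \<le> (b - 1) * t" using b_gt_1 by simp
      then show False using t label_range[of j] that by linarith
    qed
    then have "(- c) * 1 \<le> (- c) * (- t)" using cneg by (intro mult_left_mono) auto
    then have "- c \<le> c * t" by simp
    then show ?thesis using Gj G(4)[OF label_range, of j] c by linarith
  qed
  have ps: "prev_smaller G k i \<longleftrightarrow> prev_smaller ?g k i \<and> 0 < i" if k: "0 < k" "k < b" for k i
  proof (cases "0 < i")
    case True then show ?thesis unfolding prev_smaller_def using k by auto
  next
    case False
    have "\<not> prev_smaller G k i"
    proof
      assume p: "prev_smaller G k i"
      have "G k \<le> G 1" using p k False unfolding prev_smaller_def by (cases "k = 1") (auto simp: order_less_imp_le)
      moreover have "G i < G k" using p unfolding prev_smaller_def by auto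
      ultimately show False using left[of i] False by auto
    qed
    then show ?thesis using False by simp
  qed
  have ex: "\<exists>i. prev_smaller ?g k i \<and> 0 \<le> i \<and> i < b - 1" if k: "0 < k" "k < b" for k
  proof -
    obtain i where i: "prev_smaller ?g k i" "0 \<le> i" using prev_smaller_exists[OF dy k] .
    moreover have "i < k" using i(1) by (simp add: prev_smaller_def)
    ultimately show ?thesis using k by (intro exI[of _ i]) linarith
  qed
  show none: "(\<nexists>i. prev_smaller G k i) \<longleftrightarrow> prev_smaller ?g k 0" if k: "0 < k" "k < b" for k
  proof -
    obtain i where i: "prev_smaller ?g k i" "0 \<le> i" using ex[OF k] by blast
    then have "prev_smaller ?g k j \<longleftrightarrow> j = i" for j using prev_smaller_unique by metis
    then show ?thesis unfolding ps[OF k] using i(2) by auto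
  qed
  show "walk_rel G = cyclic_rel ?g"
  proof (rule walk_rel_eq_cyclic_rel[OF G(2)])
    fix k l assume kl: "0 < k" "k < b" "0 < l" "l < b"
    obtain i where i: "prev_smaller ?g k i" "0 \<le> i" "i < b - 1" using ex[OF kl(1,2)] by blast
    obtain j where j: "prev_smaller ?g l j" "0 \<le> j" "j < b - 1" using ex[OF kl(3,4)] by blast
    have "walk_rel G k l \<longleftrightarrow> (\<exists>t. 0 < i \<and> 0 < j \<and> j = i + (b - 1) * t) \<or> (i = 0 \<and> j = 0)"
    proof -
      have "prev_smaller ?g k x \<longleftrightarrow> x = i" "prev_smaller ?g l x \<longleftrightarrow> x = j" for x
        using i(1) j(1) prev_smaller_unique by metis+
      then show ?thesis
        unfolding walk_rel_def none[OF kl(1,2)] none[OF kl(3,4)] ps[OF kl(1,2)] ps[OF kl(3,4)] by auto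
    qed
    also have "\<dots> \<longleftrightarrow> i = j"
    proof
      assume "(\<exists>t. 0 < i \<and> 0 < j \<and> j = i + (b - 1) * t) \<or> (i = 0 \<and> j = 0)"
      then show "i = j"
      proof
        assume "\<exists>t. 0 < i \<and> 0 < j \<and> j = i + (b - 1) * t"
        then obtain t where t: "j = i + (b - 1) * t" by blast
        then have "t = 0" using window_eq[of i t] i j by simp
        then show "i = j" using t by simp
      qed simp
    next
      assume "i = j"
      then show "(\<exists>t. 0 < i \<and> 0 < j \<and> j = i + (b - 1) * t) \<or> (i = 0 \<and> j = 0)"
        using i(2) by (cases "i = 0") (auto intro: exI[of _ 0])
    qed
    also have "\<dots> \<longleftrightarrow> block_rel ?g k l"
      unfolding block_rel_def using i j prev_smaller_unique by metis
    finally show "walk_rel G k l \<longleftrightarrow> block_rel ?g k l" .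
  qed
qed

end

lemma exists_first_int:
  fixes P :: "int \<Rightarrow> bool"
  assumes "lo < x" "P x"
  obtains y where "lo < y" "y \<le> x" "P y" "\<And>z. lo < z \<Longrightarrow> z < y \<Longrightarrow> \<not> P z"
proof -
  let ?S = "{z. lo < z \<and> z \<le> x \<and> P z}"
  have fin: "finite ?S" by (rule finite_subset[of _ "{lo..x}"]) auto
  have "Min ?S \<in> ?S" using assms by (intro Min_in[OF fin]) auto
  moreover have "\<not> P z" if "lo < z" "z < Min ?S" for z
    using that Min_le[OF fin, of z] \<open>Min ?S \<in> ?S\<close> by auto
  ultimately show thesis using that by auto
qed

lemma exists_last_int:
  fixes P :: "int \<Rightarrow> bool"
  assumes "x < hi" "P x"
  obtains y where "x \<le> y" "y < hi" "P y" "\<And>z. y < z \<Longrightarrow> z < hi \<Longrightarrow> \<not> P z"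
proof -
  obtain y where "- hi < y" "y \<le> - x" "P (- y)" "\<And>z. - hi < z \<Longrightarrow> z < y \<Longrightarrow> \<not> P (- z)"
    using exists_first_int[of "- hi" "- x" "\<lambda>z. P (- z)"] assms by auto
  then show thesis using that[of "- y"] by (metis minus_less_iff minus_le_iff minus_minus neg_less_iff_less)
qed

context coprime_slope
begin

lemma walk_add_const: assumes "walk G" "b dvd c" shows "walk (\<lambda>i. G i + c)"
  unfolding walk_def
proof (intro conjI allI)
  fix i
  show "G i + c - a \<le> G (i + 1) + c" using walkD(1)[OF assms(1), of i] by simp
  show "b dvd G i + c + a * i" using dvd_add[OF walkD(2)[OF assms(1), of i] assms(2)] by (simp add: ac_simps)
qed

lemma walk_rel_add_const: "walk_rel (\<lambda>i. G i + c) = walk_rel G"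
proof -
  have "prev_smaller (\<lambda>i. G i + c) = prev_smaller G" by (simp add: prev_smaller_def fun_eq_iff)
  then show ?thesis by (simp add: walk_rel_def fun_eq_iff)
qed

text \<open>The record at \<open>b\<close> is moved to height \<open>0\<close>, and index
  \<open>0\<close> is overwritten by the sentinel.\<close>

definition record_window :: "(int \<Rightarrow> int) \<Rightarrow> int \<Rightarrow> int" where
  "record_window G = (\<lambda>i. G i - G b)(0 := 0)"

lemma dyck_walk_of_record':
  assumes G: "walk G" "drift G (b - 1) c" "\<And>i. 0 < i \<Longrightarrow> i < b \<Longrightarrow> G b < G i"
  shows "dyck_walk (record_window G)" "walk_rel G = cyclic_rel (record_window G)"
    "\<And>k. 0 < k \<Longrightarrow> k < b \<Longrightarrow> (\<nexists>i. prev_smaller G k i) \<longleftrightarrow> prev_smaller (record_window G) k 0"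
proof -
  let ?H = "\<lambda>i. G i - G b"
  have "b dvd G b" using walkD(2)[OF G(1), of b] by (metis dvd_add_left_iff dvd_triv_right)
  then have H1: "walk ?H" using walk_add_const[OF G(1), of "- G b"] by simp
  have H2: "drift ?H (b - 1) c" using driftD[OF G(2)] by (simp add: drift_def)
  have rel: "walk_rel ?H = walk_rel G" using walk_rel_add_const[of G "- G b"] by simp
  have ps: "prev_smaller ?H = prev_smaller G" by (simp add: prev_smaller_def fun_eq_iff)
  note * = dyck_walk_of_record[OF H1 H2, folded record_window_def]
  show "dyck_walk (record_window G)" "walk_rel G = cyclic_rel (record_window G)"
    "\<And>k. 0 < k \<Longrightarrow> k < b \<Longrightarrow> (\<nexists>i. prev_smaller G k i) \<longleftrightarrow> prev_smaller (record_window G) k 0"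
    using * G(3) unfolding rel ps by simp_all
qed

lemma exists_walk_min:
  assumes "walk G"
  obtains m where "0 \<le> m" "m < b - 1" "\<And>j. 0 \<le> j \<Longrightarrow> j < b - 1 \<Longrightarrow> j \<noteq> m \<Longrightarrow> G m < G j"
proof -
  have "\<exists>m\<in>{0..<b - 1}. G m = Min (G ` {0..<b - 1})"
    using b_gt_1 Min_in[of "G ` {0..<b - 1}"] by fastforce
  then obtain m where m: "m \<in> {0..<b - 1}" "G m = Min (G ` {0..<b - 1})" by blast
  show thesis
  proof (rule that)
    show "0 \<le> m" "m < b - 1" using m by auto
    fix j assume j: "0 \<le> j" "j < b - 1" "j \<noteq> m"
    have "G m \<le> G j" using m j by simp
    moreover have "G m \<noteq> G j"
      using walk_neq[OF assms, of m j] walk_neq[OF assms, of j m] j m by (cases "m < j") fastforce+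
    ultimately show "G m < G j" by simp
  qed
qed

text \<open>The minimum over one period works: one period further all values have grown by
  \<open>a\<close>.\<close>

lemma exists_right_min:
  assumes "walk G" "drift G (b - 1) a"
  obtains d where "\<And>i. d < i \<Longrightarrow> i < d + b \<Longrightarrow> G d < G i"
proof -
  obtain m where m: "0 \<le> m" "m < b - 1" "\<And>j. 0 \<le> j \<Longrightarrow> j < b - 1 \<Longrightarrow> j \<noteq> m \<Longrightarrow> G m < G j"
    using exists_walk_min[OF assms(1)] by blast
  have "G m < G i" if i: "m < i" "i < m + b" for i
  proof (cases "i < b - 1")
    case False
    have "G i = G (i - (b - 1)) + a" using driftD[OF assms(2), of "i - (b - 1)"] by simp
    moreover have "G m \<le> G (i - (b - 1))"
      using m(3)[of "i - (b - 1)"] False i m(1,2) by (cases "i - (b - 1) = m") auto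
    ultimately show ?thesis using a_pos by simp
  qed (use m i in auto)
  then show thesis using that by blast
qed

text \<open>Mirror image of the right minimum: for negative drift the values one period earlier are
  larger, so the minimum over a period sits at the right end \<open>d + b\<close> of its
  window.\<close>

lemma exists_record:
  assumes "walk G" "drift G (b - 1) c" "c < 0"
  obtains d where "\<And>i. d < i \<Longrightarrow> i < d + b \<Longrightarrow> G (d + b) < G i"
proof -
  obtain m where m: "0 \<le> m" "m < b - 1" "\<And>j. 0 \<le> j \<Longrightarrow> j < b - 1 \<Longrightarrow> j \<noteq> m \<Longrightarrow> G m < G j"
    using exists_walk_min[OF assms(1)] by blast
  have "G m < G i" if i: "m - b < i" "i < m" for i
  proof (cases "0 \<le> i")
    case False
    have "G (i + (b - 1)) = G i + c" using driftD[OF assms(2), of i] by simp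
    moreover have "G m \<le> G (i + (b - 1))"
      using m(3)[of "i + (b - 1)"] False i m(1,2) by (cases "i + (b - 1) = m") auto
    ultimately show ?thesis using assms(3) by simp
  qed (use m i in auto)
  then show thesis using that[of "m - b"] by auto
qed

lemma right_min_window:
  assumes "walk G" "drift G (b - 1) a" "\<And>i. d < i \<Longrightarrow> i < d + b \<Longrightarrow> G d < G i"
  shows "dyck_walk ((shift_walk d G)(b := 0))"
    "shift_rel d (walk_rel G) = cyclic_rel ((shift_walk d G)(b := 0))"
proof -
  let ?H = "shift_walk d G"
  have H: "walk ?H" "drift ?H (b - 1) a" "?H 0 = 0"
    using walk_shift drift_shift assms(1,2) by (auto simp: shift_walk_def)
  have "\<And>i. 0 < i \<Longrightarrow> i < b \<Longrightarrow> 0 < ?H i"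
    using assms(3) by (auto simp: shift_walk_def)
  from dyck_walk_of_right_min[OF H this]
  show "dyck_walk ((shift_walk d G)(b := 0))"
    "shift_rel d (walk_rel G) = cyclic_rel ((shift_walk d G)(b := 0))"
    by (simp_all add: walk_rel_shift)
qed

lemma record_window_shift:
  assumes "walk G" "drift G (b - 1) c" "\<And>i. d < i \<Longrightarrow> i < d + b \<Longrightarrow> G (d + b) < G i"
  shows "dyck_walk (record_window (shift_walk d G))"
    "shift_rel d (walk_rel G) = cyclic_rel (record_window (shift_walk d G))"
    "\<And>k. 0 < k \<Longrightarrow> k < b \<Longrightarrow>
      (\<nexists>i. prev_smaller G (k + d) i) \<longleftrightarrow> prev_smaller (record_window (shift_walk d G)) k 0"
proof -
  let ?H = "shift_walk d G"
  have H: "walk ?H" "drift ?H (b - 1) c"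
    using walk_shift drift_shift assms(1,2) by auto
  have pos: "\<And>i. 0 < i \<Longrightarrow> i < b \<Longrightarrow> ?H b < ?H i"
    using assms(3) by (auto simp: shift_walk_def add.commute)
  note * = dyck_walk_of_record'[OF H pos]
  show "dyck_walk (record_window (shift_walk d G))"
    "shift_rel d (walk_rel G) = cyclic_rel (record_window (shift_walk d G))"
    using *(1,2) by (simp_all add: walk_rel_shift)
  show "(\<nexists>i. prev_smaller G (k + d) i) \<longleftrightarrow> prev_smaller (record_window (shift_walk d G)) k 0"
    if "0 < k" "k < b" for k
  proof -
    have "(\<exists>i. prev_smaller ?H k i) \<longleftrightarrow> (\<exists>i. prev_smaller G (k + d) i)"
      unfolding prev_smaller_shift by (metis diff_add_cancel)
    then show ?thesis using *(3)[of k] that by simp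
  qed
qed

text \<open>After a shift by a suitable cut \<open>d\<close> the relation is that of a Dyck walk;
  closure under rotation undoes the shift.\<close>

lemma walk_rel_in_nc_rels:
  assumes "walk G" "drift G (b - 1) c" "c \<le> a"
  shows "walk_rel G \<in> nc_rels"
proof -
  have "\<exists>d. shift_rel d (walk_rel G) \<in> nc_rels"
  proof (cases "c = a")
    case True
    then obtain d where "\<And>i. d < i \<Longrightarrow> i < d + b \<Longrightarrow> G d < G i"
      using exists_right_min assms(1,2) by blast
    from right_min_window[OF assms(1) _ this] show ?thesis
      using assms(2) True unfolding nc_rels_def by blast
  next
    case False
    then have "c < 0" using walk_drift_cases[OF assms] by simp
    then obtain d where "\<And>i. d < i \<Longrightarrow> i < d + b \<Longrightarrow> G (d + b) < G i"
      using exists_record assms(1,2) by blast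
    from record_window_shift[OF assms(1,2) this] show ?thesis
      unfolding nc_rels_def by blast
  qed
  then obtain d where "shift_rel d (walk_rel G) \<in> nc_rels" ..
  then have "shift_rel (- d) (shift_rel d (walk_rel G)) \<in> nc_rels" by (rule nc_rels_shift)
  then show ?thesis by (simp add: shift_rel_add)
qed

lemma prev_smaller_exists_walk:
  assumes "walk G" "j < k" "k < j + b" "G j < G k"
  obtains i where "prev_smaller G k i" "j \<le> i"
proof -
  obtain i where i: "j \<le> i" "i < k" "G i < G k" "\<And>z. i < z \<Longrightarrow> z < k \<Longrightarrow> \<not> G z < G k"
    using exists_last_int[of j k "\<lambda>i. G i < G k"] assms by blast
  have "G k < G z" if "i < z" "z < k" for z
    using i(4)[OF that] walk_neq[OF assms(1), of z k] that assms i(1) by auto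
  then have "prev_smaller G k i" using i by (auto simp: prev_smaller_def)
  then show thesis using that i by blast
qed

lemma record_if_no_prev_smaller:
  assumes "walk G" "\<nexists>i. prev_smaller G k i" "j < k" "k < j + b"
  shows "G k < G j"
  using prev_smaller_exists_walk[OF assms(1,3,4)] assms(2) walk_neq[OF assms(1,3,4)]
  by (metis linorder_neqE_linordered_idom)

lemma walk_eqI:
  assumes "drift G (b - 1) c" "drift G' (b - 1) c" "G 0 = G' 0"
    and "\<And>i. 0 < i \<Longrightarrow> i < b \<Longrightarrow> G (i + d) - G' (i + d) = K"
  shows "G = G'"
proof -
  have *: "G x - G' x = K" for x
  proof -
    obtain t where t: "x - d = label (x - d) + (b - 1) * t" using label_decomp .
    have x: "x = label (x - d) + d + (b - 1) * t" using t by linarith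
    have "G x = G (label (x - d) + d) + c * t" "G' x = G' (label (x - d) + d) + c * t"
      using driftD[OF drift_mult[OF assms(1), of t], of "label (x - d) + d"]
        driftD[OF drift_mult[OF assms(2), of t], of "label (x - d) + d"] x by simp_all
    then show ?thesis using assms(4)[of "label (x - d)"] label_range[of "x - d"] by simp
  qed
  from *[of 0] have "K = 0" using assms(3) by simp
  then show ?thesis using * by (auto simp: fun_eq_iff)
qed

lemma cyclic_rel_cong:
  assumes "\<And>i. 0 \<le> i \<Longrightarrow> i < b \<Longrightarrow> g i = g' i" "dyck_walk g" "dyck_walk g'"
  shows "cyclic_rel g = cyclic_rel g'"
proof -
  have ps: "prev_smaller g k i \<longleftrightarrow> prev_smaller g' k i" if k: "0 < k" "k < b" for k i
  proof -
    have "prev_smaller g k i \<longleftrightarrow> 0 \<le> i \<and> prev_smaller g k i" using prev_smaller_nonneg(1)[OF assms(2) k] by blast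
    also have "\<dots> \<longleftrightarrow> 0 \<le> i \<and> prev_smaller g' k i" using assms(1) k unfolding prev_smaller_def by auto
    also have "\<dots> \<longleftrightarrow> prev_smaller g' k i" using prev_smaller_nonneg(1)[OF assms(3) k] by blast
    finally show ?thesis .
  qed
  show ?thesis unfolding fun_eq_iff cyclic_rel_def block_rel_def using ps label_range by simp
qed

lemma nc_rels_equiv:
  assumes "R \<in> nc_rels"
  shows "R x x" "R x y \<Longrightarrow> R y x" "R x y \<Longrightarrow> R y z \<Longrightarrow> R x z"
proof -
  obtain g where g: "dyck_walk g" "R = cyclic_rel g" using assms by (auto simp: nc_rels_def)
  show "R x x" using prev_smaller_exists[OF g(1) label_range] unfolding g(2) cyclic_rel_def block_rel_def by metis
  show "R x y \<Longrightarrow> R y x" unfolding g(2) cyclic_rel_def block_rel_def by auto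
  show "R x y \<Longrightarrow> R y z \<Longrightarrow> R x z"
    unfolding g(2) cyclic_rel_def block_rel_def using prev_smaller_unique by blast
qed

text \<open>Let \<open>i\<close> belong to \<open>x, z\<close> and \<open>j\<close> to
  \<open>y, w\<close>. From \<open>g j < g w < g z\<close> follows \<open>j <= i\<close>, as
  \<open>i\<close> is the last index before \<open>z\<close> below \<open>g z\<close>. If
  \<open>j < i\<close>, then \<open>g y < g i < g z < g y\<close>, which is absurd; so
  \<open>i = j\<close>.\<close>

lemma block_rel_noncrossing:
  assumes "x < y" "y < z" "z < w" "block_rel g x z" "block_rel g y w"
  shows "block_rel g x y"
proof -
  obtain i j where i: "prev_smaller g x i" "prev_smaller g z i" and j: "prev_smaller g y j" "prev_smaller g w j"
    using assms(4,5) by (auto simp: block_rel_def)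
  have "g w < g z" using j assms unfolding prev_smaller_def by auto
  then have "g j < g z" using j(2) unfolding prev_smaller_def by auto
  moreover have "j < z" "i < y" using i j assms unfolding prev_smaller_def by auto
  ultimately have "j \<le> i" using i(2) unfolding prev_smaller_def by (metis less_asym not_le)
  moreover have "\<not> j < i"
  proof
    assume "j < i"
    then have "g y < g i" using j(1) \<open>i < y\<close> unfolding prev_smaller_def by auto
    moreover have "g z < g y" using i(2) \<open>i < y\<close> assms unfolding prev_smaller_def by auto
    ultimately show False using i(2) unfolding prev_smaller_def by auto
  qed
  ultimately have "i = j" by simp
  then show ?thesis using i j unfolding block_rel_def by blast
qed

text \<open>Rotation moves \<open>x\<close> to the label \<open>1\<close>, after which the order on
  the window of length \<open>b - 1\<close> starting at \<open>x\<close> is the linear order of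
  labels.\<close>

lemma nc_rels_noncrossing:
  assumes "R \<in> nc_rels" "x < y" "y < z" "z < w" "w < x + (b - 1)" "R x z" "R y w"
  shows "R x y"
proof -
  obtain g where g: "dyck_walk g" "shift_rel (x - 1) R = cyclic_rel g"
    using nc_rels_shift[OF assms(1)] by (auto simp: nc_rels_def)
  have R: "R u v \<longleftrightarrow> block_rel g (u - x + 1) (v - x + 1)" if "x \<le> u" "u < x + (b - 1)" "x \<le> v" "v < x + (b - 1)" for u v
  proof -
    have "R u v \<longleftrightarrow> shift_rel (x - 1) R (u - x + 1) (v - x + 1)" by (simp add: shift_rel_def)
    then show ?thesis using g(2) that by (simp add: cyclic_rel_def label_id)
  qed
  show ?thesis using block_rel_noncrossing[of "x - x + 1" "y - x + 1" "z - x + 1" "w - x + 1" g] assms R by simp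
qed

end

section \<open>Partitions with rotational symmetry\<close>

locale periodic_slope = coprime_slope +
  fixes N e :: int
  assumes N_pos: "0 < N" and e_ge_2: "2 \<le> e" and period: "b - 1 = e * N"
begin

lemma two_N_le: "2 * N \<le> b - 1"
  unfolding period using N_pos e_ge_2 by (intro mult_right_mono) auto

lemma N_not_multiple: "N \<noteq> (b - 1) * t"
proof
  assume "N = (b - 1) * t"
  then have "N * 1 = N * (e * t)" unfolding period by (simp add: algebra_simps)
  then have "e * t = 1" using N_pos by (metis mult_cancel_left less_irrefl)
  then have "e dvd 1" by (metis dvd_triv_left)
  then show False using e_ge_2 by auto
qed

definition periodic_walks :: "(int \<Rightarrow> int) set" where
  "periodic_walks = {G. walk G \<and> G 0 = 0 \<and> (\<exists>c. drift G N c \<and> e * c \<le> a)}"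

lemma periodic_drift: "drift G N c \<Longrightarrow> drift G (b - 1) (e * c)"
  using drift_mult[of G N c e] by (simp add: period mult.commute)

text \<open>If \<open>i\<close> is the previous smaller index of \<open>k\<close>, then
  \<open>i + N\<close> is that of \<open>k + N\<close>, and the two differ modulo
  \<open>b - 1\<close>. Thus the relation alone reveals which labels are central.\<close>

lemma walk_rel_translate_iff:
  assumes "walk G" "drift G N c"
  shows "walk_rel G k (k + N) \<longleftrightarrow> (\<nexists>i. prev_smaller G k i)"
proof -
  have ps: "prev_smaller G (k + N) i \<longleftrightarrow> prev_smaller G k (i - N)" for i
    using prev_smaller_drift[OF assms(2), of k "i - N"] by simp
  have "\<not> (prev_smaller G k i \<and> prev_smaller G (k + N) (i + (b - 1) * t))" for i t
  proof
    assume "prev_smaller G k i \<and> prev_smaller G (k + N) (i + (b - 1) * t)"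
    then have "i = i + (b - 1) * t - N" unfolding ps using prev_smaller_unique by blast
    then have "N = (b - 1) * t" by linarith
    then show False using N_not_multiple by blast
  qed
  moreover have "(\<exists>i. prev_smaller G (k + N) i) \<longleftrightarrow> (\<exists>i. prev_smaller G k i)"
    unfolding ps by (metis add_diff_cancel_right')
  ultimately show ?thesis unfolding walk_rel_def by blast
qed

text \<open>Makes the sign of the drift visible in the relation, so that two walks with the same
  relation fall into the same case.\<close>

lemma central_iff_negative_drift:
  assumes "walk G" "drift G N c" "e * c \<le> a"
  shows "(\<exists>k. walk_rel G k (k + N)) \<longleftrightarrow> e * c < 0"
proof -
  note d = periodic_drift[OF assms(2)]
  have "\<exists>k. \<nexists>i. prev_smaller G k i" if neg: "e * c < 0"
  proof -
    obtain d where d': "\<And>i. d < i \<Longrightarrow> i < d + b \<Longrightarrow> G (d + b) < G i"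
      using exists_record[OF assms(1) d neg] by blast
    let ?g = "record_window (shift_walk d G)"
    have "prev_smaller ?g 1 0"
      using dyck_walkD(3)[OF record_window_shift(1)[OF assms(1) d d'], of 1] b_gt_1
      by (auto simp: prev_smaller_def record_window_def)
    then show ?thesis using record_window_shift(3)[OF assms(1) d d', of 1] b_gt_1 by auto
  qed
  moreover have "e * c < 0" if k: "\<nexists>i. prev_smaller G k i" for k
  proof -
    have "G k < G (k - (b - 1))"
      using record_if_no_prev_smaller[OF assms(1) k, of "k - (b - 1)"] b_gt_1 by simp
    then show ?thesis using driftD[OF d, of "k - (b - 1)"] by simp
  qed
  ultimately show ?thesis unfolding walk_rel_translate_iff[OF assms(1,2)] by blast
qed

text \<open>Describes the admissible cuts through the relation only, so that two walks with equal
  relations can be cut at the same place. The first value below \<open>G d\<close> after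
  \<open>d\<close>, at \<open>l\<close>, has its previous smaller index \<open>j\<close> before
  \<open>d\<close>, and then the pair \<open>j + 1, l\<close> spans \<open>d\<close>.\<close>

lemma right_min_iff_uncovered:
  assumes "walk G" "drift G N c" "e * c = a"
  shows "(\<forall>i. d < i \<and> i < d + b \<longrightarrow> G d < G i) \<longleftrightarrow>
    \<not> (\<exists>k l. k \<le> d \<and> d < l \<and> l < k + N \<and> walk_rel G k l)"
proof -
  have "0 < c" using assms(3) a_pos e_ge_2 zero_less_mult_pos[of e c] by simp
  have ex: "\<exists>i. prev_smaller G k i \<and> k - N \<le> i" for k
  proof -
    have "G (k - N) < G k" using driftD[OF assms(2), of "k - N"] \<open>0 < c\<close> by simp
    then show ?thesis using prev_smaller_exists_walk[OF assms(1), of "k - N" k] N_pos two_N_le by force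
  qed
  show ?thesis
  proof
    assume rm: "\<forall>i. d < i \<and> i < d + b \<longrightarrow> G d < G i"
    show "\<not> (\<exists>k l. k \<le> d \<and> d < l \<and> l < k + N \<and> walk_rel G k l)"
    proof safe
      fix k l assume kl: "k \<le> d" "d < l" "l < k + N" "walk_rel G k l"
      obtain i where i: "prev_smaller G k i" "k - N \<le> i" using ex by blast
      then obtain t where t: "prev_smaller G l (i + (b - 1) * t)"
        using kl(4) prev_smaller_unique unfolding walk_rel_def by metis
      define j where "j = i + (b - 1) * t"
      have "G d < G l" using rm kl two_N_le N_pos by auto
      then have "d \<le> j" using t kl unfolding j_def[symmetric] prev_smaller_def by force
      moreover have "i < k" using i by (simp add: prev_smaller_def)
      moreover have "j < l" using t unfolding j_def[symmetric] by (simp add: prev_smaller_def)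
      \<comment> \<open>The indices \<open>i\<close> and \<open>j\<close> are congruent modulo
        \<open>b - 1\<close> but distinct and less than \<open>2 * N\<close> apart.\<close>
      ultimately have "0 < j - i" "j - i < b - 1" using kl i two_N_le by linarith+
      then show False using window_eq[of 0 t] b_gt_1 unfolding j_def by auto
    qed
  next
    assume unc: "\<not> (\<exists>k l. k \<le> d \<and> d < l \<and> l < k + N \<and> walk_rel G k l)"
    show "\<forall>i. d < i \<and> i < d + b \<longrightarrow> G d < G i"
    proof (rule ccontr)
      assume "\<not> ?thesis"
      then obtain i where i: "d < i" "i < d + b" "\<not> G d < G i" by blast
      obtain l where l: "d < l" "l \<le> i" "\<not> G d < G l" "\<And>z. d < z \<Longrightarrow> z < l \<Longrightarrow> \<not> \<not> G d < G z"
        using exists_first_int[of d i "\<lambda>i. \<not> G d < G i"] i by blast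
      have ld: "G l < G d" using walk_neq[OF assms(1), of d l] l i by auto
      obtain j where j: "prev_smaller G l j" "l - N \<le> j" using ex by blast
      have "j < d"
      proof (rule ccontr)
        assume "\<not> j < d"
        then have "G d \<le> G j" using l(4)[of j] j(1) by (cases "j = d") (auto simp: prev_smaller_def)
        then show False using ld j(1) by (simp add: prev_smaller_def)
      qed
      have "G l < G (j + 1)" using j(1) \<open>j < d\<close> l(1) by (simp add: prev_smaller_def)
      then have "prev_smaller G (j + 1) j" using j(1) by (simp add: prev_smaller_def)
      then have "walk_rel G (j + 1) l" unfolding walk_rel_def using j(1) by (metis add_0_right mult_zero_right)
      then show False using unc \<open>j < d\<close> l(1) j(2) by force
    qed
  qed
qed

text \<open>Both walks are cut at a common place found from the relation. The two windows are Dyck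
  walks with equal relations, hence equal, and the common drift along \<open>b - 1\<close> spreads
  the equality to all integers.\<close>

lemma walk_rel_inj_on: "inj_on walk_rel periodic_walks"
proof (rule inj_onI)
  fix G G' assume "G \<in> periodic_walks" "G' \<in> periodic_walks" and eq: "walk_rel G = walk_rel G'"
  then obtain c c' where G: "walk G" "G 0 = 0" "drift G N c" "e * c \<le> a"
    and G': "walk G'" "G' 0 = 0" "drift G' N c'" "e * c' \<le> a" by (auto simp: periodic_walks_def)
  note d = periodic_drift[OF G(3)] and d' = periodic_drift[OF G'(3)]
  show "G = G'"
  proof (cases "\<exists>k. walk_rel G k (k + N)")
    case True
    then obtain k where k: "walk_rel G k (k + N)" by blast
    define x where "x = k - 1"
    \<comment> \<open>The index \<open>x + b\<close> is the translate of the central label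
      \<open>k\<close> by a full turn, hence itself central and a record of every walk with this
      relation.\<close>
    have rec: "H (x + b) < H i"
      if H: "walk H" "drift H N c0" "walk_rel H k (k + N)" "x < i" "i < x + b" for H c0 i
    proof -
      have "shift_rel (b - 1) (walk_rel H) k (k + N)"
        using H(3) walk_rel_drift[OF periodic_drift[OF H(2)]] by simp
      then have "walk_rel H (x + b) (x + b + N)" by (simp add: shift_rel_def x_def algebra_simps)
      then have "\<nexists>i. prev_smaller H (x + b) i" using walk_rel_translate_iff[OF H(1,2)] by simp
      then show ?thesis using record_if_no_prev_smaller[OF H(1)] H(4,5) by simp
    qed
    note r = record_window_shift[OF G(1) d rec[OF G(1,3) k]]
    note r' = record_window_shift[OF G'(1) d' rec[OF G'(1,3) k[unfolded eq]]]
    have win: "record_window (shift_walk x G) i = record_window (shift_walk x G') i" if "0 \<le> i" "i \<le> b" for i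
      using cyclic_rel_inj[OF r(1) r'(1) _ that] r(2) r'(2) eq by simp
    have *: "G (i + x) - G (b + x) = G' (i + x) - G' (b + x)" if "0 < i" "i \<le> b" for i
      using that win[of i] by (simp add: record_window_def shift_walk_def)
    have "G (b + x) = G (1 + x) + e * c" "G' (b + x) = G' (1 + x) + e * c'"
      using driftD[OF d, of "1 + x"] driftD[OF d', of "1 + x"] by (simp_all add: algebra_simps)
    then have "e * c = e * c'" using *[of 1] b_gt_1 by simp
    then have d'': "drift G' (b - 1) (e * c)" using d' by metis
    show ?thesis
    proof (rule walk_eqI[OF d d''])
      show "G (i + x) - G' (i + x) = G (b + x) - G' (b + x)" if "0 < i" "i < b" for i
        using *[of i] that by linarith
    qed (simp add: G(2) G'(2))
  next
    case False
    have "e * c = a" using walk_drift_cases[OF G(1) d G(4)] central_iff_negative_drift[OF G(1,3,4)] False by simp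
    have "e * c' = a" using walk_drift_cases[OF G'(1) d' G'(4)] central_iff_negative_drift[OF G'(1,3,4)] False eq by simp
    obtain x where x: "\<And>i. x < i \<Longrightarrow> i < x + b \<Longrightarrow> G x < G i"
      using exists_right_min[OF G(1)] d \<open>e * c = a\<close> by auto
    have x': "\<And>i. x < i \<Longrightarrow> i < x + b \<Longrightarrow> G' x < G' i"
      using right_min_iff_uncovered[OF G(1,3) \<open>e * c = a\<close>, of x]
        right_min_iff_uncovered[OF G'(1,3) \<open>e * c' = a\<close>, of x] eq x by simp
    note r = right_min_window[OF G(1) _ x]
    note r' = right_min_window[OF G'(1) _ x']
    have win: "((shift_walk x G)(b := 0)) i = ((shift_walk x G')(b := 0)) i" if "0 \<le> i" "i \<le> b" for i
      using cyclic_rel_inj[OF r(1) r'(1) _ that] r(2) r'(2) eq d d' \<open>e * c = a\<close> \<open>e * c' = a\<close> by simp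
    have *: "G (i + x) - G x = G' (i + x) - G' x" if "0 < i" "i < b" for i
      using that win[of i] by (simp add: shift_walk_def)
    have d'': "drift G' (b - 1) (e * c)" using d' \<open>e * c = a\<close> \<open>e * c' = a\<close> by simp
    show ?thesis
    proof (rule walk_eqI[OF d d''])
      show "G (i + x) - G' (i + x) = G x - G' x" if "0 < i" "i < b" for i
        using *[of i] that by linarith
    qed (simp add: G(2) G'(2))
  qed
qed

section \<open>Surjectivity onto the invariant partitions\<close>

lemma nc_rels_period_right: "R \<in> nc_rels \<Longrightarrow> R x (y + (b - 1) * t) \<longleftrightarrow> R x y"
  by (auto simp: nc_rels_def cyclic_rel_def)

text \<open>At an intermediate distance the pair and its translate by \<open>N\<close> would cross,
  which relates \<open>x\<close> to \<open>x + N\<close>; distance exactly \<open>N\<close>, in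
  either direction around the circle, is excluded as well.\<close>

lemma far_pair:
  assumes R: "R \<in> nc_rels" "shift_rel N R = R" "\<And>k. \<not> R k (k + N)"
    and xy: "R x y" "x < y" "y < x + (b - 1)"
  shows "y < x + N \<or> x + (b - 1) < y + N"
proof (rule ccontr)
  assume n: "\<not> ?thesis"
  have sh: "R (u + N) (v + N) \<longleftrightarrow> R u v" for u v using R(2) by (metis shift_rel_def)
  have "y \<noteq> x + N" using R(3) xy by auto
  moreover have "y + N \<noteq> x + (b - 1)"
  proof
    assume *: "y + N = x + (b - 1)"
    have "R y (x + (b - 1))" using nc_rels_equiv(2)[OF R(1) xy(1)] nc_rels_period_right[OF R(1), of y x 1] by simp
    then show False using R(3)[of y] * by simp
  qed
  ultimately have "R x (x + N)"
    using nc_rels_noncrossing[OF R(1), of x "x + N" y "y + N"] n xy sh N_pos by auto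
  then show False using R(3) by blast
qed

text \<open>The right end \<open>k'\<close> of a longest related pair \<open>k, k'\<close> at
  distance below \<open>N\<close> is not spanned by any such pair: by noncrossing, a spanning pair
  would relate \<open>k\<close> to some \<open>y\<close> beyond \<open>k'\<close>.\<close>

lemma exists_uncovered_gap:
  assumes R: "R \<in> nc_rels" "shift_rel N R = R" "\<And>k. \<not> R k (k + N)"
  obtains d where "\<And>x y. x \<le> d \<Longrightarrow> d < y \<Longrightarrow> y < x + N \<Longrightarrow> \<not> R x y"
proof -
  have sh: "R (u + N) (v + N) \<longleftrightarrow> R u v" for u v using R(2) by (metis shift_rel_def)
  define S where "S = {L. \<exists>x y. x < y \<and> y < x + N \<and> R x y \<and> L = y - x}"
  show thesis
  proof (cases "S = {}")
    case True
    then have "\<not> R x y" if "x \<le> 0" "0 < y" "y < x + N" for x y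
      using that unfolding S_def by force
    then show thesis using that by blast
  next
    case False
    have fin: "finite S" by (rule finite_subset[of _ "{0..N}"]) (auto simp: S_def)
    have "Max S \<in> S" using False fin by simp
    then obtain k k' where k: "k < k'" "k' < k + N" "R k k'" "Max S = k' - k" unfolding S_def by blast
    have mx: "y - x \<le> k' - k" if "x < y" "y < x + N" "R x y" for x y
    proof -
      have "y - x \<in> S" using that unfolding S_def by blast
      then show ?thesis using Max_ge[OF fin] k(4) by metis
    qed
    have "\<not> R x y" if xy: "x \<le> k'" "k' < y" "y < x + N" for x y
    proof
      assume Rxy: "R x y"
      have "k < x" using mx[OF _ xy(3) Rxy] xy by linarith
      have Rky: "R k y"
      proof (cases "x = k'")
        case True then show ?thesis using nc_rels_equiv(3)[OF R(1)] k(3) Rxy by blast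
      next
        case x: False
        have "R k x" using nc_rels_noncrossing[OF R(1) \<open>k < x\<close> _ xy(2) _ k(3) Rxy] x xy k two_N_le by linarith
        then show ?thesis using nc_rels_equiv(3)[OF R(1)] Rxy by blast
      qed
      \<comment> \<open>Maximality pushes \<open>y\<close> beyond \<open>k + N\<close>; then the
        pair \<open>k', y\<close> crosses the translate of \<open>k, k'\<close> by \<open>N\<close>,
        which forces \<open>k\<close> to be related to \<open>k + N\<close>.\<close>
      have "\<not> y < k + N" using mx[of k y] Rky xy k by linarith
      moreover have "y \<noteq> k + N" using R(3) Rky by blast
      ultimately have "k + N < y" by linarith
      have Rk'y: "R k' y" using nc_rels_equiv[OF R(1)] k(3) Rky by blast
      have "R k' (k + N)"
        using nc_rels_noncrossing[OF R(1), of k' "k + N" y "k' + N"] Rk'y sh[of k k'] k \<open>k + N < y\<close> xy two_N_le N_pos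
        by auto
      then have "R k (k + N)" using nc_rels_equiv(3)[OF R(1)] k(3) by blast
      then show False using R(3) by blast
    qed
    then show thesis using that by blast
  qed
qed

lemma drift_from_window:
  assumes "drift G (b - 1) c" "\<And>i. 0 < i \<Longrightarrow> i < b \<Longrightarrow> G (i + N) = G i + K"
  shows "drift G N K"
  unfolding drift_def
proof
  fix x
  obtain t where t: "x = label x + (b - 1) * t" using label_decomp .
  note d = driftD[OF drift_mult[OF assms(1), of t]]
  have "G (x + N) = G (label x + N + (b - 1) * t)" by (subst t) (simp add: algebra_simps)
  also have "\<dots> = G (label x + N) + c * t" by (rule d)
  also have "\<dots> = G (label x) + c * t + K" using assms(2)[OF label_range, of x] by simp
  also have "\<dots> = G (label x + (b - 1) * t) + K" unfolding d by simp
  finally show "G (x + N) = G x + K" using t by simp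
qed

text \<open>A cut just before a central label makes \<open>1\<close> and \<open>N + 1\<close> share
  the previous smaller index \<open>0\<close>. So \<open>N + b\<close> is a record of the extension
  as well as \<open>b\<close>, and by invariance the windows ending there are the same Dyck walk,
  which yields a drift along \<open>N\<close>.\<close>

lemma walk_rel_surj_central:
  assumes R: "R \<in> nc_rels" "shift_rel N R = R" and k: "R k (k + N)"
  shows "R \<in> walk_rel ` periodic_walks"
proof -
  define x where "x = k - 1"
  obtain g where g: "dyck_walk g" "shift_rel x R = cyclic_rel g"
    using nc_rels_shift[OF R(1)] by (auto simp: nc_rels_def)
  have Nb: "N + 1 < b" using two_N_le N_pos by linarith
  have "cyclic_rel g 1 (N + 1)" using k unfolding g(2)[symmetric] by (simp add: shift_rel_def x_def add.commute)
  then have "block_rel g 1 (N + 1)" using label_id[of 1] label_id[of "N + 1"] Nb N_pos b_gt_1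
    by (simp add: cyclic_rel_def)
  moreover have g1: "0 < g 1" using dyck_walkD(3)[OF g(1)] b_gt_1 by simp
  then have "prev_smaller g 1 0" using dyck_walkD(1)[OF g(1)] by (auto simp: prev_smaller_def)
  ultimately have psN: "prev_smaller g (N + 1) 0" unfolding block_rel_def using prev_smaller_unique by metis
  \<comment> \<open>The drift along \<open>b - 1\<close> is \<open>- g 1\<close> because the
    extension has to take the value \<open>g b = 0\<close> at \<open>b\<close>.\<close>
  define G where "G i = g (label i) - g 1 * ((i - 1) div (b - 1))" for i
  have decomp: "i = label i + (b - 1) * ((i - 1) div (b - 1))" for i
    using mult_div_mod_eq[of "b - 1" "i - 1"] unfolding label_def by linarith
  have Gg: "G i = g i" if "0 < i" "i < b" for i
    using that label_id[OF that] by (simp add: G_def div_pos_pos_trivial)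
  have dr: "drift G (b - 1) (- g 1)"
  proof -
    have "(i + (b - 1) - 1) div (b - 1) = (i - 1) div (b - 1) + 1" for i
    proof -
      have "i + (b - 1) - 1 = (i - 1) + (b - 1)" by simp
      then show ?thesis using b_gt_1 by (simp only: div_add_self2)
    qed
    then show ?thesis using label_period[of _ 1] unfolding drift_def G_def by (simp add: algebra_simps)
  qed
  have Gb: "G b = 0" using driftD[OF dr, of 1] Gg[of 1] b_gt_1 by simp
  have wG: "walk G"
    unfolding walk_def
  proof (intro conjI allI)
    fix i
    define t where "t = (i - 1) div (b - 1)"
    have it: "i = label i + (b - 1) * t" using decomp t_def by simp
    note d = driftD[OF drift_mult[OF dr, of t]]
    have "G i = G (label i) + - g 1 * t" by (subst it) (rule d)
    moreover have "G (i + 1) = G (label i + 1) + - g 1 * t"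
    proof -
      have "i + 1 = label i + 1 + (b - 1) * t" using it by linarith
      then show ?thesis using d[of "label i + 1"] by metis
    qed
    moreover have "G (label i) - a \<le> G (label i + 1)"
      using dyck_walkD(2)[OF g(1)] dyck_walkD(4)[OF g(1), of "label i"] label_range[of i] Gg[of "label i"] Gg[of "label i + 1"] Gb
      by (cases "label i + 1 = b") auto
    ultimately show "G i - a \<le> G (i + 1)" by simp
    have "G i + a * i = (g (label i) + a * label i) - (g 1 + a * 1) * t + b * (a * t)"
      unfolding G_def t_def[symmetric] by (subst (2) it) (simp add: algebra_simps)
    moreover have "b dvd g (label i) + a * label i" "b dvd g 1 + a * 1"
      using dyck_walkD(5)[OF g(1), of "label i"] dyck_walkD(5)[OF g(1), of 1] label_range[of i] b_gt_1 by auto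
    ultimately show "b dvd G i + a * i" by (metis dvd_add[OF dvd_diff] dvd_mult2 dvd_triv_left)
  qed
  have pos: "G b < G i" if "0 < i" "i < b" for i using Gb Gg[OF that] dyck_walkD(3)[OF g(1) that] by simp
  note r = dyck_walk_of_record'[OF wG dr pos]
  have rw: "record_window G i = g i" if "0 \<le> i" "i < b" for i
    using that Gg[of i] Gb dyck_walkD(1)[OF g(1)] by (auto simp: record_window_def)
  have relG: "walk_rel G = shift_rel x R"
    using r(2) g(2) cyclic_rel_cong[of "record_window G" g] rw r(1) g(1) by simp
  have "prev_smaller (record_window G) (N + 1) 0"
    using psN rw Nb N_pos unfolding prev_smaller_def by auto
  then have none: "\<nexists>i. prev_smaller G (N + 1) i" using r(3)[of "N + 1"] Nb N_pos by simp
  have "\<nexists>i. prev_smaller G (N + b) i"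
  proof -
    have "prev_smaller G (N + 1 + (b - 1)) (i - (b - 1) + (b - 1)) \<longleftrightarrow> prev_smaller G (N + 1) (i - (b - 1))" for i
      by (rule prev_smaller_drift[OF dr])
    then show ?thesis using none by simp
  qed
  then have recN: "G (N + b) < G i" if "N < i" "i < N + b" for i
    using record_if_no_prev_smaller[OF wG] that by simp
  note r' = record_window_shift[OF wG dr recN]
  have "shift_rel N (shift_rel x R) = shift_rel x R"
    using R(2) by (metis shift_rel_add add.commute)
  then have "cyclic_rel (record_window (shift_walk N G)) = cyclic_rel (record_window G)"
    using r'(2) r(2) relG by simp
  then have win': "record_window (shift_walk N G) i = record_window G i" if "0 \<le> i" "i \<le> b" for i
    using cyclic_rel_inj[OF r'(1) r(1) _ that] by simp
  have win: "G (i + N) = G i + G (b + N)" if "0 < i" "i < b" for i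
    using that Gb win'[of i] by (simp add: record_window_def shift_walk_def)
  have dN: "drift G N (G (b + N))" by (rule drift_from_window[OF dr win])
  have "e * G (b + N) = - g 1"
    using driftD[OF periodic_drift[OF dN], of 1] driftD[OF dr, of 1] by simp
  then have "e * G (b + N) \<le> a" using g1 a_pos by linarith
  then have "shift_walk (- x) G \<in> periodic_walks"
    unfolding periodic_walks_def using walk_shift[OF wG] drift_shift[OF dN]
    by (auto simp: shift_walk_def)
  moreover have "walk_rel (shift_walk (- x) G) = R" by (simp add: walk_rel_shift relG shift_rel_add)
  ultimately show ?thesis by blast
qed

text \<open>Here the extension has drift \<open>a = g (b - 1)\<close>. Cutting at an uncovered gap
  ensures that the translate \<open>N\<close> of the cut is again a right minimum, so that the
  windows at \<open>0\<close> and \<open>N\<close> can be compared.\<close>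

lemma walk_rel_surj_noncentral:
  assumes R: "R \<in> nc_rels" "shift_rel N R = R" "\<And>k. \<not> R k (k + N)"
  shows "R \<in> walk_rel ` periodic_walks"
proof -
  obtain x where x: "\<And>u v. u \<le> x \<Longrightarrow> x < v \<Longrightarrow> v < u + N \<Longrightarrow> \<not> R u v"
    using exists_uncovered_gap[OF R] by blast
  obtain g where g: "dyck_walk g" "shift_rel x R = cyclic_rel g"
    using nc_rels_shift[OF R(1)] by (auto simp: nc_rels_def)
  define R1 where "R1 = shift_rel x R"
  have R1: "R1 \<in> nc_rels" "shift_rel N R1 = R1" "\<And>k. \<not> R1 k (k + N)"
  proof -
    show "R1 \<in> nc_rels" unfolding R1_def by (rule nc_rels_shift[OF R(1)])
    show "shift_rel N R1 = R1" unfolding R1_def using R(2) shift_rel_add[of N x R] shift_rel_add[of x N R]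
      by (simp add: add.commute)
    show "\<not> R1 k (k + N)" for k using R(3)[of "k + x"] unfolding R1_def shift_rel_def by (simp add: ac_simps)
  qed
  have gap0: "\<not> R1 u v" if "u \<le> 0" "0 < v" "v < u + N" for u v
    using x[of "u + x" "v + x"] that by (simp add: R1_def shift_rel_def)
  have gapN: "\<not> R1 u v" if "u \<le> N" "N < v" "v < u + N" for u v
  proof -
    have "R1 u v \<longleftrightarrow> R1 (u - N) (v - N)" using R1(2) by (metis diff_add_cancel shift_rel_def)
    then show ?thesis using gap0[of "u - N" "v - N"] that by simp
  qed
  have gapb: "\<not> R1 u v" if "u \<le> b - 1" "b - 1 < v" "v < u + N" for u v
  proof -
    have "R1 u v \<longleftrightarrow> R1 (u - (b - 1)) (v - (b - 1))"
      using nc_rels_period[OF R1(1), of 1] by (metis diff_add_cancel mult.right_neutral shift_rel_def)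
    then show ?thesis using gap0[of "u - (b - 1)" "v - (b - 1)"] that by simp
  qed
  have gb: "g (b - 1) = a" by (rule dyck_walk_last[OF g(1)])
  define G where "G i = g (i mod (b - 1)) + a * (i div (b - 1))" for i
  have Gg: "G i = g i" if "0 \<le> i" "i < b" for i
  proof (cases "i = b - 1")
    case True then show ?thesis using gb dyck_walkD(1)[OF g(1)] b_gt_1 by (simp add: G_def)
  next
    case False then show ?thesis using that by (simp add: G_def)
  qed
  have dr: "drift G (b - 1) a"
    unfolding drift_def
  proof
    fix i
    have "(i + (b - 1)) mod (b - 1) = i mod (b - 1)" "(i + (b - 1)) div (b - 1) = i div (b - 1) + 1"
      using b_gt_1 by (simp_all only: mod_add_self2 div_add_self2)
    then show "G (i + (b - 1)) = G i + a" unfolding G_def by (simp add: algebra_simps)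
  qed
  have wG: "walk G"
    unfolding walk_def
  proof (intro conjI allI)
    fix i
    define t r where "t = i div (b - 1)" and "r = i mod (b - 1)"
    have it: "i = r + (b - 1) * t" unfolding t_def r_def by simp
    have r: "0 \<le> r" "r < b - 1" unfolding r_def using b_gt_1 by simp_all
    note d = driftD[OF drift_mult[OF dr, of t]]
    have Gi: "G i = G r + a * t" by (subst it) (rule d)
    moreover have "G (i + 1) = G (r + 1) + a * t"
    proof -
      have "i + 1 = r + 1 + (b - 1) * t" using it by linarith
      then show ?thesis using d[of "r + 1"] by metis
    qed
    moreover have "G r - a \<le> G (r + 1)"
      using dyck_walkD(4)[OF g(1), of r] r Gg[of r] Gg[of "r + 1"] by auto
    ultimately show "G i - a \<le> G (i + 1)" by simp
    have "G i + a * i = (g r + a * r) + b * (a * t)"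
      unfolding Gi using Gg[of r] r by (subst it) (simp add: algebra_simps)
    moreover have "b dvd g r + a * r" using dyck_walkD(5)[OF g(1), of r] r by simp
    ultimately show "b dvd G i + a * i" by simp
  qed
  have G0: "G 0 = 0" using Gg[of 0] dyck_walkD(1)[OF g(1)] b_gt_1 by simp
  have pos: "0 < G i" if "0 < i" "i < b" for i using Gg[of i] that dyck_walkD(3)[OF g(1) that] by simp
  note r = dyck_walk_of_right_min[OF wG dr G0 pos]
  have relG: "walk_rel G = R1"
  proof -
    have "dyck_walk (G(b := 0))" "walk_rel G = cyclic_rel (G(b := 0))" using r by simp_all
    then show ?thesis
      unfolding R1_def g(2) using cyclic_rel_cong[of "G(b := 0)" g] g(1) Gg by simp
  qed
  have Nb: "N < b - 1" using two_N_le N_pos by linarith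
  \<comment> \<open>A smaller value after \<open>N\<close> produces a related pair spanning
    \<open>N\<close>. By \<open>far_pair\<close> it is shorter than \<open>N\<close>, against the
    gap at \<open>N\<close>, or nearly a full turn, and then its complementary pair spans the gap at
    \<open>b - 1\<close>.\<close>
  have minN: "g N < g l" if l: "N < l" "l < b" for l
  proof (rule ccontr)
    assume neg: "\<not> g N < g l"
    obtain m where m: "N < m" "m \<le> l" "\<not> g N < g m" "\<And>z. N < z \<Longrightarrow> z < m \<Longrightarrow> \<not> \<not> g N < g z"
      using exists_first_int[of N l "\<lambda>i. \<not> g N < g i"] l neg by blast
    have mN: "g m < g N" using dyck_walk_neq[OF g(1), of N m] m l N_pos by auto
    have mb: "0 < m" "m < b" using m l N_pos by auto
    obtain j where j: "prev_smaller g m j" "0 \<le> j" using prev_smaller_exists[OF g(1) mb] .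
    have "j < N"
    proof (rule ccontr)
      assume "\<not> j < N"
      then have "g N \<le> g j" using m(4)[of j] j(1) by (cases "j = N") (auto simp: prev_smaller_def)
      then show False using mN j(1) by (simp add: prev_smaller_def)
    qed
    have "prev_smaller g (j + 1) j" by (rule prev_smaller_nonneg(2)[OF g(1) mb j(1)])
    then have "block_rel g (j + 1) m" unfolding block_rel_def using j(1) by blast
    then have rel: "R1 (j + 1) m"
      using label_id[of "j + 1"] label_id[of m] j \<open>j < N\<close> Nb mb unfolding R1_def g(2) cyclic_rel_def by simp
    have "m < j + 1 + N \<or> j + 1 + (b - 1) < m + N"
      using far_pair[OF R1 rel] \<open>j < N\<close> m mb j by linarith
    then show False
    proof
      assume "m < j + 1 + N" then show False using gapN[of "j + 1" m] rel m \<open>j < N\<close> by simp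
    next
      assume "j + 1 + (b - 1) < m + N"
      moreover have "R1 m (j + 1 + (b - 1))"
        using nc_rels_equiv(2)[OF R1(1) rel] nc_rels_period_right[OF R1(1), of m "j + 1" 1] by simp
      ultimately show False using gapb[of m "j + 1 + (b - 1)"] mb j by simp
    qed
  qed
  have rmN: "G N < G i" if "N < i" "i < N + b" for i
  proof (cases "i < b")
    case True then show ?thesis using minN[of i] that Gg[of i] Gg[of N] N_pos Nb by simp
  next
    case False
    have "G i = G (i - (b - 1)) + a" using driftD[OF dr, of "i - (b - 1)"] by simp
    moreover have "0 < G (i - (b - 1))" using pos[of "i - (b - 1)"] False that Nb by simp
    moreover have "G N < a" using minN[of "b - 1"] gb Gg[of N] Nb N_pos by simp
    ultimately show ?thesis by simp
  qed
  note r' = right_min_window[OF wG dr rmN]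
  have "cyclic_rel ((shift_walk N G)(b := 0)) = cyclic_rel (G(b := 0))"
    using r'(2) r(2) relG R1(2) by simp
  then have win': "((shift_walk N G)(b := 0)) i = (G(b := 0)) i" if "0 \<le> i" "i \<le> b" for i
    using cyclic_rel_inj[OF r'(1) r(1) _ that] by simp
  have win: "G (i + N) = G i + G N" if "0 < i" "i < b" for i
    using that win'[of i] by (simp add: shift_walk_def)
  have dN: "drift G N (G N)" by (rule drift_from_window[OF dr win])
  have "e * G N = a"
    using driftD[OF periodic_drift[OF dN], of 1] driftD[OF dr, of 1] by simp
  then have "shift_walk (- x) G \<in> periodic_walks"
    unfolding periodic_walks_def using walk_shift[OF wG] drift_shift[OF dN]
    by (auto simp: shift_walk_def)
  moreover have "walk_rel (shift_walk (- x) G) = R" by (simp add: walk_rel_shift relG R1_def shift_rel_add)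
  ultimately show ?thesis by blast
qed

lemma walk_rel_bij_betw: "bij_betw walk_rel periodic_walks {R \<in> nc_rels. shift_rel N R = R}"
proof -
  have "walk_rel ` periodic_walks \<subseteq> {R \<in> nc_rels. shift_rel N R = R}"
    using walk_rel_in_nc_rels periodic_drift walk_rel_drift by (fastforce simp: periodic_walks_def)
  moreover have "{R \<in> nc_rels. shift_rel N R = R} \<subseteq> walk_rel ` periodic_walks"
    using walk_rel_surj_central walk_rel_surj_noncentral by blast
  ultimately show ?thesis using walk_rel_inj_on by (auto simp: bij_betw_def)
qed

end

section \<open>Counting walks\<close>

lemma mod_div_eqI: "0 \<le> r \<Longrightarrow> r < p \<Longrightarrow> i = r + p * q \<Longrightarrow> i mod p = r \<and> i div p = q" for r p q i :: int
  by simp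

lemma finite_length_sum_list: "finite {l :: nat list. length l = p \<and> sum_list l = s}"
proof (rule finite_subset)
  show "{l :: nat list. length l = p \<and> sum_list l = s} \<subseteq> {l. set l \<subseteq> {0..s} \<and> length l = p}"
    by (auto intro: member_le_sum_list)
qed (rule finite_lists_length_eq, simp)

lemma sum_differences_int:
  fixes G :: "int \<Rightarrow> int"
  assumes "0 \<le> n" shows "G n - G 0 = (\<Sum>j<nat n. G (int j + 1) - G (int j))"
proof -
  have "(\<Sum>j<m. G (int j + 1) - G (int j)) = G (int m) - G 0" for m
    by (induction m) (auto simp: algebra_simps)
  then show ?thesis using assms by simp
qed

context coprime_slope
begin

text \<open>The list records the numbers of north steps in one period: each increment plus
  \<open>a\<close> is a multiple of \<open>b\<close> by the congruence and nonnegative by the step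
  bound. The drift fixes the total \<open>s\<close>.\<close>

lemma walks_bij_lists:
  fixes p s :: nat
  assumes p: "0 < p"
  shows "bij_betw (\<lambda>G. map (\<lambda>i. nat ((G (int i + 1) - G (int i) + a) div b)) [0..<p])
    {G. walk G \<and> G 0 = 0 \<and> drift G (int p) (b * int s - a * int p)} {l. length l = p \<and> sum_list l = s}"
    (is "bij_betw ?f ?W ?L")
proof -
  let ?c = "b * int s - a * int p"
  \<comment> \<open>Inverse map: partial sums within the current period, plus the drift once for
    every completed period.\<close>
  define F where "F l i = (\<Sum>j<nat (i mod int p). b * int (l ! j) - a) + ?c * (i div int p)" for l :: "nat list" and i
  have b0: "0 < b" using b_gt_1 by simp
  have step: "int (nat ((G (i + 1) - G i + a) div b)) * b = G (i + 1) - G i + a" if "walk G" for G i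
  proof -
    have d: "b dvd G (i + 1) - G i + a"
      using dvd_diff[OF walkD(2)[OF that, of "i + 1"] walkD(2)[OF that, of i]] by (simp add: algebra_simps)
    have "0 \<le> G (i + 1) - G i + a" using walkD(1)[OF that, of i] by simp
    then have "0 \<le> (G (i + 1) - G i + a) div b" using b0 by (simp add: pos_imp_zdiv_nonneg_iff)
    then show ?thesis using d by simp
  qed
  have fW: "?f G \<in> ?L" if "G \<in> ?W" for G
  proof -
    have W: "walk G" "G 0 = 0" "drift G (int p) ?c" using that by auto
    have "b * int (sum_list (?f G)) = (\<Sum>j<p. b * int (nat ((G (int j + 1) - G (int j) + a) div b)))"
      by (simp add: interv_sum_list_conv_sum_set_nat sum_distrib_left atLeast0LessThan)
    also have "\<dots> = (\<Sum>j<p. G (int j + 1) - G (int j) + a)" using step[OF W(1)] by (simp add: mult.commute)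
    also have "\<dots> = (G (int p) - G 0) + a * int p" by (simp add: sum_differences_int[of "int p" G] sum.distrib)
    also have "\<dots> = b * int s" using driftD[OF W(3), of 0] W(2) by simp
    finally show ?thesis using b0 by simp
  qed
  have Fstep: "F l (i + 1) = F l i + (b * int (l ! nat (i mod int p)) - a)" if l: "l \<in> ?L" for l i
  proof -
    define r where "r = i mod int p"
    have r: "0 \<le> r" "r < int p" using p by (simp_all add: r_def)
    have ir: "i = r + int p * (i div int p)" by (simp add: r_def)
    show ?thesis
    proof (cases "r + 1 = int p")
      case True
      have "i + 1 = 0 + int p * (i div int p + 1)" using ir True by (simp add: algebra_simps)
      then have "(i + 1) mod int p = 0" "(i + 1) div int p = i div int p + 1"
        using mod_div_eqI[of 0 "int p"] p by auto
      moreover have "(\<Sum>j<nat r. b * int (l ! j) - a) + (b * int (l ! nat r) - a) = ?c"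
      proof -
        have "Suc (nat r) = p" using True r by linarith
        then have "(\<Sum>j<nat r. b * int (l ! j) - a) + (b * int (l ! nat r) - a) = (\<Sum>j<p. b * int (l ! j) - a)"
          by (metis sum.lessThan_Suc)
        also have "\<dots> = b * int (\<Sum>j<p. l ! j) - a * int p" by (simp add: sum_subtractf sum_distrib_left)
        also have "(\<Sum>j<p. l ! j) = s" using l by (auto simp: sum_list_sum_nth atLeast0LessThan)
        finally show ?thesis .
      qed
      ultimately show ?thesis unfolding F_def r_def[symmetric] by (simp add: algebra_simps)
    next
      case False
      then have "i + 1 = (r + 1) + int p * (i div int p)" "0 \<le> r + 1" "r + 1 < int p" using ir r by linarith+
      then have "(i + 1) mod int p = r + 1" "(i + 1) div int p = i div int p"
        using mod_div_eqI[of "r + 1" "int p"] by blast+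
      moreover have "nat (r + 1) = Suc (nat r)" using r by simp
      ultimately show ?thesis unfolding F_def r_def[symmetric] by simp
    qed
  qed
  have FW: "F l \<in> ?W" if l: "l \<in> ?L" for l
  proof -
    have F0: "F l 0 = 0" by (simp add: F_def)
    have dr: "drift (F l) (int p) ?c"
    proof -
      have "F l (i + int p) = F l i + ?c" for i
      proof -
        have "(i + int p) div int p = i div int p + 1" using div_add_self2[of "int p" i] p by linarith
        then show ?thesis unfolding F_def by (simp add: algebra_simps)
      qed
      then show ?thesis by (simp add: drift_def)
    qed
    have dvd: "b dvd F l i + a * i" for i
    proof -
      have up: "b dvd F l (i + 1) + a * (i + 1) \<longleftrightarrow> b dvd F l i + a * i" for i
      proof -
        have "F l (i + 1) + a * (i + 1) = (F l i + a * i) + b * int (l ! nat (i mod int p))"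
          unfolding Fstep[OF l] by (simp add: algebra_simps)
        then show ?thesis by (metis dvd_add_left_iff dvd_triv_left)
      qed
      show ?thesis
      proof (induction i rule: int_induct[where k = 0])
        case base then show ?case by (simp add: F0)
      next
        case (step1 i) then show ?case using up by blast
      next
        case (step2 i) then show ?case using up[of "i - 1"] by simp
      qed
    qed
    have "F l i - a \<le> F l (i + 1)" for i
    proof -
      have "0 \<le> b * int (l ! nat (i mod int p))" using b0 by simp
      then show ?thesis unfolding Fstep[OF l] by linarith
    qed
    then show ?thesis using F0 dr dvd by (simp add: walk_def)
  qed
  have fF: "?f (F l) = l" if l: "l \<in> ?L" for l
  proof (rule nth_equalityI)
    show "length (?f (F l)) = length l" using l by simp
    fix i assume "i < length (?f (F l))"
    then have "i < p" by simp
    then show "?f (F l) ! i = l ! i"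
      using Fstep[OF l, of "int i"] b0 by simp
  qed
  have Ff: "F (?f G) = G" if G: "G \<in> ?W" for G
  proof
    fix i
    have W: "walk G" "G 0 = 0" "drift G (int p) ?c" using G by auto
    define r where "r = i mod int p"
    have r: "0 \<le> r" "r < int p" using p by (simp_all add: r_def)
    have ir: "i = r + int p * (i div int p)" by (simp add: r_def)
    have "F (?f G) i = (\<Sum>j<nat r. G (int j + 1) - G (int j)) + ?c * (i div int p)"
    proof -
      have "(\<Sum>j<nat r. b * int (?f G ! j) - a) = (\<Sum>j<nat r. G (int j + 1) - G (int j))"
      proof (rule sum.cong[OF refl])
        fix j assume "j \<in> {..<nat r}"
        then have "j < p" using r by auto
        then show "b * int (?f G ! j) - a = G (int j + 1) - G (int j)"
          using step[OF W(1), of "int j"] by (simp add: mult.commute)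
      qed
      then show ?thesis unfolding F_def r_def[symmetric] by simp
    qed
    also have "\<dots> = G r + ?c * (i div int p)" using sum_differences_int[OF r(1), of G] W(2) by simp
    also have "\<dots> = G (r + int p * (i div int p))" using driftD[OF drift_mult[OF W(3), of "i div int p"], of r] by simp
    also have "\<dots> = G i" using ir by simp
    finally show "F (?f G) i = G i" .
  qed
  show ?thesis
    by (rule bij_betw_byWitness[where f' = F]) (use fW FW fF Ff in auto)
qed

lemma card_walks:
  fixes p s :: nat
  assumes "0 < p"
  shows "card {G. walk G \<and> G 0 = 0 \<and> drift G (int p) (b * int s - a * int p)} = (s + p - 1) choose s"
    and "finite {G. walk G \<and> G 0 = 0 \<and> drift G (int p) (b * int s - a * int p)}"
  using bij_betw_same_card[OF walks_bij_lists[OF assms, of s]] card_length_sum_list[of p s]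
    bij_betw_finite[OF walks_bij_lists[OF assms, of s]] finite_length_sum_list[of p s] by simp_all

section \<open>Counting all partitions through closed walks\<close>

lemma drift_0_mod: "drift H b 0 \<Longrightarrow> H i = H (i mod b)"
  using driftD[OF drift_mult[of H b 0 "i div b"], of "i mod b"] by simp

text \<open>The \<open>b\<close>-periodic extension selects one representative among the Dyck walks
  that agree on \<open>0..b\<close>; without it the functions could not be counted.\<close>

lemma closed_dyck_walks:
  defines "D \<equiv> {H. walk H \<and> H 0 = 0 \<and> drift H b 0 \<and> (\<forall>i. 0 < i \<and> i < b \<longrightarrow> 0 < H i)}"
  shows "bij_betw cyclic_rel D nc_rels"
proof -
  have dy: "dyck_walk H" if "H \<in> D" for H
  proof -
    have "H b = 0" using that driftD[of H b 0 0] by (auto simp: D_def)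
    then show ?thesis using that by (auto simp: dyck_walk_def D_def walk_def)
  qed
  have "inj_on cyclic_rel D"
  proof (rule inj_onI)
    fix H H' assume H: "H \<in> D" "H' \<in> D" "cyclic_rel H = cyclic_rel H'"
    have win: "H i = H' i" if "0 \<le> i" "i \<le> b" for i using cyclic_rel_inj[OF dy dy] H that by blast
    show "H = H'"
    proof
      fix i
      have "H i = H (i mod b)" "H' i = H' (i mod b)" using H(1,2) drift_0_mod by (auto simp: D_def)
      then show "H i = H' i" using win[of "i mod b"] b_gt_1 by (simp add: less_imp_le)
    qed
  qed
  moreover have "cyclic_rel ` D = nc_rels"
  proof
    show "cyclic_rel ` D \<subseteq> nc_rels" using dy by (auto simp: nc_rels_def)
    show "nc_rels \<subseteq> cyclic_rel ` D"
    proof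
      fix R assume "R \<in> nc_rels"
      then obtain g where g: "dyck_walk g" "R = cyclic_rel g" by (auto simp: nc_rels_def)
      define H where "H i = g (i mod b)" for i
      have Hg: "H i = g i" if "0 \<le> i" "i \<le> b" for i
        using that dyck_walkD(1,2)[OF g(1)] by (cases "i = b") (auto simp: H_def)
      have HD: "H \<in> D"
        unfolding D_def walk_def
      proof (intro CollectI conjI allI impI)
        show "H 0 = 0" using Hg[of 0] b_gt_1 dyck_walkD(1)[OF g(1)] by simp
        show "drift H b 0" by (simp add: drift_def H_def)
        show "0 < H i" if "0 < i \<and> i < b" for i using that Hg[of i] dyck_walkD(3)[OF g(1), of i] by simp
        fix i
        have r: "0 \<le> i mod b" "i mod b < b" using b_gt_1 by simp_all
        have "H (i + 1) = H (i mod b + 1)" unfolding H_def by (simp add: mod_add_left_eq)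
        then show "H i - a \<le> H (i + 1)"
          using dyck_walkD(4)[OF g(1) r] Hg[of "i mod b + 1"] r by (simp add: H_def)
        have "H i + a * i = (g (i mod b) + a * (i mod b)) + b * (a * (i div b))"
        proof -
          have "a * i = a * (i mod b + b * (i div b))" by simp
          then show ?thesis unfolding H_def by (simp only: distrib_left) (simp add: algebra_simps)
        qed
        then show "b dvd H i + a * i" using dyck_walkD(5)[OF g(1), of "i mod b"] r by simp
      qed
      moreover have "R = cyclic_rel H"
        unfolding g(2) by (rule cyclic_rel_cong[OF _ g(1) dy[OF HD]]) (simp add: Hg)
      ultimately show "R \<in> cyclic_rel ` D" by blast
    qed
  qed
  ultimately show ?thesis by (simp add: bij_betw_def)
qed

text \<open>The cycle lemma: every closed walk of length \<open>b\<close> has a unique minimum.\<close>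

lemma closed_walks_bij:
  defines "D \<equiv> {H. walk H \<and> H 0 = 0 \<and> drift H b 0 \<and> (\<forall>i. 0 < i \<and> i < b \<longrightarrow> 0 < H i)}"
    and "W \<equiv> {H. walk H \<and> H 0 = 0 \<and> drift H b 0}"
  shows "bij_betw (\<lambda>(H, d). shift_walk d H) (D \<times> {0..<b}) W"
proof -
  have b0: "0 < b" using b_gt_1 by simp
  have Dpos: "0 < H i" if "H \<in> D" "i mod b \<noteq> 0" for H i
  proof -
    have "0 < i mod b" "i mod b < b"
      using that(2) pos_mod_sign[OF b0, of i] pos_mod_bound[OF b0, of i] by linarith+
    then show ?thesis using that(1) drift_0_mod[of H i] unfolding D_def by auto
  qed
  have "inj_on (\<lambda>(H, d). shift_walk d H) (D \<times> {0..<b})"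
  proof (rule inj_onI, clarify)
    fix H d H' d'
    assume H: "H \<in> D" "H' \<in> D" "d \<in> {0..<b}" "d' \<in> {0..<b}" and eq: "shift_walk d H = shift_walk d' H'"
    have eq': "H (i + d) - H d = H' (i + d') - H' d'" for i
      using fun_cong[OF eq, of i] by (simp add: shift_walk_def)
    \<comment> \<open>Otherwise \<open>H (d - d')\<close> and \<open>H' (d' - d)\<close> are both
      positive, although they are negatives of each other.\<close>
    have "(d' - d) mod b = 0"
    proof (rule ccontr)
      assume n: "(d' - d) mod b \<noteq> 0"
      have "(d - d') mod b \<noteq> 0" using n by (metis dvd_diff_commute mod_0_imp_dvd dvd_imp_mod_0)
      have "H 0 - H d = H' (d' - d) - H' d'" using eq'[of "- d"] by simp
      moreover have "H (d - d') - H d = H' 0 - H' d'" using eq'[of "- d'"] by simp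
      moreover have "H 0 = 0" "H' 0 = 0" using H by (auto simp: D_def)
      ultimately show False
        using Dpos[OF H(2) n] Dpos[OF H(1) \<open>(d - d') mod b \<noteq> 0\<close>] by linarith
    qed
    then have "b dvd d' - d" by auto
    then have "d = d'" using H(3,4) dvd_imp_le_int[of "d' - d" b] by fastforce
    moreover have "H i = H' i" for i
    proof -
      have "H 0 = 0" "H' 0 = 0" using H by (auto simp: D_def)
      then show ?thesis using eq'[of "i - d"] eq'[of "- d"] \<open>d = d'\<close> by simp
    qed
    ultimately show "H = H' \<and> d = d'" by auto
  qed
  moreover have "(\<lambda>(H, d). shift_walk d H) ` (D \<times> {0..<b}) = W"
  proof (intro equalityI subsetI)
    fix K assume "K \<in> (\<lambda>(H, d). shift_walk d H) ` (D \<times> {0..<b})"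
    then show "K \<in> W" using walk_shift drift_shift by (auto simp: D_def W_def shift_walk_def)
  next
    fix K assume K: "K \<in> W"
    \<comment> \<open>Starting the walk at its minimum gives a Dyck walk; the minimum is strict
      because values within a window shorter than \<open>b\<close> are distinct.\<close>
    have "\<exists>m\<in>{0..<b}. K m = Min (K ` {0..<b})" using b0 Min_in[of "K ` {0..<b}"] by fastforce
    then obtain m where m: "m \<in> {0..<b}" "K m = Min (K ` {0..<b})" by blast
    have mle: "K m \<le> K i" for i
    proof -
      have "K (i mod b) \<in> K ` {0..<b}" using b0 by simp
      then have "K m \<le> K (i mod b)" using m(2) by simp
      then show ?thesis using drift_0_mod[of K i] K by (auto simp: W_def)
    qed
    have W: "walk K" "K 0 = 0" "drift K b 0" using K by (auto simp: W_def)
    have "K m < K (i + m)" if "0 < i" "i < b" for i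
      using mle[of "i + m"] walk_neq[OF W(1), of m "i + m"] that by simp
    then have HD: "shift_walk m K \<in> D"
      using walk_shift[OF W(1)] drift_shift[OF W(3)] by (auto simp: D_def shift_walk_def)
    have "K = shift_walk ((- m) mod b) (shift_walk m K)"
    proof
      fix i
      have "K (i + (- m) mod b + m) = K i"
        using drift_0_mod[OF W(3), of "i + (- m) mod b + m"] drift_0_mod[OF W(3), of i]
        by (metis (no_types, opaque_lifting) add.assoc add.right_neutral add.commute mod_add_right_eq neg_eq_iff_add_eq_0 minus_minus)
      moreover have "K ((- m) mod b + m) = 0"
        using drift_0_mod[OF W(3), of "(- m) mod b + m"] W(2)
        by (metis add.left_inverse mod_0 mod_add_left_eq)
      ultimately show "K i = shift_walk ((- m) mod b) (shift_walk m K) i"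
        using W(2) by (simp add: shift_walk_def)
    qed
    moreover have "(- m) mod b \<in> {0..<b}" using b0 by simp
    ultimately show "K \<in> (\<lambda>(H, d). shift_walk d H) ` (D \<times> {0..<b})" using HD by force
  qed
  ultimately show ?thesis by (simp add: bij_betw_def)
qed

lemma card_nc_rels: "nat b * card nc_rels = (nat a + nat b - 1) choose nat a" "finite nc_rels"
proof -
  define D where "D = {H. walk H \<and> H 0 = 0 \<and> drift H b 0 \<and> (\<forall>i. 0 < i \<and> i < b \<longrightarrow> 0 < H i)}"
  define W where "W = {H. walk H \<and> H 0 = 0 \<and> drift H b 0}"
  have "W = {G. walk G \<and> G 0 = 0 \<and> drift G (int (nat b)) (b * int (nat a) - a * int (nat b))}"
    using a_pos b_gt_1 by (simp add: W_def algebra_simps)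
  then have W: "card W = (nat a + nat b - 1) choose nat a" "finite W"
    using card_walks[of "nat b" "nat a"] b_gt_1 by simp_all
  have 1: "bij_betw (\<lambda>(H, d). shift_walk d H) (D \<times> {0..<b}) W"
    unfolding D_def W_def by (rule closed_walks_bij)
  have 2: "bij_betw cyclic_rel D nc_rels" unfolding D_def by (rule closed_dyck_walks)
  have "card (D \<times> {0..<b}) = card W" by (rule bij_betw_same_card[OF 1])
  then have "card D * nat b = card W" by (simp add: card_cartesian_product)
  then show "nat b * card nc_rels = (nat a + nat b - 1) choose nat a"
    using W(1) bij_betw_same_card[OF 2] by (simp add: mult.commute)
  have "finite (D \<times> {0..<b})" using bij_betw_finite[OF 1] W(2) by simp
  then have "finite D" using b_gt_1 by (auto simp: finite_cartesian_product_iff)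
  then show "finite nc_rels" using bij_betw_finite[OF 2] by simp
qed

end

context periodic_slope
begin

text \<open>A walk with \<open>s\<close> north steps per \<open>N\<close> columns has drift
  \<open>c = b * s - a * N\<close> and \<open>e * c = b * (e * s - a) + a\<close>, so
  \<open>e * c <= a\<close> means \<open>s <= a div e\<close>. Summing the stars-and-bars counts
  over \<open>s\<close> is the hockey-stick identity.\<close>

lemma card_periodic_walks: "card periodic_walks = (nat N + nat (a div e)) choose nat (a div e)"
proof -
  define M where "M = nat (a div e)"
  define W where "W s = {G. walk G \<and> G 0 = 0 \<and> drift G (int (nat N)) (b * int s - a * int (nat N))}" for s
  have e0: "0 < e" and b0: "0 < b" using e_ge_2 b_gt_1 by simp_all
  have iff: "e * (b * s - a * N) \<le> a \<longleftrightarrow> s \<le> a div e" for s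
  proof -
    have "e * (b * s - a * N) = b * (e * s - a) + a" using period by (simp add: algebra_simps)
    then have "e * (b * s - a * N) \<le> a \<longleftrightarrow> b * (e * s - a) \<le> 0" by simp
    also have "\<dots> \<longleftrightarrow> e * s \<le> a" using b0 by (simp add: mult_le_0_iff)
    also have "\<dots> \<longleftrightarrow> s \<le> a div e"
    proof
      assume "e * s \<le> a"
      then show "s \<le> a div e" using zdiv_mono1[of "e * s" a e] e0 by simp
    next
      assume "s \<le> a div e"
      then have "e * s \<le> e * (a div e)" using e0 by simp
      also have "\<dots> \<le> a" using mult_div_mod_eq[of e a] pos_mod_sign[OF e0, of a] by linarith
      finally show "e * s \<le> a" .
    qed
    finally show ?thesis .
  qed
  have "periodic_walks = (\<Union>s\<in>{..M}. W s)"
  proof (intro equalityI subsetI)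
    fix G assume "G \<in> periodic_walks"
    then obtain c where G: "walk G" "G 0 = 0" "drift G N c" "e * c \<le> a" by (auto simp: periodic_walks_def)
    have GN: "G N = c" using driftD[OF G(3), of 0] G(2) by simp
    then have "b dvd c + a * N" using walkD(2)[OF G(1), of N] by simp
    then obtain s where s: "c + a * N = b * s" by (elim dvdE)
    have "0 \<le> c + a * N"
    proof -
      have "- a * int k \<le> G (int k)" for k
      proof (induction k)
        case (Suc k)
        have "G (int k) - a \<le> G (int (Suc k))" using walkD(1)[OF G(1), of "int k"] by (simp add: add.commute)
        then show ?case using Suc by (simp add: algebra_simps)
      qed (simp add: G(2))
      from this[of "nat N"] show ?thesis using GN N_pos by simp
    qed
    then have "0 \<le> s" using s b0 by (simp add: zero_le_mult_iff)
    have c: "c = b * s - a * N" using s by simp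
    then have "s \<le> a div e" using iff G(4) by simp
    then have "nat s \<in> {..M}" by (simp add: M_def)
    moreover have "G \<in> W (nat s)" using G(1-3) c \<open>0 \<le> s\<close> N_pos by (simp add: W_def)
    ultimately show "G \<in> (\<Union>s\<in>{..M}. W s)" by blast
  next
    fix G assume "G \<in> (\<Union>s\<in>{..M}. W s)"
    then obtain s where s: "s \<le> M" "G \<in> W s" by blast
    then have "int s \<le> a div e" using a_pos e0 by (simp add: M_def le_nat_iff pos_imp_zdiv_nonneg_iff)
    then show "G \<in> periodic_walks" using s(2) iff[of "int s"] N_pos by (auto simp: periodic_walks_def W_def)
  qed
  moreover have "card (\<Union>s\<in>{..M}. W s) = (\<Sum>s\<le>M. card (W s))"
  proof (rule card_UN_disjoint)
    show "\<forall>s\<in>{..M}. finite (W s)" using card_walks(2)[of "nat N"] N_pos by (simp add: W_def)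
    show "\<forall>i\<in>{..M}. \<forall>j\<in>{..M}. i \<noteq> j \<longrightarrow> W i \<inter> W j = {}"
    proof (intro ballI impI)
      fix i j :: nat assume "i \<noteq> j"
      have "False" if "G \<in> W i" "G \<in> W j" for G
      proof -
        have "b * int i = b * int j" 
          using that N_pos driftD[of G N "b * int i - a * N" 0] driftD[of G N "b * int j - a * N" 0]
          unfolding W_def by simp
        then show False using b0 \<open>i \<noteq> j\<close> by simp
      qed
      then show "W i \<inter> W j = {}" by blast
    qed
  qed simp
  moreover have "card (W s) = (nat N - 1 + s) choose s" for s
    using card_walks(1)[of "nat N" s] N_pos by (simp add: W_def add.commute)
  ultimately have "card periodic_walks = (\<Sum>s\<le>M. (nat N - 1 + s) choose s)" by simp
  also have "\<dots> = Suc (nat N - 1 + M) choose M" by (rule sum_choose_lower)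
  also have "Suc (nat N - 1 + M) = nat N + M" using N_pos by simp
  finally show ?thesis by (simp add: M_def)
qed

lemma card_fixed_nc_rels:
  "card {R \<in> nc_rels. shift_rel N R = R} = (nat N + nat (a div e)) choose nat (a div e)"
  using bij_betw_same_card[OF walk_rel_bij_betw] card_periodic_walks by simp

end

section \<open>Lattice paths as staircases\<close>

text \<open>For \<open>i\<close> from \<open>1\<close> to the number of east steps this is the
  height of the \<open>i\<close>-th east step. It is \<open>0\<close> at \<open>0\<close> and equals
  the number of all north steps beyond the last east step, so the vertical part of the path over
  \<open>i\<close> always runs from \<open>east_height w i\<close> to
  \<open>east_height w (Suc i)\<close>.\<close>

definition east_height :: "step list \<Rightarrow> nat \<Rightarrow> nat" where
  "east_height w i = length (filter (\<lambda>k. w ! k = North \<and> count_list (take k w) East < i) [0..<length w])"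

lemma east_height_snoc:
  "east_height (w @ [s]) i = east_height w i + (if s = North \<and> count_list w East < i then 1 else 0)"
proof -
  have "filter (\<lambda>k. (w @ [s]) ! k = North \<and> count_list (take k (w @ [s])) East < i) [0..<length w] =
        filter (\<lambda>k. w ! k = North \<and> count_list (take k w) East < i) [0..<length w]"
    by (intro filter_cong) (auto simp: nth_append)
  then show ?thesis by (simp add: east_height_def)
qed

lemma east_height_Nil [simp]: "east_height [] i = 0"
  by (simp add: east_height_def)

lemma east_height_0 [simp]: "east_height w 0 = 0"
  by (induction w rule: rev_induct) (auto simp: east_height_snoc)

lemma east_height_mono: "i \<le> j \<Longrightarrow> east_height w i \<le> east_height w j"
  by (induction w rule: rev_induct) (auto simp: east_height_snoc)

lemma east_height_top: "count_list w East < i \<Longrightarrow> east_height w i = count_list w North"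
proof (induction w rule: rev_induct)
  case (snoc s w) then show ?case by (cases s) (auto simp: east_height_snoc)
qed simp

lemma east_height_le: "east_height w i \<le> count_list w North"
  using east_height_mono[of i "max i (Suc (count_list w East))" w]
    east_height_top[of w "max i (Suc (count_list w East))"] by simp

lemma vertex_snoc: "k \<le> length w \<Longrightarrow> vertex (w @ [s]) k = vertex w k"
  by (simp add: vertex_def)

lemma vertex_length: "vertex w (length w) = (real (count_list w East), real (count_list w North))"
  by (simp add: vertex_def)

lemma curve_snoc:
  "curve (w @ [s]) = curve w \<union> closed_segment (vertex w (length w)) (vertex (w @ [s]) (Suc (length w)))"
proof -
  have "curve (w @ [s]) = (\<Union>k<length w. closed_segment (vertex (w @ [s]) k) (vertex (w @ [s]) (Suc k))) \<union>
     closed_segment (vertex (w @ [s]) (length w)) (vertex (w @ [s]) (Suc (length w)))"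
    by (simp add: curve_def lessThan_Suc Un_commute)
  also have "(\<Union>k<length w. closed_segment (vertex (w @ [s]) k) (vertex (w @ [s]) (Suc k))) = curve w"
    unfolding curve_def by (intro SUP_cong) (auto simp: vertex_snoc)
  finally show ?thesis by (simp add: vertex_snoc)
qed

lemma closed_segment_vertical:
  "closed_segment (x :: real, y :: real) (x, z) = {p. fst p = x \<and> snd p \<in> closed_segment y z}"
proof -
  have "(1 - u) * x + u * x = x" for u by (simp add: algebra_simps)
  then show ?thesis by (auto simp: closed_segment_def)
qed

lemma closed_segment_horizontal:
  "closed_segment (x :: real, y :: real) (z, y) = {p. snd p = y \<and> fst p \<in> closed_segment x z}"
proof -
  have "(1 - u) * y + u * y = y" for u by (simp add: algebra_simps)
  then show ?thesis by (auto simp: closed_segment_def)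
qed

definition staircase :: "step list \<Rightarrow> (real \<times> real) set" where
  "staircase w =
     {p. \<exists>i<count_list w East. real i \<le> fst p \<and> fst p \<le> real i + 1 \<and> snd p = real (east_height w (Suc i))} \<union>
     {p. \<exists>i\<le>count_list w East. fst p = real i \<and> real (east_height w i) \<le> snd p \<and> snd p \<le> real (east_height w (Suc i))}"

text \<open>The origin is inserted because the empty path has an empty curve but a one-point
  staircase; this lets the induction on the last step start.\<close>

lemma curve_staircase_aux: "insert (0, 0) (curve w) = staircase w"
proof (induction w rule: rev_induct)
  case Nil
  show ?case by (auto simp: curve_def staircase_def)
next
  case (snoc s w)
  let ?E = "count_list w East" and ?N = "count_list w North"
  have IH: "insert (0, 0) (curve (w @ [s])) =
      staircase w \<union> closed_segment (real ?E, real ?N) (vertex (w @ [s]) (Suc (length w)))"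
    using snoc by (auto simp: curve_snoc vertex_length)
  have top: "east_height w (Suc ?E) = ?N" "east_height w (Suc (Suc ?E)) = ?N" by (auto intro: east_height_top)
  have le: "east_height w ?E \<le> ?N" by (rule east_height_le)
  show ?case
  proof (cases s)
    case North
    have seg: "closed_segment (real ?E, real ?N) (vertex (w @ [s]) (Suc (length w))) =
        {p. fst p = real ?E \<and> real ?N \<le> snd p \<and> snd p \<le> real ?N + 1}"
      using North by (auto simp: vertex_def closed_segment_vertical closed_segment_eq_real_ivl)
    have h: "east_height (w @ [s]) i = (if i \<le> ?E then east_height w i else ?N + 1)" for i
      using North by (simp add: east_height_snoc east_height_top)
    have E: "count_list (w @ [s]) East = ?E" using North by simp
    show ?thesis
      unfolding IH seg staircase_def E
    proof (intro equalityI subsetI, goal_cases)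
      case (1 p)
      then consider i where "i < ?E" "real i \<le> fst p" "fst p \<le> real i + 1" "snd p = real (east_height w (Suc i))"
        | i where "i \<le> ?E" "fst p = real i" "real (east_height w i) \<le> snd p" "snd p \<le> real (east_height w (Suc i))"
        | "fst p = real ?E" "real ?N \<le> snd p" "snd p \<le> real ?N + 1" by auto
      then show ?case
      proof cases
        case 1 then show ?thesis by (auto simp: h intro!: exI[of _ i])
      next
        case 2
        then show ?thesis using top by (cases "i = ?E") (auto simp: h intro!: exI[of _ i])
      next
        case 3 then show ?thesis using le by (auto simp: h intro!: exI[of _ ?E])
      qed
    next
      case (2 p)
      then consider i where "i < ?E" "real i \<le> fst p" "fst p \<le> real i + 1" "snd p = real (east_height (w @ [s]) (Suc i))"
        | i where "i < ?E" "fst p = real i" "real (east_height (w @ [s]) i) \<le> snd p" "snd p \<le> real (east_height (w @ [s]) (Suc i))"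
        | "fst p = real ?E" "real (east_height (w @ [s]) ?E) \<le> snd p" "snd p \<le> real (east_height (w @ [s]) (Suc ?E))"
        using le_neq_implies_less by blast
      then show ?case
      proof cases
        case 1 then show ?thesis by (auto simp: h)
      next
        case 2 then show ?thesis by (auto simp: h)
      next
        case 3 then show ?thesis using top by (cases "snd p \<le> ?N") (auto simp: h intro!: exI[of _ ?E])
      qed
    qed
  next
    case East
    have seg: "closed_segment (real ?E, real ?N) (vertex (w @ [s]) (Suc (length w))) =
        {p. snd p = real ?N \<and> real ?E \<le> fst p \<and> fst p \<le> real ?E + 1}"
      using East by (auto simp: vertex_def closed_segment_horizontal closed_segment_eq_real_ivl)
    have h: "east_height (w @ [s]) i = east_height w i" for i
      using East by (simp add: east_height_snoc)
    have E: "count_list (w @ [s]) East = Suc ?E" using East by simp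
    show ?thesis
      unfolding IH seg staircase_def E h
    proof (intro equalityI subsetI, goal_cases)
      case (1 p)
      then consider i where "i < ?E" "real i \<le> fst p" "fst p \<le> real i + 1" "snd p = real (east_height w (Suc i))"
        | i where "i \<le> ?E" "fst p = real i" "real (east_height w i) \<le> snd p" "snd p \<le> real (east_height w (Suc i))"
        | "snd p = real ?N" "real ?E \<le> fst p" "fst p \<le> real ?E + 1" by auto
      then show ?case
      proof cases
        case 1 then show ?thesis by (auto intro!: exI[of _ i])
      next
        case 2 then show ?thesis by (auto intro!: exI[of _ i])
      next
        case 3 then show ?thesis using top by (auto intro!: exI[of _ ?E])
      qed
    next
      case (2 p)
      then consider i where "i < ?E" "real i \<le> fst p" "fst p \<le> real i + 1" "snd p = real (east_height w (Suc i))"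
        | "real ?E \<le> fst p" "fst p \<le> real ?E + 1" "snd p = real (east_height w (Suc ?E))"
        | i where "i \<le> ?E" "fst p = real i" "real (east_height w i) \<le> snd p" "snd p \<le> real (east_height w (Suc i))"
        | "fst p = real (Suc ?E)" "real (east_height w (Suc ?E)) \<le> snd p" "snd p \<le> real (east_height w (Suc (Suc ?E)))"
        unfolding less_Suc_eq le_Suc_eq by blast
      then show ?case
        by cases (use top in auto)
    qed
  qed
qed

lemma curve_staircase:
  assumes "w \<noteq> []" shows "curve w = staircase w"
proof -
  have "(0, 0) \<in> closed_segment (vertex w 0) (vertex w (Suc 0))" by (simp add: vertex_def)
  then have "(0, 0) \<in> curve w" using assms unfolding curve_def by blast
  then show ?thesis using curve_staircase_aux[of w] by (simp add: insert_absorb)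
qed

lemma east_steps_snoc: "east_steps (w @ [s]) = east_steps w @ (if s = East then [length w] else [])"
proof -
  have "filter (\<lambda>k. (w @ [s]) ! k = East) [0..<length w] = filter (\<lambda>k. w ! k = East) [0..<length w]"
    by (intro filter_cong) (auto simp: nth_append)
  then show ?thesis by (simp add: east_steps_def)
qed

lemma length_east_steps: "length (east_steps w) = count_list w East"
  by (induction w rule: rev_induct) (auto simp: east_steps_snoc, simp add: east_steps_def)

lemma east_end_eq:
  assumes "0 < i" "i \<le> count_list w East"
  shows "east_end w i = (real i, real (east_height w i))"
  using assms
proof (induction w rule: rev_induct)
  case (snoc s w)
  show ?case
  proof (cases "i \<le> count_list w East")
    case True
    have lt: "i - 1 < length (east_steps w)" using True snoc.prems by (simp add: length_east_steps)
    have "east_steps w ! (i - 1) \<in> set (east_steps w)" using lt by simp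
    then have "Suc (east_steps w ! (i - 1)) \<le> length w" by (auto simp: east_steps_def)
    then have "east_end (w @ [s]) i = east_end w i"
      using lt by (simp add: east_end_def east_steps_snoc nth_append vertex_snoc)
    then show ?thesis using snoc True by (simp add: east_height_snoc)
  next
    case False
    then have s: "s = East" "i = Suc (count_list w East)" using snoc.prems by (auto split: if_splits)
    then have "east_end (w @ [s]) i = vertex (w @ [s]) (Suc (length w))"
      by (simp add: east_end_def east_steps_snoc nth_append length_east_steps)
    then show ?thesis using s by (simp add: vertex_def east_height_snoc east_height_top)
  qed
qed simp

lemma last_East_iff:
  "w \<noteq> [] \<Longrightarrow> last w = East \<longleftrightarrow> 0 < count_list w East \<and> east_height w (count_list w East) = count_list w North"
proof (cases w rule: rev_cases)
  case (snoc v s)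
  then show ?thesis using east_height_le[of v "count_list v East"]
    by (cases s) (auto simp: east_height_snoc east_height_top)
qed simp

lemma valleys_snoc:
  "valleys (w @ [s]) = valleys w \<union> (if s = North \<and> w \<noteq> [] \<and> last w = East then {vertex w (length w)} else {})"
proof -
  have "valleys (w @ [s]) = {vertex (w @ [s]) k |k. 0 < k \<and> k < length w \<and> (w @ [s]) ! (k - 1) = East \<and> (w @ [s]) ! k = North}
    \<union> {vertex (w @ [s]) k |k. 0 < k \<and> k = length w \<and> (w @ [s]) ! (k - 1) = East \<and> (w @ [s]) ! k = North}"
    unfolding valleys_def by (auto simp: less_Suc_eq)
  also have "{vertex (w @ [s]) k |k. 0 < k \<and> k < length w \<and> (w @ [s]) ! (k - 1) = East \<and> (w @ [s]) ! k = North} = valleys w"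
  proof -
    have "(v = vertex (w @ [s]) k \<and> 0 < k \<and> k < length w \<and> (w @ [s]) ! (k - 1) = East \<and> (w @ [s]) ! k = North) \<longleftrightarrow>
        (v = vertex w k \<and> 0 < k \<and> k < length w \<and> w ! (k - 1) = East \<and> w ! k = North)" for v k
      using vertex_snoc[of k w s] by (auto simp: nth_append)
    then show ?thesis unfolding valleys_def by simp
  qed
  also have "{vertex (w @ [s]) k |k. 0 < k \<and> k = length w \<and> (w @ [s]) ! (k - 1) = East \<and> (w @ [s]) ! k = North} =
     (if s = North \<and> w \<noteq> [] \<and> last w = East then {vertex w (length w)} else {})"
    by (auto simp: vertex_snoc nth_append last_conv_nth)
  finally show ?thesis .
qed

lemma valleys_eq:
  "valleys w = {(real i, real (east_height w i)) |i. 0 < i \<and> i \<le> count_list w East \<and> east_height w i < east_height w (Suc i)}"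
proof (induction w rule: rev_induct)
  case Nil then show ?case by (simp add: valleys_def)
next
  case (snoc s w)
  let ?E = "count_list w East" and ?N = "count_list w North"
  have top: "east_height w (Suc ?E) = ?N" "east_height w (Suc (Suc ?E)) = ?N" by (auto intro: east_height_top)
  have le: "east_height w ?E \<le> ?N" by (rule east_height_le)
  show ?case
  proof (cases s)
    case East
    then have "valleys (w @ [s]) = valleys w" by (simp add: valleys_snoc)
    moreover have "0 < i \<and> i \<le> Suc ?E \<and> east_height w i < east_height w (Suc i) \<longleftrightarrow>
        0 < i \<and> i \<le> ?E \<and> east_height w i < east_height w (Suc i)" for i
      using top by (cases "i = Suc ?E") auto
    ultimately show ?thesis using snoc East by (simp add: east_height_snoc)
  next
    case North
    have h: "0 < i \<and> i \<le> ?E \<and> east_height (w @ [s]) i < east_height (w @ [s]) (Suc i) \<longleftrightarrow>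
        0 < i \<and> i \<le> ?E \<and> (east_height w i < east_height w (Suc i) \<or> i = ?E)" for i
      using North top le by (cases "i = ?E") (auto simp: east_height_snoc)
    have eq: "{(real i, real (east_height (w @ [s]) i)) |i. 0 < i \<and> i \<le> count_list (w @ [s]) East \<and>
          east_height (w @ [s]) i < east_height (w @ [s]) (Suc i)} =
        {(real i, real (east_height w i)) |i. 0 < i \<and> i \<le> ?E \<and> (east_height w i < east_height w (Suc i) \<or> i = ?E)}"
    proof -
      have "count_list (w @ [s]) East = ?E" using North by simp
      moreover have "i \<le> ?E \<Longrightarrow> east_height (w @ [s]) i = east_height w i" for i
        by (simp add: east_height_snoc)
      ultimately show ?thesis using h by (intro Collect_cong) (metis (no_types, lifting))
    qed
    show ?thesis
    proof (cases "w = [] \<or> ?E = 0")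
      case True
      then have "\<not> (w \<noteq> [] \<and> last w = East)" using last_East_iff[of w] by auto
      then show ?thesis unfolding eq valleys_snoc snoc using True by auto
    next
      case False
      show ?thesis
      proof (cases "east_height w ?E = ?N")
        case h: True
        then have "last w = East" using last_East_iff[of w] False by auto
        then show ?thesis unfolding eq valleys_snoc snoc using North False h by (auto simp: vertex_length)
      next
        case h: False
        then have "last w \<noteq> East" using last_East_iff[of w] False by auto
        moreover have "east_height w ?E < east_height w (Suc ?E)" using h le top by simp
        ultimately show ?thesis unfolding eq valleys_snoc snoc by auto
      qed
    qed
  qed
qed

text \<open>Since heights do not decrease, the path comes closest to the line at the right ends of
  its east steps, and only these have to be checked.\<close>

lemma dyck_path_iff:
  assumes "0 < b"
  shows "dyck_path a b w \<longleftrightarrow> count_list w East = b \<and> count_list w North = a \<and> (\<forall>i\<le>b. a * i \<le> b * east_height w i)"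
proof -
  have *: "real a / real b * real i \<le> real h \<longleftrightarrow> a * i \<le> b * h" for i h
  proof -
    have "real a / real b * real i \<le> real h \<longleftrightarrow> real (a * i) \<le> real (b * h)" using assms by (simp add: field_simps)
    then show ?thesis by (simp only: of_nat_le_iff)
  qed
  have **: "(\<forall>p\<in>curve w. real a / real b * fst p \<le> snd p) \<longleftrightarrow> (\<forall>i\<le>b. a * i \<le> b * east_height w i)"
    if E: "count_list w East = b"
  proof -
    have "w \<noteq> []" using E assms by auto
    note c = curve_staircase[OF this]
    show ?thesis
    proof (intro iffI allI impI ballI)
      fix i assume all: "\<forall>p\<in>curve w. real a / real b * fst p \<le> snd p" and "i \<le> b"
      then have "(real i, real (east_height w i)) \<in> curve w"
        unfolding c staircase_def using E by (auto intro!: exI[of _ i] east_height_mono)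
      then show "a * i \<le> b * east_height w i" using all * by force
    next
      fix p assume all: "\<forall>i\<le>b. a * i \<le> b * east_height w i" and "p \<in> curve w"
      then have "p \<in> staircase w" by (simp add: c)
      then consider i where "i < b" "real i \<le> fst p" "fst p \<le> real (Suc i)" "snd p = real (east_height w (Suc i))"
        | i where "i \<le> b" "fst p = real i" "real (east_height w i) \<le> snd p" unfolding staircase_def E by force
      then show "real a / real b * fst p \<le> snd p"
      proof cases
        case 1
        have "real a / real b * fst p \<le> real a / real b * real (Suc i)" using 1 by (intro mult_left_mono) auto
        also have "\<dots> \<le> real (east_height w (Suc i))" using * all 1 Suc_leI by blast
        finally show ?thesis using 1 by simp
      next
        case 2
        have "real a / real b * real i \<le> real (east_height w i)" using * all 2 by blast
        then show ?thesis using 2 by simp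
      qed
    qed
  qed
  have "dyck_path a b w \<longleftrightarrow> count_list w East = b \<and> count_list w North = a \<and> (\<forall>p\<in>curve w. real a / real b * fst p \<le> snd p)"
    by (auto simp: dyck_path_def vertex_length)
  then show ?thesis using ** by blast
qed

lemma count_list_replicate_steps:
  "count_list (replicate m North) East = 0" "count_list (replicate m North) North = m"
  by (induction m) auto

lemma east_height_append_Norths:
  "east_height (w @ replicate m North) i = east_height w i + (if count_list w East < i then m else 0)"
proof (induction m)
  case (Suc m)
  have "w @ replicate (Suc m) North = (w @ replicate m North) @ [North]"
    by (simp add: replicate_append_same)
  then show ?case using Suc by (simp only: east_height_snoc) (simp add: count_list_replicate_steps)
qed simp

lemma path_with_heights:
  fixes h :: "nat \<Rightarrow> nat"
  assumes "h 0 = 0" "\<And>i. i < b \<Longrightarrow> h i \<le> h (Suc i)"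
  obtains w where "count_list w East = b" "count_list w North = h b" "\<And>i. i \<le> b \<Longrightarrow> east_height w i = h i"
proof -
  have "\<exists>w. count_list w East = c \<and> count_list w North = h c \<and> (\<forall>i\<le>c. east_height w i = h i)" if "c \<le> b" for c
    using that
  proof (induction c)
    case 0 then show ?case using assms(1) by (intro exI[of _ "[]"]) simp
  next
    case (Suc c)
    then obtain w where w: "count_list w East = c" "count_list w North = h c" "\<And>i. i \<le> c \<Longrightarrow> east_height w i = h i"
      by auto
    let ?w = "(w @ replicate (h (Suc c) - h c) North) @ [East]"
    have le: "h c \<le> h (Suc c)" using assms(2) Suc.prems by simp
    have "east_height ?w i = h i" if "i \<le> Suc c" for i
      using that w le east_height_top[of w "Suc c"] unfolding east_height_snoc east_height_append_Norths
      by (cases "i = Suc c") auto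
    moreover have "count_list ?w East = Suc c" "count_list ?w North = h (Suc c)"
      using w le by (auto simp: count_list_replicate_steps)
    ultimately show ?case by blast
  qed
  from this[of b] show thesis using that by auto
qed

section \<open>Lasers\<close>

lemma staircase_above:
  assumes "p \<in> staircase w" "real k - 1 < fst p"
  shows "real (east_height w k) \<le> snd p"
proof -
  consider i where "fst p \<le> real i + 1" "snd p = real (east_height w (Suc i))"
    | i where "fst p = real i" "real (east_height w i) \<le> snd p"
    using assms(1) unfolding staircase_def by blast
  then show ?thesis
  proof cases
    case 1
    then have "k \<le> Suc i" using assms(2) by linarith
    then show ?thesis using 1 east_height_mono[of k "Suc i" w] by simp
  next
    case 2
    then have "k \<le> i" using assms(2) by linarith
    then have "real (east_height w k) \<le> real (east_height w i)" using east_height_mono by simp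
    then show ?thesis using 2 by linarith
  qed
qed

lemma exists_nat_ceiling:
  assumes "real i < x" obtains k :: nat where "i < k" "real k - 1 < x" "x \<le> real k"
proof -
  have "0 < x" using assms by (meson of_nat_0_le_iff order_le_less_trans)
  then have c: "real (nat \<lceil>x\<rceil>) = of_int \<lceil>x\<rceil>" by simp
  show thesis
  proof (rule that[of "nat \<lceil>x\<rceil>"])
    show "real (nat \<lceil>x\<rceil>) - 1 < x" "x \<le> real (nat \<lceil>x\<rceil>)" unfolding c by linarith+
    then show "i < nat \<lceil>x\<rceil>" using assms by linarith
  qed
qed

lemma connected_component_segment:
  "closed_segment p q \<subseteq> Z \<Longrightarrow> connected_component Z p q" for p :: "'a :: real_normed_vector"
  unfolding connected_component_def by (metis connected_segment(1) ends_in_segment)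

lemma closed_segment_PairD1:
  fixes f :: "real \<Rightarrow> real"
  assumes "p \<in> closed_segment (x :: real, f x) (y, f y)" "\<And>u v t. f ((1 - t) * u + t * v) = (1 - t) * f u + t * f v"
  shows "fst p \<in> closed_segment x y" "snd p = f (fst p)"
  using assms by (auto simp: closed_segment_def)

text \<open>Here \<open>i\<close> is the abscissa of a valley and \<open>j\<close> the next index at
  which \<open>b * h - a * k\<close> is smaller; \<open>above\<close> and \<open>below\<close> are
  these comparisons, rearranged to avoid subtraction of natural numbers.\<close>

locale laser_setup =
  fixes a b :: nat and w :: "step list" and i j :: nat
  assumes a_pos: "0 < a" and path: "dyck_path a b w" and ij: "0 < i" "i < j" "j \<le> b"
    and valley: "east_height w i < east_height w (Suc i)"
    and above: "\<And>k. i < k \<Longrightarrow> k < j \<Longrightarrow> b * east_height w i + a * k < b * east_height w k + a * i"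
    and below: "b * east_height w j + a * i < b * east_height w i + a * j"
begin

abbreviation ht :: "nat \<Rightarrow> real" where
  "ht k \<equiv> real (east_height w k)"

definition line :: "real \<Rightarrow> real" where
  "line x = ht i + real a / real b * (x - real i)"

text \<open>The solution of \<open>line x = ht j\<close>: the laser ends in the interior of the
  \<open>j\<close>-th east step.\<close>

definition hit :: real where
  "hit = real i + (ht j - ht i) * real b / real a"

lemma b_pos: "0 < b" using ij by simp

lemma slope_pos: "0 < real a / real b" using a_pos b_pos by simp

lemma line_i: "line (real i) = ht i" by (simp add: line_def)

lemma line_hit: "line hit = ht j"
  using a_pos b_pos by (simp add: line_def hit_def)

lemma line_less_iff [simp]: "line x < line y \<longleftrightarrow> x < y"
  unfolding line_def add_less_cancel_left mult_less_cancel_left_pos[OF slope_pos] by simp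

lemma line_le_iff [simp]: "line x \<le> line y \<longleftrightarrow> x \<le> y"
  by (metis line_less_iff linorder_not_less)

lemma line_affine: "line ((1 - t) * u + t * v) = (1 - t) * line u + t * line v"
proof -
  have "h + m * ((1 - t) * u + t * v - c) = (1 - t) * (h + m * (u - c)) + t * (h + m * (v - c))" for h m c :: real
    by (simp add: algebra_simps)
  then show ?thesis unfolding line_def .
qed

lemma line_at: "line (real k) < real h \<longleftrightarrow> b * east_height w i + a * k < b * h + a * i"
proof -
  have "line (real k) < real h \<longleftrightarrow> real b * line (real k) < real b * real h" using b_pos by simp
  also have "real b * line (real k) = real b * ht i + real a * real k - real a * real i"
    using b_pos by (simp add: line_def field_simps)
  also have "\<dots> < real b * real h \<longleftrightarrow> real (b * east_height w i + a * k) < real (b * h + a * i)" by (simp add: algebra_simps)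
  finally show ?thesis by (simp only: of_nat_less_iff)
qed

lemma line_at': "real h < line (real k) \<longleftrightarrow> b * h + a * i < b * east_height w i + a * k"
proof -
  have "real h < line (real k) \<longleftrightarrow> real b * real h < real b * line (real k)" using b_pos by simp
  also have "real b * line (real k) = real b * ht i + real a * real k - real a * real i"
    using b_pos by (simp add: line_def field_simps)
  also have "real b * real h < \<dots> \<longleftrightarrow> real (b * h + a * i) < real (b * east_height w i + a * k)" by (simp add: algebra_simps)
  finally show ?thesis by (simp only: of_nat_less_iff)
qed

lemma line_above: "i < k \<Longrightarrow> k < j \<Longrightarrow> line (real k) < ht k"
  using above line_at by simp

lemma hit_bounds: "real i < hit" "real j - 1 < hit" "hit < real j"
proof -
  have "east_height w (Suc i) \<le> east_height w j" using ij by (intro east_height_mono) simp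
  then have "line (real i) < line hit" unfolding line_i line_hit using valley by simp
  then show "real i < hit" by simp
  have "line hit < line (real j)" unfolding line_hit using below line_at' by simp
  then show "hit < real j" by simp
  show "real j - 1 < hit"
  proof (cases "j - 1 = i")
    case True then show ?thesis using \<open>real i < hit\<close> ij by linarith
  next
    case False
    then have "line (real (j - 1)) < ht (j - 1)" using line_above[of "j - 1"] ij by linarith
    also have "\<dots> \<le> line hit" unfolding line_hit using east_height_mono[of "j - 1" j w] by simp
    finally show ?thesis using ij by (simp add: of_nat_diff)
  qed
qed

lemma count_East: "count_list w East = b" using path b_pos by (simp add: dyck_path_iff)

lemma curve_eq: "curve w = staircase w"
  using count_East b_pos by (intro curve_staircase) auto

text \<open>The east step over \<open>x\<close> is higher than the laser: for \<open>k < j\<close>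
  because its right end is, for \<open>k = j\<close> because \<open>x\<close> comes before the
  hit.\<close>

lemma between:
  assumes "real i < x" "x < hit"
  obtains k where "i < k" "k \<le> j" "real k - 1 < x" "x \<le> real k" "line x < ht k"
proof -
  obtain k where k: "i < k" "real k - 1 < x" "x \<le> real k" using exists_nat_ceiling[OF assms(1)] .
  have "k \<le> j" using k hit_bounds assms by linarith
  moreover have "line x < ht k"
  proof (cases "k = j")
    case True then show ?thesis using assms(2) line_hit line_less_iff by metis
  next
    case False
    then have "line (real k) < ht k" using line_above k \<open>k \<le> j\<close> by simp
    then show ?thesis using k(3) line_le_iff by (meson order_le_less_trans)
  qed
  ultimately show thesis using that k by blast
qed

lemma hit_in_curve: "(hit, line hit) \<in> curve w"
proof -
  have "j - 1 < b" "real (j - 1) \<le> hit" "hit \<le> real (j - 1) + 1" using hit_bounds ij by (auto simp: of_nat_diff)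
  then show ?thesis unfolding curve_eq staircase_def line_hit count_East using ij by (auto intro!: exI[of _ "j - 1"])
qed

text \<open>Before \<open>hit\<close> the path runs strictly above the line, and at
  \<open>hit\<close> it is met. The definition of a laser forbids only earlier meetings, so the end
  point belongs to it.\<close>

lemma laser_eq: "laser a b w (real i, ht i) = {p. real i \<le> fst p \<and> fst p \<le> hit \<and> snd p = line (fst p)}"
proof -
  have pt: "(real i, ht i) + t *\<^sub>R (real b, real a) = (real i + t * real b, line (real i + t * real b))" for t
    using b_pos by (simp add: line_def)
  have free: "(x, line x) \<notin> curve w" if x: "real i < x" "x < hit" for x
  proof
    assume c: "(x, line x) \<in> curve w"
    obtain k where k: "real k - 1 < x" "line x < ht k" using between[OF x] by metis
    then show False using staircase_above[of "(x, line x)" w k] c by (simp add: curve_eq)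
  qed
  show ?thesis
  proof (intro equalityI subsetI)
    fix p assume "p \<in> laser a b w (real i, ht i)"
    then obtain t where t: "0 \<le> t" "p = (real i + t * real b, line (real i + t * real b))"
      "\<And>s. 0 < s \<Longrightarrow> s < t \<Longrightarrow> (real i + s * real b, line (real i + s * real b)) \<notin> curve w"
      unfolding laser_def pt by blast
    have "real i + t * real b \<le> hit"
    proof (rule ccontr)
      assume "\<not> ?thesis"
      then have "(hit - real i) / real b < t" using b_pos by (simp add: field_simps)
      moreover have "0 < (hit - real i) / real b" using hit_bounds b_pos by simp
      ultimately have "(real i + (hit - real i) / real b * real b, line (real i + (hit - real i) / real b * real b)) \<notin> curve w"
        using t(3) by blast
      then show False using hit_in_curve b_pos by simp
    qed
    then show "p \<in> {p. real i \<le> fst p \<and> fst p \<le> hit \<and> snd p = line (fst p)}" using t by simp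
  next
    fix p assume "p \<in> {p. real i \<le> fst p \<and> fst p \<le> hit \<and> snd p = line (fst p)}"
    then have p: "real i \<le> fst p" "fst p \<le> hit" "p = (fst p, line (fst p))" by (auto simp: prod_eq_iff)
    define t where "t = (fst p - real i) / real b"
    have t: "0 \<le> t" "real i + t * real b = fst p" using p b_pos by (simp_all add: t_def)
    have "(real i + s * real b, line (real i + s * real b)) \<notin> curve w" if "0 < s" "s < t" for s
    proof (rule free)
      show "real i < real i + s * real b" using that b_pos by simp
      have "s * real b < t * real b" using that b_pos by simp
      then show "real i + s * real b < hit" using t p by linarith
    qed
    moreover have "p = (real i + t * real b, line (real i + t * real b))" using p t by simp
    ultimately show "p \<in> laser a b w (real i, ht i)" unfolding laser_def pt using t(1) by blast
  qed
qed

text \<open>The open set enclosed by the laser and the path. The piece for \<open>k\<close> reaches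
  to the right as far as \<open>hit\<close>, not only to \<open>k\<close>: the pieces then overlap
  and leave no seams at integer abscissas. They stay below the path because heights do not
  decrease.\<close>

definition laser_region :: "(real \<times> real) set" where
  "laser_region = (\<Union>k\<in>{i<..j}. {p. real k - 1 < fst p \<and> fst p < hit \<and> line (fst p) < snd p \<and> snd p < ht k})"

abbreviation barrier :: "(real \<times> real) set" where
  "barrier \<equiv> curve w \<union> laser a b w (real i, ht i)"

lemma continuous_line [continuous_intros]: "continuous_on S f \<Longrightarrow> continuous_on S (\<lambda>p. line (f p))"
  unfolding line_def by (intro continuous_intros)

lemma open_inside: "open laser_region"
  unfolding laser_region_def
  by (intro open_UN ballI open_Collect_conj open_Collect_less continuous_intros)

lemma inside_barrier: "laser_region \<inter> barrier = {}"
proof -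
  have "p \<notin> barrier" if p: "p \<in> laser_region" for p
  proof -
    obtain k where k: "real k - 1 < fst p" "line (fst p) < snd p" "snd p < ht k"
      using p by (auto simp: laser_region_def)
    have "p \<notin> curve w" using staircase_above[of p w k] k by (auto simp: curve_eq)
    then show ?thesis using k(2) by (auto simp: laser_eq)
  qed
  then show ?thesis by blast
qed

text \<open>Closing up column by column adds only points of the laser, of east steps and of vertical
  steps; the part of a left edge below the preceding east step already lies in the preceding piece
  or on the laser.\<close>

lemma closed_inside_barrier: "closed (laser_region \<union> barrier)"
proof -
  define T where "T k = {p. real k - 1 \<le> fst p \<and> fst p \<le> real k \<and> fst p \<le> hit \<and>
      line (fst p) \<le> snd p \<and> snd p \<le> ht k}" for k
  have T: "T k \<subseteq> laser_region \<union> barrier" if k: "i < k" "k \<le> j" for k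
  proof
    fix p assume "p \<in> T k"
    then have p: "real k - 1 \<le> fst p" "fst p \<le> real k" "fst p \<le> hit" "line (fst p) \<le> snd p" "snd p \<le> ht k"
      by (auto simp: T_def)
    have ip: "real i \<le> fst p" using p k by linarith
    show "p \<in> laser_region \<union> barrier"
    proof (cases "snd p = line (fst p) \<or> snd p = ht k")
      case True
      moreover have "p \<in> curve w" if "snd p = ht k"
        using that p k ij unfolding curve_eq staircase_def count_East by (auto intro!: exI[of _ "k - 1"] simp: of_nat_diff)
      ultimately show ?thesis using p ip by (auto simp: laser_eq)
    next
      case False
      then have s: "line (fst p) < snd p" "snd p < ht k" using p by auto
      have "fst p \<noteq> hit"
      proof
        assume "fst p = hit"
        then have "k = j" using p k hit_bounds by linarith
        then show False using s \<open>fst p = hit\<close> line_hit by simp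
      qed
      then have h: "fst p < hit" using p by simp
      consider "real k - 1 < fst p" | "fst p = real (k - 1)" using p k by (force simp: of_nat_diff)
      then show ?thesis
      proof cases
        case 1 then show ?thesis using s h k by (auto simp: laser_region_def)
      next
        case 2
        have vert: "p \<in> curve w" if "ht (k - 1) \<le> snd p"
          using that 2 s k ij unfolding curve_eq staircase_def count_East by (auto intro!: exI[of _ "k - 1"])
        show ?thesis
        proof (cases "ht (k - 1) \<le> snd p")
          case lt: False
          have "k - 1 \<noteq> i"
          proof
            assume "k - 1 = i"
            then show False using lt s 2 line_i by simp
          qed
          then have "i < k - 1" using k by linarith
          moreover have "real (k - 1) - 1 < fst p" using 2 by linarith
          moreover have "k - 1 \<le> j" using k by simp
          ultimately show ?thesis using s h lt by (auto simp: laser_region_def intro!: bexI[of _ "k - 1"])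
        qed (use vert in auto)
      qed
    qed
  qed
  have "laser_region \<subseteq> (\<Union>k\<in>{i<..j}. T k)"
  proof
    fix p assume "p \<in> laser_region"
    then obtain k where k: "i < k" "real k - 1 < fst p" "fst p < hit" "line (fst p) < snd p" "snd p < ht k"
      by (auto simp: laser_region_def)
    have "real i < fst p" using k by linarith
    then obtain m where m: "i < m" "m \<le> j" "real m - 1 < fst p" "fst p \<le> real m" using between[OF _ k(3)] by metis
    have "k \<le> m" using k m by linarith
    then have "ht k \<le> ht m" using east_height_mono by simp
    then have "p \<in> T m" using k m by (auto simp: T_def)
    then show "p \<in> (\<Union>k\<in>{i<..j}. T k)" using m by auto
  qed
  then have "laser_region \<union> barrier = (\<Union>k\<in>{i<..j}. T k) \<union> barrier" using T by fastforce
  moreover have "closed (\<Union>k\<in>{i<..j}. T k)"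
    unfolding T_def by (intro closed_UN ballI closed_Collect_conj closed_Collect_le continuous_intros finite_greaterThanAtMost)
  moreover have "closed barrier"
  proof (rule closed_Un)
    show "closed (curve w)" unfolding curve_def by (intro closed_UN) auto
    show "closed (laser a b w (real i, ht i))"
      unfolding laser_eq by (intro closed_Collect_conj closed_Collect_le closed_Collect_eq continuous_intros)
  qed
  ultimately show ?thesis by (simp add: closed_Un)
qed

text \<open>Off the barrier, the region and its complement are both open, so no connected set
  avoiding the barrier meets both.\<close>

lemma not_connected:
  assumes "p \<in> laser_region" "q \<notin> laser_region"
  shows "\<not> connected_component (- barrier) p q"
proof
  assume "connected_component (- barrier) p q"
  then obtain T where T: "connected T" "T \<subseteq> - barrier" "p \<in> T" "q \<in> T" unfolding connected_component_def by blast
  have "open (- (laser_region \<union> barrier))" using closed_inside_barrier unfolding closed_def .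
  moreover have "T \<subseteq> laser_region \<union> - (laser_region \<union> barrier)" using T(2) by blast
  ultimately have "laser_region \<inter> T = {} \<or> - (laser_region \<union> barrier) \<inter> T = {}"
    using connectedD[OF T(1) open_inside] by blast
  then show False using T assms by blast
qed

lemma label_inside:
  assumes "i < l" "l < j" "line (real l) < y" "y < ht l"
  shows "(real l, y) \<in> laser_region"
proof -
  have "real l < hit" using assms hit_bounds by linarith
  then show ?thesis using assms by (auto simp: laser_region_def intro!: bexI[of _ l])
qed

lemma label_outside:
  assumes "\<not> (i < l \<and> l < j)" shows "(real l, y) \<notin> laser_region"
proof
  assume "(real l, y) \<in> laser_region"
  then obtain k where "i < k" "real k - 1 < real l" "real l < hit" by (auto simp: laser_region_def)
  then have "i < l \<and> l < j" using hit_bounds by linarith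
  then show False using assms by simp
qed

text \<open>From each label descend to the parallel of the laser at distance \<open>d\<close> above
  it, and move along this parallel. Choosing \<open>d\<close> below all gaps at labels suffices,
  since between \<open>m - 1\<close> and \<open>m\<close> the line is at most its value at
  \<open>m\<close> while the path has height \<open>ht m\<close>.\<close>

lemma connected_inside:
  assumes l: "i < l" "l < j" and l': "i < l'" "l' < j" and e: "0 < e"
    "line (real l) < ht l - e" "line (real l') < ht l' - e"
  shows "connected_component (- barrier) (real l, ht l - e) (real l', ht l' - e)"
proof -
  let ?S = "(\<lambda>k. ht k - line (real k)) ` {i<..<j}"
  define d where "d = Min ?S / 2"
  have "0 < Min ?S" using l by (subst Min_gr_iff) (auto intro: line_above)
  then have d: "0 < d" "d < Min ?S" by (simp_all add: d_def)
  have dk: "line (real k) + d < ht k" if "i < k" "k < j" for k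
  proof -
    have "Min ?S \<le> ht k - line (real k)" using that by (intro Min_le) auto
    then show ?thesis using d by linarith
  qed
  have vert: "connected_component (- barrier) (real k, ht k - e) (real k, line (real k) + d)"
    if k: "i < k" "k < j" "line (real k) < ht k - e" for k
  proof (rule connected_component_segment)
    have "p \<in> laser_region" if "p \<in> closed_segment (real k, ht k - e) (real k, line (real k) + d)" for p
    proof -
      have "fst p = real k" "line (real k) < snd p" "snd p < ht k"
        using that k e(1) d dk[OF k(1,2)] by (auto simp: closed_segment_vertical closed_segment_eq_real_ivl split: if_splits)
      then show ?thesis using label_inside[of k "snd p"] k by (metis prod.collapse)
    qed
    then show "closed_segment (real k, ht k - e) (real k, line (real k) + d) \<subseteq> - barrier"
      using inside_barrier by blast
  qed
  have slant: "connected_component (- barrier) (real k, line (real k) + d) (real k', line (real k') + d)"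
    if k: "i < k" "k < j" "i < k'" "k' < j" for k k'
  proof (rule connected_component_segment)
    have "p \<in> laser_region" if p: "p \<in> closed_segment (real k, line (real k) + d) (real k', line (real k') + d)" for p
    proof -
      have aff: "line ((1 - t) * u + t * v) + d = (1 - t) * (line u + d) + t * (line v + d)" for t u v
        unfolding line_affine by (simp add: algebra_simps)
      have s: "snd p = line (fst p) + d" and f: "fst p \<in> closed_segment (real k) (real k')"
        using closed_segment_PairD1[OF p aff] by auto
      have f': "real i < fst p" "fst p \<le> real (j - 1)"
        using f k by (auto simp: closed_segment_eq_real_ivl of_nat_diff split: if_splits)
      obtain m where m: "i < m" "real m - 1 < fst p" "fst p \<le> real m" using exists_nat_ceiling[OF f'(1)] .
      have "m < j" using m f' ij by linarith
      have "line (fst p) + d \<le> line (real m) + d" using m by simp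
      also have "\<dots> < ht m" using dk m \<open>m < j\<close> by simp
      finally have "snd p < ht m" using s by simp
      moreover have "fst p < hit" using f' hit_bounds ij by (simp add: of_nat_diff)
      ultimately show ?thesis using m \<open>m < j\<close> s d by (auto simp: laser_region_def intro!: bexI[of _ m])
    qed
    then show "closed_segment (real k, line (real k) + d) (real k', line (real k') + d) \<subseteq> - barrier"
      using inside_barrier by blast
  qed
  show ?thesis
    using connected_component_trans[OF vert[OF l e(2)] connected_component_trans[OF slant[OF l l'] connected_component_sym[OF vert[OF l' e(3)]]]] .
qed

text \<open>From each label go straight down to height \<open>-1\<close>, below both path and laser.
  Among the labels outside only \<open>k = i\<close> has the laser over its abscissa, and there the
  laser is at the valley itself, above the label.\<close>

lemma connected_outside:
  assumes l: "\<not> (i < l \<and> l < j)" and l': "\<not> (i < l' \<and> l' < j)" and e: "0 < e"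
  shows "connected_component (- barrier) (real l, ht l - e) (real l', ht l' - e)"
proof -
  have free: "p \<notin> barrier" if "fst p = real k" "snd p < ht k" "\<not> (i < k \<and> k < j)" for p k
  proof -
    have "p \<notin> curve w" using staircase_above[of p w k] that by (auto simp: curve_eq)
    moreover have False if "p \<in> laser a b w (real i, ht i)"
    proof -
      have "real i \<le> real k" "real k \<le> hit" "snd p = line (real k)" using that \<open>fst p = real k\<close> by (auto simp: laser_eq)
      then have "k = i" using \<open>\<not> (i < k \<and> k < j)\<close> hit_bounds by linarith
      then show False using \<open>snd p = line (real k)\<close> \<open>snd p < ht k\<close> line_i by simp
    qed
    ultimately show ?thesis by blast
  qed
  have vert: "connected_component (- barrier) (real k, ht k - e) (real k, -1)"
    if k: "\<not> (i < k \<and> k < j)" for k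
  proof (rule connected_component_segment)
    have "p \<notin> barrier" if "p \<in> closed_segment (real k, ht k - e) (real k, -1)" for p
    proof -
      have "0 \<le> ht k" by simp
      then have "fst p = real k" "snd p < ht k"
        using that e by (auto simp: closed_segment_vertical closed_segment_eq_real_ivl split: if_splits)
      then show ?thesis using free k by blast
    qed
    then show "closed_segment (real k, ht k - e) (real k, -1) \<subseteq> - barrier" by blast
  qed
  have "connected_component (- barrier) (real l, -1) (real l', -1)"
  proof (rule connected_component_segment)
    have "p \<notin> barrier" if "snd p = -1" for p
    proof -
      have "p \<notin> curve w"
      proof
        assume "p \<in> curve w"
        then have "0 \<le> snd p" unfolding curve_eq staircase_def by (auto intro: order_trans[OF of_nat_0_le_iff])
        then show False using that by simp
      qed
      moreover have False if lz: "p \<in> laser a b w (real i, ht i)"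
      proof -
        have "line (real i) \<le> snd p" using lz by (auto simp: laser_eq)
        moreover have "0 \<le> line (real i)" by (simp add: line_i)
        ultimately show False using \<open>snd p = -1\<close> by linarith
      qed
      ultimately show ?thesis by blast
    qed
    then show "closed_segment (real l, - 1) (real l', - 1) \<subseteq> - barrier" by (auto simp: closed_segment_horizontal)
  qed
  from connected_component_trans[OF vert[OF l] connected_component_trans[OF this connected_component_sym[OF vert[OF l']]]]
  show ?thesis .
qed

lemma separated_iff:
  assumes l: "0 < l" "l \<le> b" and l': "0 < l'" "l' \<le> b"
  shows "separated a b w (real i, ht i) l l' \<longleftrightarrow> (i < l \<and> l < j) \<noteq> (i < l' \<and> l' < j)"
proof -
  have pt: "east_end w k - (0, e) = (real k, ht k - e)" if "0 < k" "k \<le> b" for k e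
    using east_end_eq[of k w] that count_East by simp
  \<comment> \<open>A label inside lies above the laser only when \<open>e\<close> is smaller than
    its gap; this is where smallness of the displacement enters.\<close>
  have ev: "\<forall>\<^sub>F e in at_right 0. 0 < e \<and> (i < k \<and> k < j \<longrightarrow> line (real k) < ht k - e)" for k
  proof (cases "i < k \<and> k < j")
    case True
    then have "0 < ht k - line (real k)" using line_above by simp
    then have "\<forall>\<^sub>F e in at_right 0. e \<in> {0<..<ht k - line (real k)}"
      by (rule eventually_at_right_real)
    then show ?thesis by (rule eventually_mono) auto
  next
    case False
    then show ?thesis using eventually_at_right_less[of "0::real"] by (auto elim: eventually_mono)
  qed
  have "\<forall>\<^sub>F e in at_right 0. (\<not> connected_component (- barrier) (east_end w l - (0, e)) (east_end w l' - (0, e))) \<longleftrightarrow>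
      ((i < l \<and> l < j) \<noteq> (i < l' \<and> l' < j))"
    using ev[of l] ev[of l']
  proof eventually_elim
    case (elim e)
    have e: "0 < e" using elim by simp
    show ?case
    proof (cases "(i < l \<and> l < j) = (i < l' \<and> l' < j)")
      case True
      then show ?thesis
        unfolding pt[OF l] pt[OF l'] using connected_inside connected_outside elim by (cases "i < l \<and> l < j") auto
    next
      case False
      have "\<not> connected_component (- barrier) (real x, ht x - e) (real y, ht y - e)"
        if "i < x" "x < j" "line (real x) < ht x - e" "\<not> (i < y \<and> y < j)" for x y
        using not_connected[OF label_inside[OF that(1-3)] label_outside[OF that(4)]] e by simp
      then show ?thesis
        unfolding pt[OF l] pt[OF l'] using False elim connected_component_sym by (cases "i < l \<and> l < j") blast+
    qed
  qed
  then have "separated a b w (real i, ht i) l l' \<longleftrightarrow>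
      (\<forall>\<^sub>F e in at_right (0::real). (i < l \<and> l < j) \<noteq> (i < l' \<and> l' < j))"
    unfolding separated_def by (rule eventually_cong) 
  then show ?thesis by (simp add: eventually_const_iff)
qed

end

section \<open>Gaussian polynomials\<close>

lemma coeff_q_int: "coeff (q_int n) i = (if i < n then 1 else 0)"
  by (simp add: q_int_def coeff_sum)

lemma q_int_Suc_0 [simp]: "q_int (Suc 0) = 1"
  by (simp add: q_int_def)

lemma q_int_add: "q_int (m + n) = q_int m + monom 1 m * q_int n"
  by (rule poly_eqI) (auto simp: coeff_q_int coeff_monom_mult)

lemma q_int_nonzero: "0 < n \<Longrightarrow> q_int n \<noteq> 0"
  using coeff_q_int[of n 0] by auto

lemma q_fact_Suc: "q_fact (Suc n) = q_fact n * q_int (Suc n)"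
  by (simp add: q_fact_def)

lemma q_fact_0 [simp]: "q_fact 0 = 1"
  by (simp add: q_fact_def)

lemma q_fact_nonzero: "q_fact n \<noteq> 0"
  by (induction n) (auto simp: q_fact_Suc q_int_nonzero)

text \<open>The q-binomial coefficient through the q-Pascal recursion, which makes it a polynomial
  by construction. In terms of partitions in a box, the recursion asks whether a part
  \<open>Suc b\<close> occurs.\<close>

fun gauss :: "nat \<Rightarrow> nat \<Rightarrow> int poly" where
  "gauss 0 b = 1"
| "gauss (Suc a) 0 = 1"
| "gauss (Suc a) (Suc b) = gauss (Suc a) b + monom 1 (Suc b) * gauss a (Suc b)"

lemma gauss_q_fact: "gauss a b * (q_fact a * q_fact b) = q_fact (a + b)"
proof (induction a b rule: gauss.induct)
  case (3 a b)
  have "gauss (Suc a) (Suc b) * (q_fact (Suc a) * q_fact (Suc b)) =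
     gauss (Suc a) b * (q_fact (Suc a) * q_fact b) * q_int (Suc b) +
     gauss a (Suc b) * (q_fact a * q_fact (Suc b)) * (monom 1 (Suc b) * q_int (Suc a))"
    by (simp add: q_fact_Suc algebra_simps)
  also have "\<dots> = q_fact (Suc (a + b)) * (q_int (Suc b) + monom 1 (Suc b) * q_int (Suc a))"
    using 3 by (simp add: algebra_simps)
  also have "\<dots> = q_fact (Suc a + Suc b)"
    unfolding q_int_add[symmetric] by (simp add: q_fact_Suc add.commute)
  finally show ?case .
qed auto

lemma degree_gauss: "degree (gauss a b) \<le> a * b"
proof (induction a b rule: gauss.induct)
  case (3 a b)
  have "degree (monom 1 (Suc b) * gauss a (Suc b)) \<le> Suc b + a * Suc b"
    using 3 by (intro degree_mult_le[THEN order_trans]) (simp add: degree_monom_eq)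
  then show ?case using 3 by (simp add: degree_add_le)
qed auto

text \<open>Partitions of \<open>i\<close> in an \<open>a\<close> by \<open>b\<close> box, padded
  with zero parts so that the number of parts is exactly \<open>a\<close>.\<close>

definition box_msets :: "nat \<Rightarrow> nat \<Rightarrow> nat \<Rightarrow> nat multiset set" where
  "box_msets a b i = {M. size M = a \<and> set_mset M \<subseteq> {..b} \<and> sum_mset M = i}"

lemma finite_box_msets: "finite (box_msets a b i)"
proof (rule finite_subset)
  show "box_msets a b i \<subseteq> mset ` {xs. set xs \<subseteq> {..b} \<and> length xs = a}"
  proof
    fix M assume "M \<in> box_msets a b i"
    moreover obtain xs where "M = mset xs" using ex_mset by metis
    ultimately show "M \<in> mset ` {xs. set xs \<subseteq> {..b} \<and> length xs = a}" by (auto simp: box_msets_def)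
  qed
qed (intro finite_imageI finite_lists_length_eq finite_atMost)

lemma coeff_gauss: "coeff (gauss a b) i = int (card (box_msets a b i))"
proof (induction a b arbitrary: i rule: gauss.induct)
  case (1 b)
  have "box_msets 0 b i = (if i = 0 then {{#}} else {})" by (auto simp: box_msets_def)
  then show ?case by simp
next
  case (2 a)
  have "box_msets (Suc a) 0 i = (if i = 0 then {replicate_mset (Suc a) 0} else {})"
  proof -
    have "M = replicate_mset (size M) 0" if "set_mset M \<subseteq> {0}" for M :: "nat multiset"
      using that set_mset_subset_singletonD by fastforce
    then have "size M = Suc a \<and> set_mset M \<subseteq> {..0} \<longleftrightarrow> M = replicate_mset (Suc a) 0" for M :: "nat multiset"
      by (metis atMost_0 set_mset_replicate_mset_subset size_replicate_mset subset_refl empty_subsetI)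
    then have "box_msets (Suc a) 0 i = {M. M = replicate_mset (Suc a) 0 \<and> sum_mset M = i}"
      unfolding box_msets_def conj_assoc[symmetric] by simp
    then show ?thesis by (auto split: if_splits)
  qed
  then show ?case by simp
next
  case (3 a b)
  have split: "box_msets (Suc a) (Suc b) i = box_msets (Suc a) b i \<union>
     (if Suc b \<le> i then add_mset (Suc b) ` box_msets a (Suc b) (i - Suc b) else {})" (is "?L = ?R")
  proof (intro equalityI subsetI)
    fix M assume M: "M \<in> ?L"
    show "M \<in> ?R"
    proof (cases "Suc b \<in># M")
      case True
      then obtain M' where "M = add_mset (Suc b) M'" by (metis mset_add)
      then show ?thesis using M by (auto simp: box_msets_def)
    next
      case False
      then have "set_mset M \<subseteq> {..b}" using M by (auto simp: box_msets_def) (metis atMost_iff le_SucE subsetD)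
      then show ?thesis using M by (auto simp: box_msets_def)
    qed
  next
    fix M assume "M \<in> ?R"
    then show "M \<in> ?L" by (auto simp: box_msets_def split: if_splits)
  qed
  have "card ?L = card (box_msets (Suc a) b i) +
     card (if Suc b \<le> i then add_mset (Suc b) ` box_msets a (Suc b) (i - Suc b) else {})"
    unfolding split by (rule card_Un_disjoint) (auto simp: finite_box_msets, auto simp: box_msets_def split: if_splits)
  also have "\<dots> = card (box_msets (Suc a) b i) + (if Suc b \<le> i then card (box_msets a (Suc b) (i - Suc b)) else 0)"
    by (simp add: card_image inj_on_def)
  finally show ?case using 3 by (simp add: coeff_monom_mult del: of_nat_add) 
qed

text \<open>Gaussian elimination: each equation added in the induction is solved for a pivot
  \<open>p\<close> and substituted into the others. It supplies a kernel vector of the raising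
  operator.\<close>

lemma underdetermined_system:
  fixes c :: "'b \<Rightarrow> 'a \<Rightarrow> real"
  assumes "finite B" "finite A" "card B < card A"
  shows "\<exists>x. (\<exists>\<alpha>\<in>A. x \<alpha> \<noteq> 0) \<and> (\<forall>\<beta>\<in>B. (\<Sum>\<alpha>\<in>A. c \<beta> \<alpha> * x \<alpha>) = 0)"
  using assms
proof (induction B arbitrary: A c rule: finite_induct)
  case empty
  then have "A \<noteq> {}" by auto
  then show ?case by (intro exI[of _ "\<lambda>_. 1"]) auto
next
  case (insert \<beta> B)
  show ?case
  proof (cases "\<forall>\<alpha>\<in>A. c \<beta> \<alpha> = 0")
    case True
    have "card B < card A" using insert by simp
    then obtain x where "\<exists>\<alpha>\<in>A. x \<alpha> \<noteq> 0" "\<forall>\<beta>\<in>B. (\<Sum>\<alpha>\<in>A. c \<beta> \<alpha> * x \<alpha>) = 0"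
      using insert.IH[OF insert.prems(1)] by blast
    then show ?thesis using True by auto
  next
    case False
    then obtain p where p: "p \<in> A" "c \<beta> p \<noteq> 0" by blast
    define c' where "c' \<gamma> \<alpha> = c \<gamma> \<alpha> - c \<gamma> p * c \<beta> \<alpha> / c \<beta> p" for \<gamma> \<alpha>
    have "card B < card (A - {p})" using insert p by simp
    then obtain x where x: "\<exists>\<alpha>\<in>A - {p}. x \<alpha> \<noteq> 0" "\<forall>\<gamma>\<in>B. (\<Sum>\<alpha>\<in>A - {p}. c' \<gamma> \<alpha> * x \<alpha>) = 0"
      using insert.IH[of "A - {p}" c'] insert.prems by auto
    define y where "y = x(p := - (\<Sum>\<alpha>\<in>A - {p}. c \<beta> \<alpha> * x \<alpha>) / c \<beta> p)"
    have sum: "(\<Sum>\<alpha>\<in>A. c \<gamma> \<alpha> * y \<alpha>) = c \<gamma> p * y p + (\<Sum>\<alpha>\<in>A - {p}. c \<gamma> \<alpha> * x \<alpha>)" for \<gamma>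
    proof -
      have "(\<Sum>\<alpha>\<in>A - {p}. c \<gamma> \<alpha> * y \<alpha>) = (\<Sum>\<alpha>\<in>A - {p}. c \<gamma> \<alpha> * x \<alpha>)"
        by (intro sum.cong) (auto simp: y_def)
      then show ?thesis using sum.remove[OF insert.prems(1) p(1), of "\<lambda>\<alpha>. c \<gamma> \<alpha> * y \<alpha>"] by simp
    qed
    have "(\<Sum>\<alpha>\<in>A. c \<gamma> \<alpha> * y \<alpha>) = 0" if "\<gamma> \<in> insert \<beta> B" for \<gamma>
    proof (cases "\<gamma> = \<beta>")
      case True then show ?thesis unfolding sum using p(2) by (simp add: y_def)
    next
      case False
      then have "0 = (\<Sum>\<alpha>\<in>A - {p}. c' \<gamma> \<alpha> * x \<alpha>)" using x(2) that by auto
      also have "\<dots> = (\<Sum>\<alpha>\<in>A - {p}. c \<gamma> \<alpha> * x \<alpha>) - c \<gamma> p / c \<beta> p * (\<Sum>\<alpha>\<in>A - {p}. c \<beta> \<alpha> * x \<alpha>)"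
        unfolding c'_def sum_distrib_left sum_subtractf[symmetric] by (intro sum.cong) (auto simp: algebra_simps)
      finally show ?thesis unfolding sum by (simp add: y_def)
    qed
    moreover have "\<exists>\<alpha>\<in>A. y \<alpha> \<noteq> 0" using x(1) by (auto simp: y_def)
    ultimately show ?thesis by blast
  qed
qed

section \<open>Unimodality\<close>

definition raise_weight :: "nat \<Rightarrow> nat \<Rightarrow> real" where
  "raise_weight b y = sqrt (real y * real (Suc b - y))"

lemma raise_weight_boundary [simp]: "raise_weight b 0 = 0" "raise_weight b (Suc b) = 0"
  by (simp_all add: raise_weight_def)

lemma raise_weight_sq: "(raise_weight b y)\<^sup>2 = real y * real (Suc b - y)"
  unfolding raise_weight_def by (rule real_sqrt_pow2) simp

text \<open>The difference is the weight of the basis vector \<open>y\<close>, that is the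
  eigenvalue of the commutator; it survives in the norm identity.\<close>

lemma raise_weight_sq_diff:
  assumes "y \<le> b"
  shows "(raise_weight b (Suc y))\<^sup>2 - (raise_weight b y)\<^sup>2 = real b - 2 * real y"
  using assms by (simp add: raise_weight_sq of_nat_diff algebra_simps)

abbreviation tuples :: "nat \<Rightarrow> nat \<Rightarrow> (nat \<Rightarrow> nat) set" where
  "tuples a b \<equiv> {..<a} \<rightarrow>\<^sub>E {..b}"

lemma finite_tuples: "finite (tuples a b)"
  by (intro finite_PiE) auto

text \<open>The shift misses tuples with entry \<open>0\<close> at \<open>t\<close> and pushes those
  with entry \<open>b\<close> out of the box; both contribute zero by the boundary
  assumptions.\<close>

lemma sum_tuples_shift:
  fixes F :: "(nat \<Rightarrow> nat) \<Rightarrow> real"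
  assumes t: "t < a" and 0: "\<And>x. x t = 0 \<Longrightarrow> F x = 0" and b: "\<And>x. x t = Suc b \<Longrightarrow> F x = 0"
  shows "(\<Sum>x\<in>tuples a b. F x) = (\<Sum>y\<in>tuples a b. F (y(t := Suc (y t))))"
proof -
  have "(\<Sum>x\<in>tuples a b. F x) = (\<Sum>x\<in>{x \<in> tuples a b. 0 < x t}. F x)"
    using 0 by (intro sum.mono_neutral_right finite_tuples) auto
  also have "\<dots> = (\<Sum>y\<in>{y \<in> tuples a b. y t < b}. F (y(t := Suc (y t))))"
  proof (rule sum.reindex_bij_witness[where i = "\<lambda>y. y(t := Suc (y t))" and j = "\<lambda>x. x(t := x t - 1)"])
    fix x assume "x \<in> {x \<in> tuples a b. 0 < x t}"
    then have x: "x \<in> tuples a b" "0 < x t" by auto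
    have "x t \<le> b" using x t by (auto simp: PiE_iff)
    then have "x t - Suc 0 \<le> b" "x t - Suc 0 < b" using x(2) by linarith+
    then show "x(t := x t - 1) \<in> {y \<in> tuples a b. y t < b}"
      using x t by (auto simp: PiE_iff extensional_def)
    show "(x(t := x t - 1))(t := Suc ((x(t := x t - 1)) t)) = x" using x by auto
    then show "F ((x(t := x t - 1))(t := Suc ((x(t := x t - 1)) t))) = F x" by simp
  next
    fix y assume "y \<in> {y \<in> tuples a b. y t < b}"
    then show "y(t := Suc (y t)) \<in> {x \<in> tuples a b. 0 < x t}"
      using t by (auto simp: PiE_iff extensional_def)
    show "(y(t := Suc (y t)))(t := (y(t := Suc (y t))) t - 1) = y" by auto
  qed
  also have "\<dots> = (\<Sum>y\<in>tuples a b. F (y(t := Suc (y t))))"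
  proof (intro sum.mono_neutral_left finite_tuples ballI)
    fix y assume "y \<in> tuples a b - {y \<in> tuples a b. y t < b}"
    then have "y t \<le> b" "\<not> y t < b" using t by (auto simp: PiE_iff)
    then have "y t = b" by linarith
    then show "F (y(t := Suc (y t))) = 0" by (intro b) simp
  qed auto
  finally show ?thesis .
qed

definition raise_op :: "nat \<Rightarrow> nat \<Rightarrow> ((nat \<Rightarrow> nat) \<Rightarrow> real) \<Rightarrow> (nat \<Rightarrow> nat) \<Rightarrow> real" where
  "raise_op a b f x = (\<Sum>t<a. raise_weight b (x t) * f (x(t := x t - 1)))"

definition lower_op :: "nat \<Rightarrow> nat \<Rightarrow> ((nat \<Rightarrow> nat) \<Rightarrow> real) \<Rightarrow> (nat \<Rightarrow> nat) \<Rightarrow> real" where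
  "lower_op a b f x = (\<Sum>t<a. raise_weight b (Suc (x t)) * f (x(t := Suc (x t))))"

text \<open>Both operators come from the action of \<open>sl\<^sub>2\<close> on the \<open>a\<close>-th tensor power of its irreducible
  representation of dimension \<open>b + 1\<close>, with the weights chosen such that they are adjoint to each
  other; the identity is the commutation relation in the form of a quadratic form.\<close>

lemma raise_lower_norm:
  fixes f :: "(nat \<Rightarrow> nat) \<Rightarrow> real"
  shows "(\<Sum>x\<in>tuples a b. (raise_op a b f x)\<^sup>2) = (\<Sum>x\<in>tuples a b. (lower_op a b f x)\<^sup>2) +
     (\<Sum>x\<in>tuples a b. (real (a * b) - 2 * real (\<Sum>t<a. x t)) * (f x)\<^sup>2)"
proof -
  let ?T = "tuples a b" and ?w = "raise_weight b"
  define u where "u s x = ?w (x s) * f (x(s := x s - 1))" for s x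
  define d where "d s x = ?w (Suc (x s)) * f (x(s := Suc (x s)))" for s x
  \<comment> \<open>For \<open>s\<close> and \<open>t\<close> distinct, shifting both coordinates
    turns one product into the other; only the diagonal \<open>s = t\<close> leaves a commutator
    term.\<close>
  have diff: "(\<Sum>x\<in>?T. u s x * u t x) = (\<Sum>x\<in>?T. d s x * d t x) +
      (if s = t then \<Sum>x\<in>?T. (real b - 2 * real (x t)) * (f x)\<^sup>2 else 0)" if st: "s < a" "t < a" for s t
  proof (cases "s = t")
    case True
    have 1: "(\<Sum>x\<in>?T. u t x * u t x) = (\<Sum>x\<in>?T. (?w (Suc (x t)))\<^sup>2 * (f x)\<^sup>2)"
    proof -
      have "(\<Sum>x\<in>?T. u t x * u t x) = (\<Sum>y\<in>?T. u t (y(t := Suc (y t))) * u t (y(t := Suc (y t))))"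
        by (rule sum_tuples_shift[OF st(2)]) (auto simp: u_def)
      then show ?thesis by (simp add: u_def power2_eq_square mult_ac)
    qed
    have 2: "(\<Sum>x\<in>?T. (?w (x t))\<^sup>2 * (f x)\<^sup>2) = (\<Sum>x\<in>?T. d t x * d t x)"
    proof -
      have "(\<Sum>x\<in>?T. (?w (x t))\<^sup>2 * (f x)\<^sup>2) =
        (\<Sum>y\<in>?T. (?w ((y(t := Suc (y t))) t))\<^sup>2 * (f (y(t := Suc (y t))))\<^sup>2)"
        by (rule sum_tuples_shift[OF st(2)]) auto
      then show ?thesis by (simp add: d_def power2_eq_square mult_ac)
    qed
    have "(\<Sum>x\<in>?T. (?w (Suc (x t)))\<^sup>2 * (f x)\<^sup>2) - (\<Sum>x\<in>?T. (?w (x t))\<^sup>2 * (f x)\<^sup>2) =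
       (\<Sum>x\<in>?T. (real b - 2 * real (x t)) * (f x)\<^sup>2)"
      unfolding sum_subtractf[symmetric] left_diff_distrib[symmetric]
      using st by (intro sum.cong refl, subst raise_weight_sq_diff) (auto simp: PiE_iff)
    then show ?thesis using True 1 2 by simp
  next
    case False
    have "(\<Sum>x\<in>?T. u s x * u t x) = (\<Sum>y\<in>?T. u s (y(t := Suc (y t))) * u t (y(t := Suc (y t))))"
      by (rule sum_tuples_shift[OF st(2)]) (auto simp: u_def)
    also have "\<dots> = (\<Sum>y\<in>?T. ?w (y s) * f (y(t := Suc (y t), s := y s - 1)) * (?w (Suc (y t)) * f y))"
      using False by (simp add: u_def)
    also have "\<dots> = (\<Sum>z\<in>?T. (\<lambda>y. ?w (y s) * f (y(t := Suc (y t), s := y s - 1)) * (?w (Suc (y t)) * f y)) (z(s := Suc (z s))))"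
      by (rule sum_tuples_shift[OF st(1)]) auto
    also have "\<dots> = (\<Sum>x\<in>?T. d s x * d t x)"
    proof (rule sum.cong[OF refl])
      fix z
      have "z(s := Suc (z s), t := Suc (z t), s := z s) = z(t := Suc (z t))" using False by auto
      then show "(\<lambda>y. ?w (y s) * f (y(t := Suc (y t), s := y s - 1)) * (?w (Suc (y t)) * f y)) (z(s := Suc (z s))) = d s z * d t z"
        using False by (simp add: d_def mult_ac)
    qed
    finally show ?thesis using False by simp
  qed
  have "(\<Sum>x\<in>?T. (raise_op a b f x)\<^sup>2) = (\<Sum>x\<in>?T. \<Sum>s<a. \<Sum>t<a. u s x * u t x)"
    by (simp add: raise_op_def u_def power2_eq_square sum_product)
  also have "\<dots> = (\<Sum>s<a. \<Sum>t<a. \<Sum>x\<in>?T. u s x * u t x)"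
    by (subst sum.swap) (intro sum.cong refl sum.swap)
  also have "\<dots> = (\<Sum>s<a. \<Sum>t<a. (\<Sum>x\<in>?T. d s x * d t x)) +
     (\<Sum>s<a. \<Sum>t<a. if s = t then \<Sum>x\<in>?T. (real b - 2 * real (x t)) * (f x)\<^sup>2 else 0)"
    unfolding sum.distrib[symmetric] by (intro sum.cong refl diff) auto
  also have "(\<Sum>s<a. \<Sum>t<a. (\<Sum>x\<in>?T. d s x * d t x)) = (\<Sum>x\<in>?T. \<Sum>s<a. \<Sum>t<a. d s x * d t x)"
    by (subst (2) sum.swap) (intro sum.cong refl sum.swap)
  also have "\<dots> = (\<Sum>x\<in>?T. (lower_op a b f x)\<^sup>2)"
    by (simp add: lower_op_def d_def power2_eq_square sum_product)
  also have "(\<Sum>s<a. \<Sum>t<a. if s = t then \<Sum>x\<in>?T. (real b - 2 * real (x t)) * (f x)\<^sup>2 else 0) =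
     (\<Sum>s<a. \<Sum>x\<in>?T. (real b - 2 * real (x s)) * (f x)\<^sup>2)"
    by (intro sum.cong refl) (simp add: sum.delta)
  also have "\<dots> = (\<Sum>x\<in>?T. (real (a * b) - 2 * real (\<Sum>t<a. x t)) * (f x)\<^sup>2)"
    by (subst sum.swap) (simp add: sum_distrib_right[symmetric] sum_subtractf sum_distrib_left[symmetric])
  finally show ?thesis .
qed

definition tuple_mset :: "nat \<Rightarrow> (nat \<Rightarrow> nat) \<Rightarrow> nat multiset" where
  "tuple_mset a x = image_mset x (mset_set {..<a})"

lemma tuple_mset_update:
  assumes "t < a" shows "tuple_mset a (x(t := v)) = tuple_mset a x - {#x t#} + {#v#}"
proof -
  have "mset_set {..<a} = add_mset t (mset_set ({..<a} - {t}))"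
    using assms mset_set.remove[of "{..<a}" t] by simp
  moreover have "image_mset (x(t := v)) (mset_set ({..<a} - {t})) = image_mset x (mset_set ({..<a} - {t}))"
    by (intro image_mset_cong) auto
  ultimately show ?thesis by (simp add: tuple_mset_def)
qed

lemma sum_tuple_mset: "sum_mset (tuple_mset a x) = (\<Sum>t<a. x t)"
  unfolding tuple_mset_def by (rule sum_unfold_sum_mset[symmetric])

lemma tuple_mset_in_box: "x \<in> tuples a b \<Longrightarrow> tuple_mset a x \<in> box_msets a b (\<Sum>t<a. x t)"
  unfolding box_msets_def mem_Collect_eq
  by (intro conjI sum_tuple_mset) (auto simp: tuple_mset_def PiE_iff)

lemma box_mset_is_tuple_mset:
  assumes "M \<in> box_msets a b i"
  obtains x where "x \<in> tuples a b" "tuple_mset a x = M"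
proof -
  obtain xs where xs: "M = mset xs" using ex_mset by metis
  define x where "x = (\<lambda>t\<in>{..<a}. xs ! t)"
  have len: "length xs = a" "set xs \<subseteq> {..b}" using assms xs by (auto simp: box_msets_def)
  have "x \<in> tuples a b" using len by (auto simp: x_def PiE_iff) (metis atMost_iff nth_mem subsetD)
  moreover have "tuple_mset a x = M"
  proof -
    have "tuple_mset a x = image_mset ((!) xs) (mset_set {..<a})"
      unfolding tuple_mset_def x_def by (intro image_mset_cong) simp
    also have "\<dots> = mset (map ((!) xs) [0..<a])" by (simp add: mset_upt atLeast0LessThan)
    also have "\<dots> = M" using len xs map_nth[of xs] by metis
    finally show ?thesis .
  qed
  ultimately show thesis using that by blast
qed

text \<open>If the coefficient dropped, the raising operator from degree \<open>i\<close> to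
  \<open>Suc i\<close> would kill a nonzero symmetric function \<open>f\<close>. The norm identity
  then writes \<open>0\<close> as a sum of squares plus the positive multiple
  \<open>a * b - 2 * i\<close> of the squared norm of \<open>f\<close>, which forces
  \<open>f = 0\<close>.\<close>

lemma gauss_coeff_mono:
  assumes "2 * i < a * b"
  shows "coeff (gauss a b) i \<le> coeff (gauss a b) (Suc i)"
proof (rule ccontr)
  assume "\<not> ?thesis"
  then have lt: "card (box_msets a b (Suc i)) < card (box_msets a b i)" by (simp add: coeff_gauss)
  \<comment> \<open>Matrix of the raising operator on symmetric functions of tuples, indexed by the
    multisets of their entries.\<close>
  define c where "c M' M = (\<Sum>v\<in>#M'. raise_weight b v * (if M' - {#v#} + {#v - 1#} = M then 1 else 0))" for M' M
  obtain \<phi> where \<phi>: "\<exists>M\<in>box_msets a b i. \<phi> M \<noteq> 0"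
      "\<forall>M'\<in>box_msets a b (Suc i). (\<Sum>M\<in>box_msets a b i. c M' M * \<phi> M) = 0"
    using underdetermined_system[OF finite_box_msets finite_box_msets lt, of c] by blast
  define f where "f x = (if tuple_mset a x \<in> box_msets a b i then \<phi> (tuple_mset a x) else 0)" for x
  have zero: "raise_op a b f x = 0" if x: "x \<in> tuples a b" for x
  proof (cases "(\<Sum>t<a. x t) = Suc i")
    case True
    let ?M' = "tuple_mset a x"
    let ?h = "\<lambda>v. ?M' - {#v#} + {#v - 1#}"
    have "raise_op a b f x = (\<Sum>t<a. (\<lambda>v. raise_weight b v * (if ?h v \<in> box_msets a b i then \<phi> (?h v) else 0)) (x t))"
      unfolding raise_op_def f_def by (intro sum.cong refl) (simp add: tuple_mset_update)
    also have "\<dots> = (\<Sum>v\<in>#?M'. raise_weight b v * (if ?h v \<in> box_msets a b i then \<phi> (?h v) else 0))"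
      by (simp add: tuple_mset_def sum_unfold_sum_mset image_mset.compositionality comp_def)
    also have "\<dots> = (\<Sum>v\<in>#?M'. \<Sum>M\<in>box_msets a b i. raise_weight b v * (if ?h v = M then 1 else 0) * \<phi> M)"
    proof (intro arg_cong[where f = sum_mset] image_mset_cong)
      fix v
      have "(\<Sum>M\<in>box_msets a b i. raise_weight b v * (if ?h v = M then 1 else 0) * \<phi> M) =
        (\<Sum>M\<in>box_msets a b i. if ?h v = M then raise_weight b v * \<phi> M else 0)"
        by (intro sum.cong) auto
      then show "raise_weight b v * (if ?h v \<in> box_msets a b i then \<phi> (?h v) else 0) =
        (\<Sum>M\<in>box_msets a b i. raise_weight b v * (if ?h v = M then 1 else 0) * \<phi> M)"
        by (simp add: sum.delta' finite_box_msets)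
    qed
    also have "\<dots> = (\<Sum>M\<in>box_msets a b i. c ?M' M * \<phi> M)"
    proof -
      have "(\<Sum>v\<in>#K. \<Sum>M\<in>B. g v M * \<phi> M) = (\<Sum>M\<in>B. (\<Sum>v\<in>#K. g v M) * \<phi> M)"
        for K :: "nat multiset" and B and g :: "nat \<Rightarrow> nat multiset \<Rightarrow> real"
        by (induction K) (auto simp: sum.distrib distrib_right)
      then show ?thesis unfolding c_def by simp
    qed
    also have "\<dots> = 0" using \<phi>(2) tuple_mset_in_box[OF x] True by simp
    finally show ?thesis .
  next
    case False
    show ?thesis unfolding raise_op_def
    proof (intro sum.neutral ballI)
      fix t assume "t \<in> {..<a}"
      then have t: "t < a" by simp
      show "raise_weight b (x t) * f (x(t := x t - 1)) = 0"
      proof (cases "x t = 0")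
        case xt: False
        have "(\<Sum>s<a. (x(t := x t - 1)) s) + 1 = (\<Sum>s<a. x s)"
        proof -
          have "(\<Sum>s<a. (x(t := x t - 1)) s) = (x t - 1) + (\<Sum>s\<in>{..<a} - {t}. x s)"
          proof -
            have "(\<Sum>s\<in>{..<a} - {t}. (x(t := x t - 1)) s) = (\<Sum>s\<in>{..<a} - {t}. x s)"
              by (intro sum.cong) auto
            then show ?thesis using t sum.remove[of "{..<a}" t "x(t := x t - 1)"] by simp
          qed
          moreover have "(\<Sum>s<a. x s) = x t + (\<Sum>s\<in>{..<a} - {t}. x s)" using t sum.remove[of "{..<a}" t x] by simp
          ultimately show ?thesis using xt by simp
        qed
        then have "(\<Sum>s<a. (x(t := x t - 1)) s) \<noteq> i" using False by linarith
        then have "tuple_mset a (x(t := x t - 1)) \<notin> box_msets a b i"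
          unfolding box_msets_def using sum_tuple_mset[of a "x(t := x t - 1)"] by simp
        then show ?thesis by (simp add: f_def)
      qed simp
    qed
  qed
  have supp: "(real (a * b) - 2 * real (\<Sum>t<a. x t)) * (f x)\<^sup>2 = real (a * b - 2 * i) * (f x)\<^sup>2" for x
  proof (cases "tuple_mset a x \<in> box_msets a b i")
    case True
    then have "(\<Sum>t<a. x t) = i" unfolding box_msets_def using sum_tuple_mset[of a x] by simp
    then show ?thesis using assms by (simp add: of_nat_diff del: of_nat_sum)
  qed (simp add: f_def)
  have "0 = (\<Sum>x\<in>tuples a b. (lower_op a b f x)\<^sup>2) + (\<Sum>x\<in>tuples a b. real (a * b - 2 * i) * (f x)\<^sup>2)"
    using raise_lower_norm[of a b f, unfolded supp] zero by (simp del: of_nat_sum of_nat_mult)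
  moreover have "0 \<le> (\<Sum>x\<in>tuples a b. (lower_op a b f x)\<^sup>2)" by (intro sum_nonneg) simp
  moreover have "0 \<le> (\<Sum>x\<in>tuples a b. real (a * b - 2 * i) * (f x)\<^sup>2)" by (intro sum_nonneg) simp
  ultimately have "(\<Sum>x\<in>tuples a b. real (a * b - 2 * i) * (f x)\<^sup>2) = 0" by linarith
  then have "\<forall>x\<in>tuples a b. real (a * b - 2 * i) * (f x)\<^sup>2 = 0"
    using sum_nonneg_eq_0_iff[OF finite_tuples, of a b "\<lambda>x. real (a * b - 2 * i) * (f x)\<^sup>2"] by simp
  moreover have "0 < real (a * b - 2 * i)" using assms by (simp only: of_nat_0_less_iff zero_less_diff)
  ultimately have f0: "f x = 0" if "x \<in> tuples a b" for x
    using that by (metis less_irrefl mult_eq_0_iff zero_eq_power2)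
  obtain M where M: "M \<in> box_msets a b i" "\<phi> M \<noteq> 0" using \<phi>(1) by blast
  obtain x where "x \<in> tuples a b" "tuple_mset a x = M" using box_mset_is_tuple_mset[OF M(1)] .
  then show False using f0[of x] M by (simp add: f_def)
qed

section \<open>Rational q-Catalan numbers\<close>

text \<open>The subtractive Euclidean algorithm carries over to q-integers through
  \<open>q_int_add\<close>.\<close>

lemma q_int_bezout: "\<exists>u v. u * q_int a + v * q_int b = q_int (gcd a b)"
proof (induction "a + b" arbitrary: a b rule: less_induct)
  case less
  consider "a = 0" | "b = 0" | "0 < a" "a \<le> b" | "0 < b" "b < a" by linarith
  then show ?case
  proof cases
    case 1 then show ?thesis by (intro exI[of _ 0] exI[of _ 1]) simp
  next
    case 2 then show ?thesis by (intro exI[of _ 1] exI[of _ 0]) simp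
  next
    case 3
    then obtain u v where uv: "u * q_int a + v * q_int (b - a) = q_int (gcd a (b - a))"
      using less[of a "b - a"] by auto
    have "q_int b = q_int (b - a) + monom 1 (b - a) * q_int a" using q_int_add[of "b - a" a] 3 by simp
    then have "(u - v * monom 1 (b - a)) * q_int a + v * q_int b = u * q_int a + v * q_int (b - a)"
      by (simp add: algebra_simps)
    moreover have "gcd a (b - a) = gcd a b" using 3 by (metis gcd.commute gcd_diff1_nat)
    ultimately show ?thesis using uv by metis
  next
    case 4
    then obtain u v where uv: "u * q_int (a - b) + v * q_int b = q_int (gcd (a - b) b)"
      using less[of "a - b" b] by auto
    have "q_int a = q_int (a - b) + monom 1 (a - b) * q_int b" using q_int_add[of "a - b" b] 4 by simp
    then have "u * q_int a + (v - u * monom 1 (a - b)) * q_int b = u * q_int (a - b) + v * q_int b"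
      by (simp add: algebra_simps)
    moreover have "gcd (a - b) b = gcd a b" using 4 by (metis gcd_diff1_nat less_imp_le)
    ultimately show ?thesis using uv by metis
  qed
qed

text \<open>The products of \<open>X\<close> with \<open>q_int a\<close> and \<open>q_int b\<close>
  are the Gaussian polynomials for \<open>a - 1, b\<close> and \<open>a, b - 1\<close>. As
  \<open>a\<close> and \<open>b\<close> are coprime, a combination of these two q-integers is
  \<open>1\<close>, and it produces \<open>X\<close>.\<close>

lemma q_Catalan_poly_exists:
  assumes "0 < a" "0 < b" "coprime a b"
  obtains X where "X * (q_fact a * q_fact b) = q_fact (a + b - 1)"
proof -
  obtain u v where uv: "u * q_int a + v * q_int b = 1"
    using q_int_bezout[of a b] assms(3) by (auto simp: coprime_iff_gcd_eq_1)
  obtain a' b' where ab: "a = Suc a'" "b = Suc b'" using assms by (metis not0_implies_Suc less_irrefl)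
  let ?X = "u * gauss a' b + v * gauss a b'"
  have "?X * (q_fact a * q_fact b) =
    u * q_int a * (gauss a' b * (q_fact a' * q_fact b)) + v * q_int b * (gauss a b' * (q_fact a * q_fact b'))"
    using ab by (simp add: q_fact_Suc algebra_simps)
  also have "\<dots> = (u * q_int a + v * q_int b) * q_fact (a + b - 1)"
    unfolding gauss_q_fact using ab by (simp add: algebra_simps)
  finally show thesis using that uv by simp
qed

lemma reflect_q_int: "reflect_poly (q_int n) = q_int n"
proof (cases n)
  case (Suc m)
  have "degree (q_int n) = m"
    using Suc by (intro antisym degree_le le_degree) (auto simp: coeff_q_int)
  then show ?thesis using Suc by (intro poly_eqI) (auto simp: coeff_reflect_poly coeff_q_int)
qed (simp add: q_int_def)

lemma reflect_q_fact: "reflect_poly (q_fact n) = q_fact n"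
  by (simp add: q_fact_def reflect_poly_prod reflect_q_int)

context
  fixes a b :: nat and X :: "int poly"
  assumes a: "0 < a" and b: "0 < b" and X: "X * (q_fact a * q_fact b) = q_fact (a + b - 1)"
begin

lemma q_Catalan_mult_q_int: "X * q_int (a + b) = gauss a b"
proof -
  obtain n where n: "a + b = Suc n" using a by (metis add_is_0 less_irrefl not0_implies_Suc)
  have "X * q_int (a + b) * (q_fact a * q_fact b) = q_fact n * q_int (Suc n)"
    using X n by (simp add: algebra_simps)
  also have "\<dots> = gauss a b * (q_fact a * q_fact b)" unfolding gauss_q_fact n q_fact_Suc ..
  finally show ?thesis using q_fact_nonzero by simp
qed

lemma q_Catalan_reflect: "reflect_poly X = X"
proof -
  have "reflect_poly X * (q_fact a * q_fact b) = X * (q_fact a * q_fact b)"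
    using arg_cong[OF X, of reflect_poly] X unfolding reflect_poly_mult reflect_q_fact by metis
  then show ?thesis using q_fact_nonzero by simp
qed

lemma q_Catalan_coeff_nonneg: "0 \<le> coeff X i"
proof -
  have X0: "X \<noteq> 0" using X q_fact_nonzero by auto
  have "degree X \<le> degree (gauss a b)"
    unfolding q_Catalan_mult_q_int[symmetric] using X0 q_int_nonzero[of "a + b"] a by (subst degree_mult_eq) auto
  then have deg: "degree X \<le> a * b" using degree_gauss order_trans by blast
  have q1: "(1 - monom 1 1) * q_int n = 1 - monom 1 n" for n
    using q_int_add[of 1 n] q_int_add[of n 1] by (simp add: algebra_simps)
  have eq: "X = monom 1 (a + b) * X + gauss a b - monom 1 1 * gauss a b"
  proof -
    have "X * (1 - monom 1 (a + b)) = (1 - monom 1 1) * (X * q_int (a + b))"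
      by (simp only: q1[of "a + b", symmetric] mult_ac)
    then show ?thesis unfolding q_Catalan_mult_q_int by (simp add: algebra_simps)
  qed
  \<comment> \<open>The identity \<open>eq\<close> expresses a coefficient of \<open>X\<close> as
    the one \<open>a + b\<close> places earlier plus an increment of \<open>gauss a b\<close>. Since
    \<open>degree X <= a * b\<close>, the first half of \<open>X\<close> stays in the increasing
    range of \<open>gauss a b\<close>.\<close>
  have low: "0 \<le> coeff X i" if "2 * i \<le> degree X" for i
    using that
  proof (induction i rule: less_induct)
    case (less i)
    have "coeff X i = (if i < a + b then 0 else coeff X (i - (a + b))) + coeff (gauss a b) i -
        (if i < 1 then 0 else coeff (gauss a b) (i - 1))"
      by (subst eq) (simp add: coeff_monom_mult)
    moreover have "0 \<le> (if i < a + b then 0 else coeff X (i - (a + b)))" using less a by auto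
    moreover have "(if i < 1 then 0 else coeff (gauss a b) (i - 1)) \<le> coeff (gauss a b) i"
    proof (cases i)
      case 0 then show ?thesis by (simp add: coeff_gauss)
    next
      case (Suc j)
      have "2 * j < a * b" using Suc less.prems deg by linarith
      then show ?thesis using gauss_coeff_mono[of j a b] Suc by simp
    qed
    ultimately show ?case by linarith
  qed
  consider "2 * i \<le> degree X" | "degree X < i" | "i \<le> degree X" "2 * (degree X - i) \<le> degree X" by linarith
  then show ?thesis
  proof cases
    case 1 then show ?thesis by (rule low)
  next
    case 2 then show ?thesis by (simp add: coeff_eq_0)
  next
    case 3
    have "coeff X i = coeff (reflect_poly X) i" by (simp add: q_Catalan_reflect)
    also have "\<dots> = coeff X (degree X - i)" using 3 by (simp add: coeff_reflect_poly)
    finally show ?thesis using low[OF 3(2)] by simp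
  qed
qed

end

section \<open>Evaluation at roots of unity\<close>

definition complex_eval :: "complex \<Rightarrow> int poly \<Rightarrow> complex" where
  "complex_eval z p = poly (map_poly complex_of_int p) z"

lemma complex_eval_pCons [simp]: "complex_eval z (pCons c p) = of_int c + z * complex_eval z p"
  by (simp add: complex_eval_def map_poly_pCons)

lemma complex_eval_0 [simp]: "complex_eval z 0 = 0"
  by (simp add: complex_eval_def)

lemma complex_eval_1 [simp]: "complex_eval z 1 = 1"
  by (simp add: complex_eval_def)

lemma complex_eval_add [simp]: "complex_eval z (p + q) = complex_eval z p + complex_eval z q"
proof (induction p arbitrary: q)
  case (pCons c p)
  obtain d q' where "q = pCons d q'" by (cases q)
  then show ?case by (simp add: pCons.IH algebra_simps)
qed simp

lemma complex_eval_smult [simp]: "complex_eval z (smult c p) = of_int c * complex_eval z p"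
  by (induction p) (auto simp: algebra_simps)

lemma complex_eval_mult [simp]: "complex_eval z (p * q) = complex_eval z p * complex_eval z q"
  by (induction p) (auto simp: algebra_simps)

lemma complex_eval_monom [simp]: "complex_eval z (monom c k) = of_int c * z ^ k"
  by (simp add: complex_eval_def map_poly_monom poly_monom)

lemma complex_eval_sum [simp]: "complex_eval z (sum f A) = (\<Sum>i\<in>A. complex_eval z (f i))"
  by (induction A rule: infinite_finite_induct) auto

lemma complex_eval_prod [simp]: "complex_eval z (prod f A) = (\<Prod>i\<in>A. complex_eval z (f i))"
  by (induction A rule: infinite_finite_induct) auto

lemma q_fact_add: "q_fact (m + k) = q_fact m * (\<Prod>j=1..k. q_int (m + j))"
  by (induction k) (auto simp: q_fact_Suc algebra_simps)

text \<open>The q-integer of \<open>k\<close> in the variable \<open>q ^ e\<close>; at an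
  \<open>e\<close>-th root of unity its value is \<open>k\<close>.\<close>

definition q_int_pow :: "nat \<Rightarrow> nat \<Rightarrow> int poly" where
  "q_int_pow e k = (\<Sum>i<k. monom 1 (e * i))"

lemma q_int_mult: "q_int (e * k) = q_int e * q_int_pow e k"
proof (induction k)
  case (Suc k)
  have "q_int (e * Suc k) = q_int (e * k) + monom 1 (e * k) * q_int e"
    using q_int_add[of "e * k" e] by (simp add: add.commute)
  then show ?case using Suc by (simp add: q_int_pow_def algebra_simps)
qed (simp add: q_int_def q_int_pow_def)

lemma complex_eval_q_int_nonzero:
  assumes "z ^ j \<noteq> 1" shows "complex_eval z (q_int j) \<noteq> 0"
proof -
  have "z \<noteq> 1" using assms by auto
  then have "complex_eval z (q_int j) = (z ^ j - 1) / (z - 1)"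
    by (simp add: q_int_def geometric_sum)
  then show ?thesis using assms \<open>z \<noteq> 1\<close> by simp
qed

text \<open>Since \<open>b - 1\<close> is a multiple of the order \<open>e\<close> of \<open>z\<close>, the factors of numerator and denominator agree
  at \<open>z\<close> except for those whose index is divisible by \<open>e\<close>; these have a common simple zero.\<close>

lemma q_Catalan_eval:
  fixes a n e N :: nat
  assumes X: "X * (q_fact a * q_fact (Suc n)) = q_fact (a + Suc n - 1)" and a: "0 < a"
    and z: "\<And>j. z ^ j = 1 \<longleftrightarrow> e dvd j" and e: "2 \<le> e" and n: "n = e * N"
  shows "complex_eval z X = of_nat ((N + a div e) choose (a div e))"
proof -
  \<comment> \<open>Cancelling the q-factorial of \<open>n + 1\<close> and dropping
    \<open>q_int 1 = 1\<close> leaves products over the same range \<open>2..a\<close>, with index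
    \<open>j\<close> below and \<open>n + j\<close> above.\<close>
  have "X * (\<Prod>j=1..a. q_int j) * q_fact (Suc n) = q_fact (Suc n + (a - 1))"
    using X a by (simp add: q_fact_def mult.assoc add.commute)
  then have "X * (\<Prod>j=1..a. q_int j) = (\<Prod>j=1..a - 1. q_int (Suc n + j))"
    unfolding q_fact_add using q_fact_nonzero[of "Suc n"] by (simp add: mult.commute)
  moreover have "(\<Prod>j=1..a - 1. q_int (Suc n + j)) = (\<Prod>j=2..a. q_int (n + j))"
    using a by (intro prod.reindex_bij_witness[where i = "\<lambda>j. j - 1" and j = Suc]) auto
  moreover have "(\<Prod>j=1..a. q_int j) = (\<Prod>j=2..a. q_int j)"
    using a by (subst prod.atLeast_Suc_atMost) (auto simp: numeral_2_eq_2)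
  ultimately have X2: "X * (\<Prod>j=2..a. q_int j) = (\<Prod>j=2..a. q_int (n + j))" by simp
  define A where "A = {j \<in> {2..a}. \<not> e dvd j}"
  define B where "B = {j \<in> {2..a}. e dvd j}"
  have split: "(\<Prod>j=2..a. f j) = (\<Prod>j\<in>A. f j) * (\<Prod>j\<in>B. f j)" for f :: "nat \<Rightarrow> int poly"
  proof -
    have "{2..a} = A \<union> B" by (auto simp: A_def B_def)
    moreover have "finite A" "finite B" "A \<inter> B = {}" by (auto simp: A_def B_def)
    ultimately show ?thesis by (simp only: prod.union_disjoint)
  qed
  have B: "(\<Prod>j\<in>B. f j) = (\<Prod>k=1..a div e. f (e * k))" for f :: "nat \<Rightarrow> int poly"
  proof (rule prod.reindex_bij_witness[where i = "\<lambda>k. e * k" and j = "\<lambda>j. j div e"])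
    fix j assume "j \<in> B"
    then have j: "2 \<le> j" "j \<le> a" "e dvd j" by (auto simp: B_def)
    show "e * (j div e) = j" using j by simp
    then show "f (e * (j div e)) = f j" by simp
    have "0 < j div e" using j e by (metis dvd_div_eq_0_iff gr0I not_numeral_le_zero)
    then show "j div e \<in> {1..a div e}" using j by (auto intro: div_le_mono)
  next
    fix k assume k: "k \<in> {1..a div e}"
    show "e * k div e = k" using e by simp
    have "e * k \<le> e * (a div e)" using k by simp
    also have "\<dots> \<le> a" by simp
    finally have "e * k \<le> a" .
    moreover have "2 * 1 \<le> e * k" using k e by (intro mult_mono) auto
    ultimately show "e * k \<in> B" by (auto simp: B_def)
  qed
  \<comment> \<open>The factors vanishing at \<open>z\<close> are collected in \<open>E\<close> and
    cancelled as polynomials, before evaluation.\<close>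
  define E where "E = (\<Prod>k=1..a div e. q_int e)"
  have E0: "E \<noteq> 0" unfolding E_def using q_int_nonzero[of e] e by simp
  have 1: "(\<Prod>j\<in>B. q_int j) = E * (\<Prod>k=1..a div e. q_int_pow e k)"
    unfolding B E_def prod.distrib[symmetric] by (simp add: q_int_mult)
  have 2: "(\<Prod>j\<in>B. q_int (n + j)) = E * (\<Prod>k=1..a div e. q_int_pow e (N + k))"
    unfolding B E_def prod.distrib[symmetric] n by (simp add: q_int_mult[symmetric] distrib_left)
  have "E * (X * (\<Prod>j\<in>A. q_int j) * (\<Prod>k=1..a div e. q_int_pow e k)) =
    E * ((\<Prod>j\<in>A. q_int (n + j)) * (\<Prod>k=1..a div e. q_int_pow e (N + k)))"
    using X2 unfolding split 1 2 by (simp add: mult_ac)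
  then have "X * (\<Prod>j\<in>A. q_int j) * (\<Prod>k=1..a div e. q_int_pow e k) =
    (\<Prod>j\<in>A. q_int (n + j)) * (\<Prod>k=1..a div e. q_int_pow e (N + k))" using E0 by simp
  from arg_cong[OF this, of "complex_eval z"]
  have ev: "complex_eval z X * (\<Prod>j\<in>A. complex_eval z (q_int j)) * (\<Prod>k=1..a div e. complex_eval z (q_int_pow e k)) =
    (\<Prod>j\<in>A. complex_eval z (q_int (n + j))) * (\<Prod>k=1..a div e. complex_eval z (q_int_pow e (N + k)))" by simp
  have zn: "z ^ n = 1" "z ^ e = 1" using z n by auto
  have qn: "complex_eval z (q_int n) = 0"
  proof -
    have "z \<noteq> 1" using z[of 1] e by auto
    have "complex_eval z (q_int n) = (z ^ n - 1) / (z - 1)"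
      using \<open>z \<noteq> 1\<close> by (simp add: q_int_def geometric_sum)
    then show ?thesis using zn by simp
  qed
  have "complex_eval z (q_int (n + j)) = complex_eval z (q_int j)" for j
    unfolding q_int_add by (simp add: qn zn)
  moreover have "complex_eval z (q_int_pow e k) = of_nat k" for k
    using zn by (simp add: q_int_pow_def power_mult)
  moreover have "(\<Prod>j\<in>A. complex_eval z (q_int j)) \<noteq> 0"
    using complex_eval_q_int_nonzero z by (auto simp: A_def)
  ultimately have "complex_eval z X * (\<Prod>k=1..a div e. of_nat k) = (\<Prod>k=1..a div e. of_nat (N + k))"
    using ev by (simp add: mult_ac)
  moreover have "(\<Prod>k=1..m. of_nat (N + k) :: complex) = of_nat ((N + m) choose m) * (\<Prod>k=1..m. of_nat k)" for m
  proof (induction m)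
    case (Suc m)
    have "Suc (N + m) * ((N + m) choose m) = Suc m * ((N + Suc m) choose Suc m)"
      using Suc_times_binomial[of m "N + m"] by (simp add: mult.commute)
    then have "of_nat (Suc (N + m)) * of_nat ((N + m) choose m) = (of_nat (Suc m) * of_nat ((N + Suc m) choose Suc m) :: complex)"
      by (metis of_nat_mult)
    then show ?case using Suc by (simp add: algebra_simps)
  qed simp
  moreover have "(\<Prod>k=1..a div e. of_nat k :: complex) \<noteq> 0" by auto
  ultimately show ?thesis by simp
qed

lemma complex_eval_1_q_fact: "complex_eval 1 (q_fact n) = of_nat (fact n)"
proof (induction n)
  case (Suc n)
  have "complex_eval 1 (q_int k) = of_nat k" for k by (simp add: q_int_def)
  then show ?case using Suc by (simp add: q_fact_Suc algebra_simps)
qed simp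

lemma q_Catalan_eval_1:
  assumes X: "X * (q_fact a * q_fact b) = q_fact (a + b - 1)" and b: "0 < b"
  shows "of_nat b * complex_eval 1 X = of_nat ((a + b - 1) choose a)"
proof -
  obtain n where n: "b = Suc n" using b by (metis not0_implies_Suc less_irrefl)
  have "complex_eval 1 X * (of_nat (fact a) * of_nat (fact b)) = of_nat (fact (a + n))"
    using arg_cong[OF X, of "complex_eval 1"] n by (simp add: complex_eval_1_q_fact)
  moreover have "of_nat (fact a * fact n * ((a + n) choose a)) = (of_nat (fact (a + n)) :: complex)"
    using binomial_fact_lemma[of a "a + n"] by simp
  ultimately have "(of_nat b * complex_eval 1 X) * (of_nat (fact a) * of_nat (fact n)) =
      of_nat ((a + n) choose a) * (of_nat (fact a) * of_nat (fact n))"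
    using n by (simp add: algebra_simps)
  then show ?thesis using n by simp
qed

section \<open>Noncrossing partitions as periodic relations\<close>

text \<open>For a valley \<open>i\<close> this says that the laser fired from \<open>i\<close> cuts
  off the label \<open>l\<close>.\<close>

definition visible :: "(int \<Rightarrow> int) \<Rightarrow> int \<Rightarrow> int \<Rightarrow> bool" where
  "visible g i l \<longleftrightarrow> i < l \<and> (\<forall>k. i < k \<and> k \<le> l \<longrightarrow> g i < g k)"

text \<open>The previous smaller index of a label is the largest index from which it is visible;
  when positive it is a valley. So labels visible from the same valleys share that index.
  Conversely, visibility from \<open>x\<close> passes between labels with a common previous smaller
  index.\<close>

lemma (in coprime_slope) block_rel_iff_visible:
  assumes g: "dyck_walk g" and k: "0 < k" "k < b" and l: "0 < l" "l < b"
  shows "block_rel g k l \<longleftrightarrow>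
    (\<forall>i. 0 < i \<and> i < b \<and> g i < g (i + 1) \<longrightarrow> (visible g i k \<longleftrightarrow> visible g i l))"
proof -
  obtain p where p: "prev_smaller g k p" "0 \<le> p" using prev_smaller_exists[OF g k] .
  obtain q where q: "prev_smaller g l q" "0 \<le> q" using prev_smaller_exists[OF g l] .
  have vis: "visible g x r" if "prev_smaller g r x" for r x
    using that unfolding visible_def prev_smaller_def by (auto simp: order_le_less)
  have le: "x \<le> y" if "prev_smaller g r y" "visible g x r" for r x y
    using that unfolding visible_def prev_smaller_def by (smt (verit, best))
  have trans: "visible g x s" if "prev_smaller g r y" "prev_smaller g s y" "visible g x r" for r s x y
  proof -
    have xy: "x \<le> y" by (rule le[OF that(1,3)])
    have gxy: "g x \<le> g y"
    proof (cases "x = y")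
      case False
      then have "x < y" "y \<le> r" using xy that(1) by (auto simp: prev_smaller_def)
      then show ?thesis using that(3) unfolding visible_def by (simp add: less_imp_le)
    qed simp
    have "g x < g u" if "x < u" "u \<le> s" for u
    proof (cases "u \<le> y")
      case True
      then show ?thesis using \<open>prev_smaller g r y\<close> \<open>visible g x r\<close> that unfolding visible_def prev_smaller_def by auto
    next
      case False
      then have "g s \<le> g u" using \<open>prev_smaller g s y\<close> that unfolding prev_smaller_def
        by (cases "u = s") (auto simp: order_le_less)
      then show ?thesis using gxy \<open>prev_smaller g s y\<close> unfolding prev_smaller_def by auto
    qed
    moreover have "x < s" using xy that(2) unfolding prev_smaller_def by auto
    ultimately show ?thesis unfolding visible_def by blast
  qed
  have rel: "block_rel g k l \<longleftrightarrow> p = q" using p q prev_smaller_unique unfolding block_rel_def by metis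
  show ?thesis
  proof
    assume "block_rel g k l"
    then show "\<forall>i. 0 < i \<and> i < b \<and> g i < g (i + 1) \<longrightarrow> (visible g i k \<longleftrightarrow> visible g i l)"
      using rel trans p q by blast
  next
    assume all: "\<forall>i. 0 < i \<and> i < b \<and> g i < g (i + 1) \<longrightarrow> (visible g i k \<longleftrightarrow> visible g i l)"
    have *: "y \<le> x" if "prev_smaller g r x" "prev_smaller g s y" "0 \<le> x" "0 < s" "s < b"
      "\<And>i. 0 < i \<Longrightarrow> i < b \<Longrightarrow> g i < g (i + 1) \<Longrightarrow> visible g i s \<Longrightarrow> visible g i r" for r s x y
    proof (cases "y \<le> 0")
      case False
      have "y < s" using that(2) by (simp add: prev_smaller_def)
      moreover have "g y < g (y + 1)"
        using prev_smaller_nonneg(2)[OF g that(4,5,2)] by (simp add: prev_smaller_def)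
      ultimately have "visible g y r" using that(5,6) vis[OF that(2)] False by simp
      then show ?thesis using le[OF that(1)] by blast
    qed (use that in simp)
    have "q \<le> p" using *[OF p(1) q(1) p(2) l] all by blast
    moreover have "p \<le> q" using *[OF q(1) p(1) q(2) k] all by blast
    ultimately show "block_rel g k l" using rel by simp
  qed
qed

definition path_walk :: "nat \<Rightarrow> nat \<Rightarrow> step list \<Rightarrow> int \<Rightarrow> int" where
  "path_walk a b w x = int b * int (east_height w (nat x)) - int a * x"

definition partition_of_rel :: "nat \<Rightarrow> (int \<Rightarrow> int \<Rightarrow> bool) \<Rightarrow> nat set set" where
  "partition_of_rel n R = {1..n} // {(i, j). i \<in> {1..n} \<and> j \<in> {1..n} \<and> R (int i) (int j)}"

locale rational_slope =
  fixes a b :: nat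
  assumes a_pos: "0 < a" and a_less_b: "a < b" and coprime_ab: "coprime a b"

sublocale rational_slope \<subseteq> slope: coprime_slope "int a" "int b"
  using a_pos a_less_b coprime_ab by unfold_locales auto

context rational_slope
begin

lemma dyck_walk_path_walk:
  assumes "dyck_path a b w" shows "slope.dyck_walk (path_walk a b w)"
proof -
  have b0: "0 < b" using a_less_b by simp
  have w: "count_list w East = b" "count_list w North = a" "\<And>i. i \<le> b \<Longrightarrow> a * i \<le> b * east_height w i"
    using assms b0 by (auto simp: dyck_path_iff)
  have "a \<le> east_height w b" using w(3)[of b] b0 by simp
  then have hb: "east_height w b = a" using east_height_le[of w b] w by simp
  have pos: "0 < path_walk a b w i" if i: "0 < i" "i < int b" for i
  proof -
    have "int a * i \<le> int b * int (east_height w (nat i))"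
    proof -
      have "int (a * nat i) \<le> int (b * east_height w (nat i))" using w(3)[of "nat i"] i by (simp only: of_nat_le_iff)
      then show ?thesis using i by simp
    qed
    \<comment> \<open>Coprimality excludes lattice points in the interior of the diagonal.\<close>
    moreover have "int a * i \<noteq> int b * int (east_height w (nat i))"
    proof
      assume "int a * i = int b * int (east_height w (nat i))"
      then have "int b dvd int a * i" by simp
      then have "int b dvd i" using slope.coprime_ab by (simp add: coprime_dvd_mult_right_iff coprime_commute)
      then show False using i zdvd_imp_le[of "int b" i] by linarith
    qed
    ultimately show ?thesis by (simp add: path_walk_def)
  qed
  have step: "path_walk a b w i - int a \<le> path_walk a b w (i + 1)" if "0 \<le> i" for i
  proof -
    have "east_height w (nat i) \<le> east_height w (nat (i + 1))" using that by (intro east_height_mono) simp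
    then have "int b * int (east_height w (nat i)) \<le> int b * int (east_height w (nat (i + 1)))" by (simp add: mult_left_mono)
    then show ?thesis by (simp add: path_walk_def algebra_simps)
  qed
  show ?thesis
    unfolding slope.dyck_walk_def using pos step hb by (auto simp: path_walk_def)
qed

text \<open>Each valley \<open>i\<close> is fed into \<open>laser_setup\<close>, with
  \<open>j\<close> the first later index of smaller walk value; the labels behind its laser are then
  those visible from \<open>i\<close>.\<close>

lemma not_separated_iff:
  assumes path: "dyck_path a b w" and k: "0 < k" "k < b" and l: "0 < l" "l < b"
  shows "\<not> (\<exists>P\<in>valleys w. separated a b w P k l) \<longleftrightarrow> slope.block_rel (path_walk a b w) (int k) (int l)"
proof -
  let ?g = "path_walk a b w"
  have b0: "0 < b" using a_less_b by simp
  note g = dyck_walk_path_walk[OF path]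
  have E: "count_list w East = b" using path b0 by (auto simp: dyck_path_iff)
  have gb: "?g (int b) = 0" using slope.dyck_walkD(2)[OF g] .
  have valley: "east_height w i < east_height w (Suc i) \<longleftrightarrow> ?g (int i) < ?g (int i + 1)" for i
  proof
    assume "east_height w i < east_height w (Suc i)"
    then have "int b * (int (east_height w i) + 1) \<le> int b * int (east_height w (Suc i))" by (intro mult_left_mono) auto
    then show "?g (int i) < ?g (int i + 1)" using a_less_b by (simp add: path_walk_def algebra_simps nat_add_distrib)
  next
    assume "?g (int i) < ?g (int i + 1)"
    then have "int b * int (east_height w i) < int b * int (east_height w (Suc i))"
      using a_pos by (simp add: path_walk_def algebra_simps nat_add_distrib)
    then show "east_height w i < east_height w (Suc i)" using b0 by simp
  qed
  \<comment> \<open>At abscissa \<open>b\<close> the path has already reached its full height, so no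
    valley lies there.\<close>
  have nb: "\<not> east_height w b < east_height w (Suc b)"
  proof -
    have "b * east_height w b = a * b" using gb by (simp add: path_walk_def mult.commute flip: of_nat_mult)
    then have "east_height w b = a" using b0 by simp
    moreover have "count_list w North = a" using path b0 by (auto simp: dyck_path_iff)
    ultimately show ?thesis using east_height_le[of w "Suc b"] by simp
  qed
  have sep: "separated a b w (real i, real (east_height w i)) k l \<longleftrightarrow> visible ?g (int i) (int k) \<noteq> visible ?g (int i) (int l)"
    if i: "0 < i" "i < b" "east_height w i < east_height w (Suc i)" for i
  proof -
    have "?g (int b) < ?g (int i)" using slope.dyck_walkD(3)[OF g, of "int i"] gb i by simp
    then obtain j' where j': "int i < j'" "j' \<le> int b" "?g j' < ?g (int i)"
        "\<And>z. int i < z \<Longrightarrow> z < j' \<Longrightarrow> \<not> ?g z < ?g (int i)"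
      using exists_first_int[of "int i" "int b" "\<lambda>x. ?g x < ?g (int i)"] i by auto
    obtain j where j: "j' = int j" using j'(1) zero_le_imp_eq_int[of j'] by auto
    have ab: "?g (int i) < ?g z" if "int i < z" "z < j'" for z
    proof -
      have "?g (int i) \<noteq> ?g z" using slope.dyck_walk_neq[OF g, of "int i" z] that i j'(2) by auto
      then show ?thesis using j'(4)[OF that] by linarith
    qed
    interpret laser_setup a b w i j
    proof
      show "0 < a" "dyck_path a b w" "0 < i" "i < j" "j \<le> b" "east_height w i < east_height w (Suc i)"
        using a_pos path i j' j by auto
      have *: "?g (int x) < ?g (int y) \<longleftrightarrow> b * east_height w x + a * y < b * east_height w y + a * x" for x y
      proof -
        have "?g (int x) < ?g (int y) \<longleftrightarrow> int (b * east_height w x + a * y) < int (b * east_height w y + a * x)"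
          by (simp add: path_walk_def algebra_simps)
        then show ?thesis by (simp only: of_nat_less_iff)
      qed
      show "b * east_height w i + a * k < b * east_height w k + a * i" if "i < k" "k < j" for k
        using ab[of "int k"] that * j by simp
      show "b * east_height w j + a * i < b * east_height w i + a * j" using j'(3) * j by simp
    qed
    have vis: "visible ?g (int i) (int r) \<longleftrightarrow> i < r \<and> r < j" for r
    proof
      assume v: "visible ?g (int i) (int r)"
      then have "\<not> j \<le> r" using j'(1,3) j unfolding visible_def by (metis int_ops(1) less_asym of_nat_le_iff)
      then show "i < r \<and> r < j" using v by (simp add: visible_def)
    next
      assume "i < r \<and> r < j"
      then show "visible ?g (int i) (int r)" unfolding visible_def using ab j by auto
    qed
    show ?thesis unfolding vis using separated_iff[of k l] k l by simp
  qed
  have "(\<exists>P\<in>valleys w. separated a b w P k l) \<longleftrightarrow>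
     (\<exists>i. 0 < i \<and> i < b \<and> east_height w i < east_height w (Suc i) \<and> separated a b w (real i, real (east_height w i)) k l)"
    unfolding valleys_eq E using nb by (auto simp: order_le_less)
  also have "\<dots> \<longleftrightarrow> (\<exists>i. 0 < i \<and> i < b \<and> ?g (int i) < ?g (int i + 1) \<and> visible ?g (int i) (int k) \<noteq> visible ?g (int i) (int l))"
    using sep valley by blast
  also have "\<dots> \<longleftrightarrow> (\<exists>i. 0 < i \<and> i < int b \<and> ?g i < ?g (i + 1) \<and> visible ?g i (int k) \<noteq> visible ?g i (int l))"
  proof
    assume "\<exists>i. 0 < i \<and> i < b \<and> ?g (int i) < ?g (int i + 1) \<and> visible ?g (int i) (int k) \<noteq> visible ?g (int i) (int l)"
    then show "\<exists>i. 0 < i \<and> i < int b \<and> ?g i < ?g (i + 1) \<and> visible ?g i (int k) \<noteq> visible ?g i (int l)"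
      by (metis of_nat_0_less_iff of_nat_less_iff)
  next
    assume "\<exists>i. 0 < i \<and> i < int b \<and> ?g i < ?g (i + 1) \<and> visible ?g i (int k) \<noteq> visible ?g i (int l)"
    then obtain i where "0 < i" "i < int b" "?g i < ?g (i + 1)" "visible ?g i (int k) \<noteq> visible ?g i (int l)" by blast
    then show "\<exists>i. 0 < i \<and> i < b \<and> ?g (int i) < ?g (int i + 1) \<and> visible ?g (int i) (int k) \<noteq> visible ?g (int i) (int l)"
      by (intro exI[of _ "nat i"]) auto
  qed
  finally show ?thesis using slope.block_rel_iff_visible[OF g, of "int k" "int l"] k l by auto
qed

lemma dyck_partition_eq:
  assumes "dyck_path a b w"
  shows "dyck_partition a b w = partition_of_rel (b - 1) (slope.cyclic_rel (path_walk a b w))"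
proof -
  have "{(i, j). i \<in> {1..b - 1} \<and> j \<in> {1..b - 1} \<and> \<not> (\<exists>P\<in>valleys w. separated a b w P i j)} =
      {(i, j). i \<in> {1..b - 1} \<and> j \<in> {1..b - 1} \<and> slope.cyclic_rel (path_walk a b w) (int i) (int j)}"
  proof -
    have "\<not> (\<exists>P\<in>valleys w. separated a b w P i j) \<longleftrightarrow> slope.cyclic_rel (path_walk a b w) (int i) (int j)"
      if "i \<in> {1..b - 1}" "j \<in> {1..b - 1}" for i j
    proof -
      have "0 < i" "i < b" "0 < j" "j < b" using that by auto
      then show ?thesis using not_separated_iff[OF assms] slope.label_id by (simp add: slope.cyclic_rel_def)
    qed
    then show ?thesis by blast
  qed
  then show ?thesis by (simp add: dyck_partition_def partition_of_rel_def)
qed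

lemma path_of_dyck_walk:
  assumes g: "slope.dyck_walk g"
  obtains w where "dyck_path a b w" "slope.cyclic_rel (path_walk a b w) = slope.cyclic_rel g"
proof -
  have b0: "0 < b" using a_less_b by simp
  define h where "h i = nat ((g (int i) + int a * int i) div int b)" for i :: nat
  have nonneg: "0 \<le> g i" if "0 \<le> i" "i \<le> int b" for i
    using slope.dyck_walkD(1,2)[OF g] slope.dyck_walkD(3)[OF g, of i] that by (cases "i = 0 \<or> i = int b") auto
  have bh: "int b * int (h i) = g (int i) + int a * int i" if "i \<le> b" for i
  proof -
    have d: "int b dvd g (int i) + int a * int i" using slope.dyck_walkD(5)[OF g, of "int i"] that by simp
    have "0 \<le> g (int i) + int a * int i" using nonneg[of "int i"] that by simp
    then have "0 \<le> (g (int i) + int a * int i) div int b" using b0 by (simp add: pos_imp_zdiv_nonneg_iff)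
    then show ?thesis using d by (simp add: h_def)
  qed
  have h0: "h 0 = 0" using slope.dyck_walkD(1)[OF g] by (simp add: h_def)
  have hb: "h b = a" using bh[of b] slope.dyck_walkD(2)[OF g] b0 by (simp add: mult.commute)
  have mono: "h i \<le> h (Suc i)" if "i < b" for i
  proof -
    have "g (int i) - int a \<le> g (int i + 1)" using slope.dyck_walkD(4)[OF g, of "int i"] that by simp
    then have "int b * int (h i) \<le> int b * int (h (Suc i))"
      using bh[of i] bh[of "Suc i"] that by (simp add: algebra_simps)
    then show ?thesis using b0 by simp
  qed
  obtain w where w: "count_list w East = b" "count_list w North = h b" "\<And>i. i \<le> b \<Longrightarrow> east_height w i = h i"
    using path_with_heights[of h b, OF h0 mono] by blast
  have "a * i \<le> b * east_height w i" if "i \<le> b" for i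
  proof -
    have "int (a * i) \<le> int (b * h i)" using bh[OF that] nonneg[of "int i"] that by simp
    then show ?thesis using w(3)[OF that] by (simp only: of_nat_le_iff)
  qed
  then have path: "dyck_path a b w" using w hb b0 by (simp add: dyck_path_iff)
  have "path_walk a b w i = g i" if "0 \<le> i" "i < int b" for i
    using bh[of "nat i"] w(3)[of "nat i"] that by (simp add: path_walk_def)
  then have "slope.cyclic_rel (path_walk a b w) = slope.cyclic_rel g"
    by (intro slope.cyclic_rel_cong dyck_walk_path_walk path g) 
  then show thesis using that path by blast
qed

lemma NC_eq: "NC a b = partition_of_rel (b - 1) ` slope.nc_rels"
proof (intro equalityI subsetI)
  fix \<pi> assume "\<pi> \<in> NC a b"
  then obtain w where w: "dyck_path a b w" "\<pi> = dyck_partition a b w" by (auto simp: NC_def)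
  have "slope.cyclic_rel (path_walk a b w) \<in> slope.nc_rels"
    using dyck_walk_path_walk[OF w(1)] by (auto simp: slope.nc_rels_def)
  then show "\<pi> \<in> partition_of_rel (b - 1) ` slope.nc_rels"
    using w(2) dyck_partition_eq[OF w(1)] by simp
next
  fix \<pi> assume "\<pi> \<in> partition_of_rel (b - 1) ` slope.nc_rels"
  then obtain g where g: "slope.dyck_walk g" "\<pi> = partition_of_rel (b - 1) (slope.cyclic_rel g)"
    by (auto simp: slope.nc_rels_def)
  obtain w where "dyck_path a b w" "slope.cyclic_rel (path_walk a b w) = slope.cyclic_rel g"
    using path_of_dyck_walk[OF g(1)] by blast
  then show "\<pi> \<in> NC a b" using g dyck_partition_eq[of w] by (auto simp: NC_def)
qed

section \<open>Partitions and their rotation\<close>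

lemma equiv_rel_nc:
  assumes "R \<in> slope.nc_rels"
  shows "equiv {1..n} {(i, j). i \<in> {1..n} \<and> j \<in> {1..n} \<and> R (int i) (int j)}"
proof -
  note E = slope.nc_rels_equiv[OF assms]
  let ?r = "{(i, j). i \<in> {1..n} \<and> j \<in> {1..n} \<and> R (int i) (int j)}"
  have "refl_on {1..n} ?r" by (rule refl_onI) (use E(1) in auto)
  moreover have "sym ?r" by (rule symI) (use E(2) in auto)
  moreover have "trans ?r"
  proof (rule transI)
    fix x y z assume "(x, y) \<in> ?r" "(y, z) \<in> ?r"
    then show "(x, z) \<in> ?r" using E(3)[of "int x" "int y" "int z"] by simp
  qed
  ultimately show ?thesis by (intro equivI) auto
qed

lemma nc_rels_label:
  assumes "R \<in> slope.nc_rels" shows "R x y \<longleftrightarrow> R (slope.label x) (slope.label y)"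
proof -
  obtain g where "R = slope.cyclic_rel g" using assms by (auto simp: slope.nc_rels_def)
  then show ?thesis by (simp only: slope.cyclic_rel_def slope.label_id[OF slope.label_range])
qed

lemma partition_of_rel_inj: "inj_on (partition_of_rel (b - 1)) slope.nc_rels"
proof (rule inj_onI)
  fix R R' assume R: "R \<in> slope.nc_rels" "R' \<in> slope.nc_rels"
    and eq: "partition_of_rel (b - 1) R = partition_of_rel (b - 1) R'"
  have *: "R' (int i) (int j)" if R: "R \<in> slope.nc_rels" "R' \<in> slope.nc_rels"
    and eq: "partition_of_rel (b - 1) R = partition_of_rel (b - 1) R'"
    and ij: "i \<in> {1..b - 1}" "j \<in> {1..b - 1}" "R (int i) (int j)" for R R' i j
  proof -
    let ?r = "{(i, j). i \<in> {1..b - 1} \<and> j \<in> {1..b - 1} \<and> R (int i) (int j)}"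
    let ?r' = "{(i, j). i \<in> {1..b - 1} \<and> j \<in> {1..b - 1} \<and> R' (int i) (int j)}"
    have "?r `` {i} \<in> {1..b - 1} // ?r'"
      using quotientI[OF ij(1), of ?r] eq unfolding partition_of_rel_def by simp
    moreover have "i \<in> ?r `` {i}" "j \<in> ?r `` {i}" using ij slope.nc_rels_equiv(1)[OF R(1)] by auto
    ultimately have "(i, j) \<in> ?r'" using in_quotient_imp_in_rel[OF equiv_rel_nc[OF R(2)]] by blast
    then show ?thesis by simp
  qed
  have "R x y \<longleftrightarrow> R' x y" for x y
  proof -
    have lab: "\<exists>i\<in>{1..b - 1}. slope.label x = int i" for x
    proof -
      have "0 < slope.label x" "slope.label x < int b" by (rule slope.label_range)+
      then show ?thesis by (intro bexI[of _ "nat (slope.label x)"]) auto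
    qed
    obtain i j where "i \<in> {1..b - 1}" "j \<in> {1..b - 1}" "slope.label x = int i" "slope.label y = int j"
      using lab[of x] lab[of y] by blast
    then show ?thesis using *[OF R eq, of i j] *[OF R(2,1) eq[symmetric], of i j] nc_rels_label[OF R(1), of x y] nc_rels_label[OF R(2), of x y]
      by metis
  qed
  then show "R = R'" by blast
qed

lemma rot_label:
  assumes "i \<in> {1..b - 1}"
  shows "rot (b - 1) i \<in> {1..b - 1} \<and> int (rot (b - 1) i) = slope.label (int i + 1)"
proof -
  have "slope.label (int i) = int i" using assms by (intro slope.label_id) auto
  moreover have "int i = int b - 1 \<longleftrightarrow> i = b - 1" using assms by auto
  ultimately show ?thesis using slope.label_add_1[of "int i"] assms by (auto simp: rot_def)
qed

lemma rot_bij: "bij_betw (rot (b - 1)) {1..b - 1} {1..b - 1}"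
proof -
  have "inj_on (rot (b - 1)) {1..b - 1}" by (rule inj_onI) (auto simp: rot_def split: if_splits)
  moreover have "rot (b - 1) ` {1..b - 1} \<subseteq> {1..b - 1}" using rot_label by blast
  ultimately show ?thesis by (simp add: bij_betw_def endo_inj_surj)
qed

text \<open>The shift is \<open>- 1\<close> because moving the elements forward means pulling the
  arguments of the relation back.\<close>

lemma rot_blocks_partition:
  assumes R: "R \<in> slope.nc_rels"
  shows "rot_blocks (b - 1) (partition_of_rel (b - 1) R) = partition_of_rel (b - 1) (slope.shift_rel (- 1) R)"
proof -
  let ?A = "{1..b - 1}" and ?f = "rot (b - 1)"
  let ?R' = "slope.shift_rel (- 1) R"
  let ?r = "{(i, j). i \<in> ?A \<and> j \<in> ?A \<and> R (int i) (int j)}"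
  let ?r' = "{(i, j). i \<in> ?A \<and> j \<in> ?A \<and> ?R' (int i) (int j)}"
  have R': "?R' \<in> slope.nc_rels" by (rule slope.nc_rels_shift[OF R])
  have rel: "?R' (int (?f i)) (int (?f j)) \<longleftrightarrow> R (int i) (int j)" if "i \<in> ?A" "j \<in> ?A" for i j
  proof -
    have "?R' (int (?f i)) (int (?f j)) \<longleftrightarrow> ?R' (int i + 1) (int j + 1)"
      using nc_rels_label[OF R', of "int i + 1" "int j + 1"] rot_label[OF that(1)] rot_label[OF that(2)] by simp
    then show ?thesis by (simp add: slope.shift_rel_def)
  qed
  have surj: "?f ` ?A = ?A" using rot_bij by (simp add: bij_betw_def)
  have cls: "?f ` (?r `` {i}) = ?r' `` {?f i}" if i: "i \<in> ?A" for i
  proof (intro equalityI subsetI)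
    fix y assume "y \<in> ?f ` (?r `` {i})"
    then obtain j where "j \<in> ?A" "R (int i) (int j)" "y = ?f j" by auto
    then show "y \<in> ?r' `` {?f i}" using rel[OF i] rot_label i by auto
  next
    fix y assume y: "y \<in> ?r' `` {?f i}"
    then have "y \<in> ?f ` ?A" unfolding surj by auto
    then obtain j where j: "j \<in> ?A" "y = ?f j" by blast
    then have "R (int i) (int j)" using y rel[OF i j(1)] by auto
    then show "y \<in> ?f ` (?r `` {i})" using i j by auto
  qed
  have "rot_blocks (b - 1) (?A // ?r) = (\<lambda>i. ?f ` (?r `` {i})) ` ?A"
    by (auto simp: rot_blocks_def quotient_def)
  also have "\<dots> = (\<lambda>i. ?r' `` {?f i}) ` ?A" using cls by (intro image_cong) auto
  also have "\<dots> = (\<lambda>i. ?r' `` {i}) ` (?f ` ?A)" by (simp only: image_image)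
  also have "\<dots> = ?A // ?r'" unfolding surj by (auto simp: quotient_def)
  finally show ?thesis unfolding partition_of_rel_def .
qed

lemma rot_blocks_pow_partition:
  assumes R: "R \<in> slope.nc_rels"
  shows "(rot_blocks (b - 1) ^^ k) (partition_of_rel (b - 1) R) = partition_of_rel (b - 1) (slope.shift_rel (- int k) R)"
proof (induction k)
  case (Suc k)
  have "(rot_blocks (b - 1) ^^ Suc k) (partition_of_rel (b - 1) R) =
      partition_of_rel (b - 1) (slope.shift_rel (- 1) (slope.shift_rel (- int k) R))"
    using Suc rot_blocks_partition[OF slope.nc_rels_shift[OF R]] by simp
  then show ?case by (simp add: slope.shift_rel_add)
qed simp

end

section \<open>Cyclic sieving\<close>

lemma (in coprime_slope) shift_rel_fixed_mult:
  assumes "shift_rel d R = R" shows "shift_rel (d * u) R = R"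
proof -
  have pos: "shift_rel (d * int k) R = R" for k
  proof (induction k)
    case (Suc k)
    have "shift_rel (d * int (Suc k)) R = shift_rel d (shift_rel (d * int k) R)"
      by (simp add: shift_rel_add algebra_simps)
    then show ?case using Suc assms by simp
  qed simp
  show ?thesis
  proof (cases "0 \<le> u")
    case True then show ?thesis using pos[of "nat u"] by simp
  next
    case False
    have "shift_rel (d * u) R = shift_rel (d * u) (shift_rel (d * int (nat (- u))) R)" by (simp only: pos)
    also have "\<dots> = R" using False by (simp add: shift_rel_add)
    finally show ?thesis .
  qed
qed

lemma primitive_root_pow_eq_1_iff:
  assumes "primitive_root_of_unity n \<zeta>" "0 < n"
  shows "\<zeta> ^ m = 1 \<longleftrightarrow> n dvd m"
proof -
  have 1: "\<zeta> ^ n = 1" "\<And>k. 0 < k \<Longrightarrow> k < n \<Longrightarrow> \<zeta> ^ k \<noteq> 1" using assms(1) by (auto simp: primitive_root_of_unity_def)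
  have "\<zeta> ^ m = \<zeta> ^ (n * (m div n) + m mod n)" by simp
  also have "\<dots> = \<zeta> ^ (m mod n)" unfolding power_add power_mult 1(1) by simp
  finally have "\<zeta> ^ m = 1 \<longleftrightarrow> \<zeta> ^ (m mod n) = 1" by simp
  also have "\<dots> \<longleftrightarrow> m mod n = 0" using 1(2)[of "m mod n"] assms(2) by (cases "m mod n = 0") auto
  finally show ?thesis unfolding dvd_eq_mod_eq_0 .
qed

context rational_slope
begin

lemma int_period: "int (b - 1) = int b - 1"
  using a_less_b by (simp add: of_nat_diff)

text \<open>The shifts fixing \<open>R\<close> form a subgroup of the integers containing
  \<open>b - 1\<close>, so by Bezout it contains \<open>k\<close> exactly when it contains the
  greatest common divisor.\<close>

lemma rot_blocks_pow_fixed_iff: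
  assumes R: "R \<in> slope.nc_rels"
  shows "(rot_blocks (b - 1) ^^ k) (partition_of_rel (b - 1) R) = partition_of_rel (b - 1) R \<longleftrightarrow>
    slope.shift_rel (int (gcd k (b - 1))) R = R"
proof -
  have "(rot_blocks (b - 1) ^^ k) (partition_of_rel (b - 1) R) = partition_of_rel (b - 1) R \<longleftrightarrow>
      slope.shift_rel (- int k) R = R"
    unfolding rot_blocks_pow_partition[OF R]
    using partition_of_rel_inj R slope.nc_rels_shift[OF R, of "- int k"] by (auto dest: inj_onD)
  also have "\<dots> \<longleftrightarrow> slope.shift_rel (int (gcd k (b - 1))) R = R"
  proof
    assume k: "slope.shift_rel (- int k) R = R"
    obtain u v where uv: "u * int k + v * int (b - 1) = int (gcd k (b - 1))"
      using bezout_int[of "int k" "int (b - 1)"] by auto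
    have "slope.shift_rel (- int k * - u) R = R" by (rule slope.shift_rel_fixed_mult[OF k])
    moreover have "slope.shift_rel ((int b - 1) * v) R = R" by (rule slope.nc_rels_period[OF R])
    ultimately have "slope.shift_rel (- int k * - u + (int b - 1) * v) R = R"
      by (metis slope.shift_rel_add)
    moreover have "- int k * - u + (int b - 1) * v = int (gcd k (b - 1))"
      using uv int_period by (simp add: mult.commute)
    ultimately show "slope.shift_rel (int (gcd k (b - 1))) R = R" by simp
  next
    assume g: "slope.shift_rel (int (gcd k (b - 1))) R = R"
    obtain u where "k = gcd k (b - 1) * u" using gcd_dvd1[of k "b - 1"] by (elim dvdE)
    then have "- int k = int (gcd k (b - 1)) * - int u" by (metis of_nat_mult mult_minus_right)
    then show "slope.shift_rel (- int k) R = R" using slope.shift_rel_fixed_mult[OF g, of "- int u"] by simp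
  qed
  finally show ?thesis .
qed

lemma card_rot_fixed:
  "card {x \<in> NC a b. (rot_blocks (b - 1) ^^ k) x = x} =
   card {R \<in> slope.nc_rels. slope.shift_rel (int (gcd k (b - 1))) R = R}"
proof -
  have "{x \<in> NC a b. (rot_blocks (b - 1) ^^ k) x = x} =
      partition_of_rel (b - 1) ` {R \<in> slope.nc_rels. slope.shift_rel (int (gcd k (b - 1))) R = R}"
    unfolding NC_eq using rot_blocks_pow_fixed_iff by blast
  then show ?thesis
    using card_image inj_on_subset[OF partition_of_rel_inj] by (metis (no_types, lifting) mem_Collect_eq subsetI)
qed

section \<open>The action of the cyclic group\<close>

lemma finite_NC: "finite (NC a b)"
  unfolding NC_eq using slope.card_nc_rels(2) by simp

lemma rot_pow_in_NC:
  assumes "x \<in> NC a b" shows "(rot_blocks (b - 1) ^^ k) x \<in> NC a b"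
proof -
  obtain R where R: "R \<in> slope.nc_rels" "x = partition_of_rel (b - 1) R" using assms unfolding NC_eq by blast
  show ?thesis
    unfolding NC_eq R(2) rot_blocks_pow_partition[OF R(1)] by (intro imageI slope.nc_rels_shift R(1))
qed

lemma rot_pow_period: "x \<in> NC a b \<Longrightarrow> (rot_blocks (b - 1) ^^ (b - 1)) x = x"
proof -
  assume "x \<in> NC a b"
  then obtain R where R: "R \<in> slope.nc_rels" "x = partition_of_rel (b - 1) R" unfolding NC_eq by blast
  have "slope.shift_rel (int b - 1) R = R" using slope.nc_rels_period[OF R(1), of 1] by simp
  then have "slope.shift_rel (int (gcd (b - 1) (b - 1))) R = R" using int_period by simp
  then show ?thesis unfolding R(2) rot_blocks_pow_fixed_iff[OF R(1)] .
qed

lemma rot_pow_mod: "x \<in> NC a b \<Longrightarrow> (rot_blocks (b - 1) ^^ (k mod (b - 1))) x = (rot_blocks (b - 1) ^^ k) x"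
proof -
  assume x: "x \<in> NC a b"
  have mult: "(rot_blocks (b - 1) ^^ ((b - 1) * q)) x = x" for q
  proof (induction q)
    case (Suc q)
    have "(rot_blocks (b - 1) ^^ ((b - 1) * Suc q)) x = (rot_blocks (b - 1) ^^ (b - 1)) ((rot_blocks (b - 1) ^^ ((b - 1) * q)) x)"
      by (simp add: funpow_add)
    then show ?case using Suc rot_pow_period[OF x] by simp
  qed simp
  have "(rot_blocks (b - 1) ^^ k) x = (rot_blocks (b - 1) ^^ (k mod (b - 1) + (b - 1) * (k div (b - 1)))) x" by simp
  also have "\<dots> = (rot_blocks (b - 1) ^^ (k mod (b - 1))) x" unfolding funpow_add comp_apply mult ..
  finally show ?thesis by simp
qed

lemma rot_action_group_action: "group_action (integer_mod_group (b - 1)) (NC a b) (rot_action a b)"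
proof -
  let ?C = "integer_mod_group (b - 1)" and ?X = "NC a b" and ?r = "rot_blocks (b - 1)"
  have n0: "0 < b - 1" using slope.b_gt_1 by simp
  have add: "(?r ^^ nat ((x + y) mod int (b - 1))) p = (?r ^^ nat x) ((?r ^^ nat y) p)"
    if "p \<in> ?X" "0 \<le> x" "0 \<le> y" for x y p
  proof -
    have "nat ((x + y) mod int (b - 1)) = (nat x + nat y) mod (b - 1)"
      using that by (simp add: nat_mod_distrib nat_add_distrib)
    then have "(?r ^^ nat ((x + y) mod int (b - 1))) p = (?r ^^ (nat x + nat y)) p" using rot_pow_mod[OF that(1)] by simp
    then show ?thesis by (simp add: funpow_add)
  qed
  have Bij: "rot_action a b x \<in> Bij ?X" for x
  proof -
    have "inj_on (?r ^^ nat x) ?X"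
    proof (rule inj_onI)
      fix p q assume pq: "p \<in> ?X" "q \<in> ?X" "(?r ^^ nat x) p = (?r ^^ nat x) q"
      \<comment> \<open>Applying \<open>k\<close> further rotations completes whole turns, so the
        power of rotation has a left inverse on \<open>NC a b\<close>.\<close>
      define k where "k = (b - 1) * nat x - nat x"
      have "1 * nat x \<le> (b - 1) * nat x" using n0 by (intro mult_right_mono) auto
      then have k: "k + nat x = (b - 1) * nat x" unfolding k_def by linarith
      have "(?r ^^ (k + nat x)) s = s" if "s \<in> ?X" for s
        unfolding k using rot_pow_mod[OF that, of "(b - 1) * nat x"] by simp
      then have "(?r ^^ k) ((?r ^^ nat x) p) = p" "(?r ^^ k) ((?r ^^ nat x) q) = q" using pq(1,2) by (simp_all add: funpow_add)
      then show "p = q" using pq(3) by metis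
    qed
    moreover have "(?r ^^ nat x) ` ?X \<subseteq> ?X" using rot_pow_in_NC by blast
    ultimately have "bij_betw (?r ^^ nat x) ?X ?X" using finite_NC by (simp add: bij_betw_def endo_inj_surj)
    then have "bij_betw (rot_action a b x) ?X ?X" unfolding rot_action_def by (simp cong: bij_betw_cong)
    then show ?thesis by (simp add: Bij_def rot_action_def)
  qed
  have "rot_action a b \<in> hom ?C (BijGroup ?X)"
  proof (rule homI)
    fix x assume "x \<in> carrier ?C"
    then show "rot_action a b x \<in> carrier (BijGroup ?X)" using Bij by (simp add: BijGroup_def)
  next
    fix x y assume xy: "x \<in> carrier ?C" "y \<in> carrier ?C"
    then have nn: "0 \<le> x" "0 \<le> y" using n0 by (auto simp: carrier_integer_mod_group)
    have "rot_action a b ((x + y) mod int (b - 1)) = compose ?X (rot_action a b x) (rot_action a b y)"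
    proof
      fix p
      show "rot_action a b ((x + y) mod int (b - 1)) p = compose ?X (rot_action a b x) (rot_action a b y) p"
        using add[OF _ nn] rot_pow_in_NC by (cases "p \<in> ?X") (auto simp: rot_action_def compose_def)
    qed
    then show "rot_action a b (x \<otimes>\<^bsub>?C\<^esub> y) = rot_action a b x \<otimes>\<^bsub>BijGroup ?X\<^esub> rot_action a b y"
      using Bij by (simp add: BijGroup_def)
  qed
  then show ?thesis
    by (intro group_action.intro group_hom.intro group_hom_axioms.intro group_BijGroup) simp_all
qed

text \<open>The number \<open>e\<close> is the order of \<open>\<zeta> ^ d\<close>, and rotation by
  \<open>d\<close> fixes the same partitions as rotation by \<open>N\<close>. For
  \<open>e = 1\<close> all partitions are fixed and the cycle lemma counts them; for
  \<open>e >= 2\<close> the periodic walks do.\<close>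

lemma card_rot_fixed_eval:
  assumes X: "X * (q_fact a * q_fact b) = q_fact (a + b - 1)" and \<zeta>: "primitive_root_of_unity (b - 1) \<zeta>"
  shows "complex_eval (\<zeta> ^ d) X = of_nat (card {x \<in> NC a b. (rot_blocks (b - 1) ^^ d) x = x})"
proof -
  define N where "N = gcd d (b - 1)"
  define e where "e = (b - 1) div N"
  have n0: "0 < b - 1" using slope.b_gt_1 by simp
  have b1: "b = Suc (b - 1)" using n0 by simp
  have eN: "b - 1 = e * N" by (simp add: e_def N_def)
  have N0: "0 < N" "0 < e" using n0 eN by (auto intro!: gr0I)
  have pow: "(\<zeta> ^ d) ^ j = 1 \<longleftrightarrow> e dvd j" for j
  proof -
    obtain d' where d': "d = d' * N" using gcd_dvd1[of d "b - 1"] unfolding N_def by (metis dvd_def mult.commute)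
    have "coprime d' e"
    proof -
      have "N * gcd d' e = gcd (N * d') (N * e)" by (simp add: gcd_mult_distrib_nat)
      also have "\<dots> = N" using d' eN N_def by (metis mult.commute)
      finally show ?thesis using N0 by (simp add: coprime_iff_gcd_eq_1)
    qed
    have "(\<zeta> ^ d) ^ j = 1 \<longleftrightarrow> e * N dvd d' * N * j"
      using primitive_root_pow_eq_1_iff[OF \<zeta> n0, of "d * j"] eN d' by (simp add: power_mult)
    also have "\<dots> \<longleftrightarrow> e dvd d' * j" using N0 by (metis dvd_times_right_cancel_iff mult.assoc mult.commute not_less_iff_gr_or_eq)
    also have "\<dots> \<longleftrightarrow> e dvd j" using \<open>coprime d' e\<close> by (simp add: coprime_dvd_mult_right_iff coprime_commute)
    finally show ?thesis .
  qed
  show ?thesis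
  proof (cases "e = 1")
    case True
    then have z: "\<zeta> ^ d = 1" using pow[of 1] by simp
    have "slope.shift_rel (int N) R = R" if "R \<in> slope.nc_rels" for R
      using slope.nc_rels_period[OF that, of 1] True eN int_period by simp
    then have "{R \<in> slope.nc_rels. slope.shift_rel (int N) R = R} = slope.nc_rels" by blast
    then have c: "card {x \<in> NC a b. (rot_blocks (b - 1) ^^ d) x = x} = card slope.nc_rels"
      using card_rot_fixed[of d] unfolding N_def[symmetric] by simp
    have "b * card slope.nc_rels = (a + b - 1) choose a" using slope.card_nc_rels(1) by simp
    then have "of_nat b * of_nat (card slope.nc_rels) = of_nat b * complex_eval 1 X"
      using q_Catalan_eval_1[OF X] n0 by (simp flip: of_nat_mult)
    then show ?thesis unfolding z c using n0 by simp
  next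
    case False
    then have e2: "2 \<le> e" using N0 by simp
    interpret periodic_slope "int a" "int b" "int N" "int e"
    proof
      show "0 < int N" "2 \<le> int e" using N0 e2 by simp_all
      show "int b - 1 = int e * int N" using int_period eN by (metis of_nat_mult)
    qed
    have "card {x \<in> NC a b. (rot_blocks (b - 1) ^^ d) x = x} = (N + a div e) choose (a div e)"
      using card_rot_fixed[of d] card_fixed_nc_rels unfolding N_def[symmetric] by (simp flip: of_nat_div)
    moreover have "complex_eval (\<zeta> ^ d) X = of_nat ((N + a div e) choose (a div e))"
      using q_Catalan_eval[of X a "b - 1" "\<zeta> ^ d" e N] X a_pos pow e2 eN b1 by simp
    ultimately show ?thesis by simp
  qed
qed

end

theorem theorem5p3:
  fixes a b :: nat
  assumes "0 < a" and "a < b" and "coprime a b"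
  shows "\<exists>X :: int poly.
           to_fract X = q_Catalan a b \<and>
           q_Catalan a b =
             to_fract (q_fact (a + b - 1)) / (to_fract (q_fact a) * to_fract (q_fact b)) \<and>
           cyclic_sieving (NC a b) (integer_mod_group (b - 1)) (1 mod int (b - 1))
             (rot_action a b) X"
proof -
  interpret rational_slope a b using assms by unfold_locales
  have b0: "0 < b" and n0: "0 < b - 1" using assms by auto
  obtain X where X: "X * (q_fact a * q_fact b) = q_fact (a + b - 1)"
    using q_Catalan_poly_exists[OF assms(1) b0 assms(3)] by blast
  \<comment> \<open>The reduction in \<open>?c\<close> matters for \<open>b = 2\<close>, where the
    group is trivial and its generator is \<open>0\<close>.\<close>
  let ?C = "integer_mod_group (b - 1)" and ?c = "1 mod int (b - 1)"
  have quot: "q_Catalan a b = to_fract (q_fact (a + b - 1)) / (to_fract (q_fact a) * to_fract (q_fact b))"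
  proof -
    have "q_fact (a + b) = q_fact (a + b - 1) * q_int (a + b)"
      using q_fact_Suc[of "a + b - 1"] assms by simp
    then show ?thesis using q_int_nonzero[of "a + b"] assms unfolding q_Catalan_def q_multinomial_def by simp
  qed
  have XC: "to_fract X = q_Catalan a b"
  proof -
    have "to_fract X * (to_fract (q_fact a) * to_fract (q_fact b)) = to_fract (q_fact (a + b - 1))"
      using arg_cong[OF X, of to_fract] by simp
    then show ?thesis unfolding quot using q_fact_nonzero by (simp add: field_simps)
  qed
  have carr: "carrier ?C = {0..<int (b - 1)}" using n0 by (simp add: carrier_integer_mod_group)
  have c: "?c \<in> carrier ?C" using n0 unfolding carr by simp
  have gen: "generate ?C {?c} = carrier ?C"
  proof -
    have "generate ?C {?c} = {(k * ?c) mod int (b - 1) |k. k \<in> (UNIV :: int set)}"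
      using group.generate_pow[OF group_integer_mod_group c] by (simp add: int_pow_integer_mod_group)
    also have "\<dots> = {k mod int (b - 1) |k. k \<in> (UNIV :: int set)}"
      by (simp add: mod_mult_right_eq)
    also have "\<dots> = {0..<int (b - 1)}"
    proof (intro equalityI subsetI)
      fix x assume "x \<in> {0..<int (b - 1)}"
      then have "x = x mod int (b - 1)" by simp
      then show "x \<in> {k mod int (b - 1) |k. k \<in> (UNIV :: int set)}" by blast
    qed (use n0 in auto)
    finally show ?thesis using carr by simp
  qed
  have fix_eq: "{x \<in> NC a b. rot_action a b (?c [^]\<^bsub>?C\<^esub> d) x = x} = {x \<in> NC a b. (rot_blocks (b - 1) ^^ d) x = x}" for d :: nat
  proof -
    have "?c [^]\<^bsub>?C\<^esub> d = int (d mod (b - 1))" by (simp add: mod_mult_right_eq zmod_int)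
    then have "rot_action a b (?c [^]\<^bsub>?C\<^esub> d) x = (rot_blocks (b - 1) ^^ d) x" if "x \<in> NC a b" for x
      using that rot_pow_mod[OF that, of d] by (simp add: rot_action_def)
    then show ?thesis by auto
  qed
  have "cyclic_sieving (NC a b) ?C ?c (rot_action a b) X"
    unfolding cyclic_sieving_def
  proof (intro conjI allI impI)
    show "finite (NC a b)" by (rule finite_NC)
    show "finite (carrier ?C)" unfolding carr by simp
    show "?c \<in> carrier ?C" "generate ?C {?c} = carrier ?C" by (rule c, rule gen)
    show "group_action ?C (NC a b) (rot_action a b)" by (rule rot_action_group_action)
    show "0 \<le> coeff X i" for i by (rule q_Catalan_coeff_nonneg[OF assms(1) b0 X])
    fix \<zeta> :: complex and d :: nat assume "primitive_root_of_unity (Coset.order ?C) \<zeta>"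
    moreover have "Coset.order ?C = b - 1" unfolding Coset.order_def carr by simp
    ultimately show "poly (map_poly complex_of_int X) (\<zeta> ^ d) =
        of_nat (card {x \<in> NC a b. rot_action a b (?c [^]\<^bsub>?C\<^esub> d) x = x})"
      using card_rot_fixed_eval[OF X, of \<zeta> d] unfolding fix_eq complex_eval_def by simp
  qed
  then show ?thesis using XC quot by blast
qed

end
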